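(* Let $T^2$ be the $2$-torus, and identify $H_1(T^2;\mathbb{R})\simeq\mathbb{R}^2$ so that the lattice of integral classes $H_1(T^2;\mathbb{Z})_{\mathbb{R}}$ is identified with $\mathbb{Z}^2$. Let $\|\cdot\|_\infty$ be a strictly convex norm on $H_1(T^2;\mathbb{R})$ and let $\langle h_j=(a_j,b_j)\rangle_{j=1}^{\infty}$ be a sequence consisting of all of the integral homology classes $H_1(T^2;\mathbb{Z})_{\mathbb{R}}\simeq\mathbb{Z}^2$ (an enumeration of $\mathbb{Z}^2$), where $\|(a_j,b_j)\|_\infty\le\|(a_{j+1},b_{j+1})\|_\infty$ for each $j$. Then there exists a sequence $\langle\|\cdot\|_j\rangle_{j=1}^{\infty}$ of toral stable norms such that (i) for each $k\in\mathbb{N}$ we have $\|(a_j,b_j)\|_k=\|(a_j,b_j)\|_\infty$ for $1\le j\le k$, while $\|(a_j,b_j)\|_k\ge\|(a_k,b_k)\|_\infty$ for all $j\ge k+1$; (ii) $\lim_{j\to\infty}\|\cdot\|_j=\|\cdot\|_\infty$ in the topology of compact convergence (uniform convergence on compact subsets of $\mathbb{R}^2$).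
   Context: A norm $\|\cdot\|$ on $\mathbb{R}^2$ is strictly convex if $\|x+y\|<\|x\|+\|y\|$ for all linearly independent $x,y\in\mathbb{R}^2$. Stable norm: given a smooth Riemannian metric $g$ on $T^2$ with length functional $L_g$, for $h\in H_1(T^2;\mathbb{Z})_{\mathbb{R}}\simeq\mathbb{Z}^2$ let $f(h)=\inf\{L_g(\sigma):\sigma\text{ is a smooth loop representing the class }h\}$, and for $n\in\mathbb{N}$ define $f_n:\frac1n H_1(T^2;\mathbb{Z})_{\mathbb{R}}\to\mathbb{R}_{\ge0}$ by $f_n(h)=\frac1n f(nh)$. The $f_n$ converge uniformly on compact sets to a norm $\|\cdot\|_s$ on $H_1(T^2;\mathbb{R})\simeq\mathbb{R}^2$, called the stable norm of $g$; that is, if $v_n\in H_1(T^2;\mathbb{Z})_{\mathbb{R}}$ and $v_n/n\to v$, then $\|v\|_s=\lim_{n\to\infty}f(v_n)/n$. A toral stable norm is the stable norm of some Riemannian metric on $T^2$. *)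

theory Defs
  imports "HOL-Analysis.Analysis"
begin

definition is_norm :: "(real \<times> real \<Rightarrow> real) \<Rightarrow> bool" where
  "is_norm N \<longleftrightarrow>
     (\<forall>x. 0 \<le> N x) \<and> (\<forall>x. N x = 0 \<longleftrightarrow> x = 0) \<and>
     (\<forall>c x. N (c *\<^sub>R x) = \<bar>c\<bar> * N x) \<and>
     (\<forall>x y. N (x + y) \<le> N x + N y)"

text \<open>Linear independence of the pair \<open>x, y\<close> is independence of the set \<open>{x, y}\<close> together
  with \<open>x \<noteq> y\<close>, as \<open>{x, x}\<close> collapses to a singleton.\<close>

definition strictly_convex_norm :: "(real \<times> real \<Rightarrow> real) \<Rightarrow> bool" where
  "strictly_convex_norm N \<longleftrightarrow> is_norm N \<and>
     (\<forall>x y. x \<noteq> y \<and> independent {x, y} \<longrightarrow> N (x + y) < N x + N y)"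

text \<open>The map \<open>f\<close> is of class \<open>C\<^sup>k\<close>: all its iterated directional derivatives up to order \<open>k\<close>
  exist and are continuous.\<close>

primrec C_class :: "nat \<Rightarrow> ('a::real_normed_vector \<Rightarrow> 'b::real_normed_vector) \<Rightarrow> bool" where
  "C_class 0 f \<longleftrightarrow> continuous_on UNIV f"
| "C_class (Suc k) f \<longleftrightarrow> (\<forall>x. f differentiable (at x)) \<and>
     (\<forall>v. C_class k (\<lambda>x. frechet_derivative f (at x) v))"

definition smooth :: "('a::real_normed_vector \<Rightarrow> 'b::real_normed_vector) \<Rightarrow> bool" where
  "smooth f \<longleftrightarrow> (\<forall>k. C_class k f)"

text \<open>The torus \<open>T\<^sup>2\<close> is the quotient of \<open>\<real>\<^sup>2\<close> by the translation lattice \<open>\<int>\<^sup>2\<close>. Objects on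
  \<open>T\<^sup>2\<close> are given by their lifts to the universal cover \<open>\<real>\<^sup>2\<close>, and an integral homology class
  is identified with the corresponding deck translation, i.e. with a vector of \<open>\<int>\<^sup>2\<close>.\<close>

abbreviation lattice :: "(real \<times> real) set" where
  "lattice \<equiv> \<int> \<times> \<int>"

text \<open>A Riemannian metric on \<open>T\<^sup>2\<close> is a \<open>\<int>\<^sup>2\<close>-periodic smooth family \<open>g p\<close> of inner products on
  the tangent spaces \<open>\<real>\<^sup>2\<close>.\<close>

definition torus_metric ::
  "(real \<times> real \<Rightarrow> real \<times> real \<Rightarrow> real \<times> real \<Rightarrow> real) \<Rightarrow> bool" where
  "torus_metric g \<longleftrightarrow>
     (\<forall>p. bilinear (g p)) \<and>
     (\<forall>p v w. g p v w = g p w v) \<and>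
     (\<forall>p v. v \<noteq> 0 \<longrightarrow> 0 < g p v v) \<and>
     (\<forall>v w. smooth (\<lambda>p. g p v w)) \<and>
     (\<forall>z \<in> lattice. \<forall>p. g (p + z) = g p)"

text \<open>A smooth loop \<open>\<real>/\<int> \<rightarrow> T\<^sup>2\<close> represents the class \<open>h\<close> iff its lifts \<open>\<sigma> : \<real> \<rightarrow> \<real>\<^sup>2\<close> satisfy
  \<open>\<sigma> (t + 1) = \<sigma> t + h\<close>; being smooth as a loop, it has no corner at its base point.\<close>

definition loop_in_class :: "real \<times> real \<Rightarrow> (real \<Rightarrow> real \<times> real) \<Rightarrow> bool" where
  "loop_in_class h \<sigma> \<longleftrightarrow> smooth \<sigma> \<and> (\<forall>t. \<sigma> (t + 1) = \<sigma> t + h)"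

definition riem_length ::
  "(real \<times> real \<Rightarrow> real \<times> real \<Rightarrow> real \<times> real \<Rightarrow> real) \<Rightarrow> (real \<Rightarrow> real \<times> real) \<Rightarrow> real" where
  "riem_length g \<sigma> = integral {0..1}
     (\<lambda>t. sqrt (g (\<sigma> t) (vector_derivative \<sigma> (at t)) (vector_derivative \<sigma> (at t))))"

definition min_length ::
  "(real \<times> real \<Rightarrow> real \<times> real \<Rightarrow> real \<times> real \<Rightarrow> real) \<Rightarrow> real \<times> real \<Rightarrow> real" where
  "min_length g h = (INF \<sigma> \<in> {\<sigma>. loop_in_class h \<sigma>}. riem_length g \<sigma>)"

text \<open>\<open>N\<close> is the limit, uniformly on compact sets, of the functions
  \<open>h \<mapsto> min_length g (n h) / n\<close>. The \<open>n\<close>-th of them is only defined on \<open>(1/n) \<int>\<^sup>2\<close>, which is why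
  \<open>uniform_limit\<close> on a fixed set does not apply. As these sets become dense, \<open>N\<close> is unique.\<close>

definition is_stable_norm ::
  "(real \<times> real \<Rightarrow> real \<times> real \<Rightarrow> real \<times> real \<Rightarrow> real) \<Rightarrow> (real \<times> real \<Rightarrow> real) \<Rightarrow> bool" where
  "is_stable_norm g N \<longleftrightarrow> is_norm N \<and>
     (\<forall>K. compact K \<longrightarrow> (\<forall>e>0. \<forall>\<^sub>F n in sequentially.
        \<forall>h \<in> K. real n *\<^sub>R h \<in> lattice \<longrightarrow>
          \<bar>min_length g (real n *\<^sub>R h) / real n - N h\<bar> < e))"

definition toral_stable_norm :: "(real \<times> real \<Rightarrow> real) \<Rightarrow> bool" where
  "toral_stable_norm N \<longleftrightarrow> (\<exists>g. torus_metric g \<and> is_stable_norm g N)"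

end

theory Submission
  imports Defs
begin

text \<open>It suffices to find, for each finite set of lattice vectors, a toral stable norm that agrees there
  with the given norm \<open>N\<close>: applied to large balls of the lattice, agreement and homogeneity give
  uniform convergence.

  Choose pairwise non-parallel representatives \<open>i\<close> of the directions and functionals \<open>L i \<le> N\<close> with
  \<open>L i \<bullet> i = N i\<close>; strict convexity gives \<open>\<bar>L l \<bullet> i\<bar> < N i\<close> for \<open>l \<noteq> i\<close>. Deform each \<open>L i\<close> to a
  closed 1-form \<open>\<theta> i\<close> in the same cohomology class which near each point of \<open>(1/M) \<int>\<^sup>2\<close> is
  \<open>\<tau>\<close> times the Euclidean dual of the unit vector of \<open>i\<close>; for suitable \<open>M\<close> the closed lines through
  \<open>0\<close> in the chosen directions cross only at such points. Then \<open>\<bar>\<theta> l i\<bar> < \<theta> i i\<close> along the line of \<open>i\<close>.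
  A metric which is \<open>\<tau>\<^sup>2 \<bar>v\<bar>\<^sup>2\<close> near the crossings, \<open>(\<theta> i)\<^sup>2\<close> along the line of \<open>i\<close>, and very large
  transversally to the lines and away from them, dominates all \<open>(\<theta> l)\<^sup>2\<close>, so that \<open>\<theta> i\<close> calibrates
  the line of \<open>i\<close>, which is therefore a shortest loop of length \<open>N i\<close>.\<close>

text \<open>All chosen lines pass through 0. A metric calibrated there by the constant forms
  \<open>L i\<close> would need \<open>g i i = (N i)\<^sup>2\<close> for every \<open>i\<close>, and
  an inner product cannot match a general \<open>N\<close> in more than three directions. This is
  why the forms are made Euclidean at the crossings. If \<open>cross i x\<close> and
  \<open>cross l x\<close> are integers, then \<open>cross i l *\<^sub>R x\<close> is an integral
  combination of \<open>i\<close> and \<open>l\<close>; so \<open>M\<close> is a common multiple of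
  these determinants. The inequalities between the forms are strict, hence domination is an open
  condition near the lines, and compactness then yields one constant for the transversal
  enlargement. The lower bound in (i) also comes from closeness: a norm that agrees with
  \<open>N\<close> on a large lattice ball is at least \<open>N / 2\<close> everywhere, and the
  \<open>k\<close>-th ball is so large that \<open>N\<close> is at least \<open>2 * N (h k)\<close>
  outside it. That a metric has a stable norm at all is proved by homogenizing its minimal lengths,
  which are subadditive up to a constant.\<close>

section \<open>Smooth functions\<close>

lemma C_class_SucI:
  assumes "\<And>x. (f has_derivative D x) (at x)" "\<And>v. C_class k (\<lambda>x. D x v)"
  shows "C_class (Suc k) f"
proof -
  have "frechet_derivative f (at x) = D x" for x
    using frechet_derivative_at[OF assms(1)] by simp
  then show ?thesis
    using assms by (auto simp: differentiable_def)
qed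

lemma C_class_SucD:
  assumes "C_class (Suc k) f"
  shows "(f has_derivative frechet_derivative f (at x)) (at x)"
    and "C_class k (\<lambda>x. frechet_derivative f (at x) v)"
  using assms by (auto simp: frechet_derivative_works)

lemma C_class_mono: "C_class (Suc k) f \<Longrightarrow> C_class k f"
proof (induction k arbitrary: f)
  case 0
  then show ?case
    by (auto intro!: continuous_at_imp_continuous_on differentiable_imp_continuous_within)
next
  case (Suc k)
  then show ?case by (auto simp del: C_class.simps(1))
qed

lemma C_class_continuous: "C_class k f \<Longrightarrow> continuous_on UNIV f"
  by (induction k) (use C_class_mono in \<open>auto intro!: continuous_at_imp_continuous_on differentiable_imp_continuous_within\<close>)

lemma C_class_const: "C_class k (\<lambda>x. c)"
proof (induction k arbitrary: c)
  case (Suc k)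
  show ?case by (rule C_class_SucI[where D="\<lambda>x v. 0"]) (auto intro: Suc)
qed auto

lemma C_class_bounded_linear: 
  assumes "bounded_linear f" shows "C_class k f"
proof (cases k)
  case 0
  then show ?thesis using assms by (auto intro: linear_continuous_on)
next
  case (Suc j)
  show ?thesis unfolding Suc
    by (rule C_class_SucI[where D="\<lambda>x. f"]) (auto intro: bounded_linear.has_derivative[OF assms] C_class_const bounded_linear_imp_has_derivative assms)
qed

lemma C_class_add:
  assumes "C_class k f" "C_class k g" shows "C_class k (\<lambda>x. f x + g x)"
  using assms
proof (induction k arbitrary: f g)
  case 0
  then show ?case by (auto intro: continuous_intros)
next
  case (Suc k)
  show ?case
    by (rule C_class_SucI[OF has_derivative_add[OF C_class_SucD(1)[OF Suc.prems(1)] C_class_SucD(1)[OF Suc.prems(2)]]])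
      (intro Suc.IH C_class_SucD(2) Suc.prems)
qed

lemma C_class_bounded_linear_compose:
  assumes h: "bounded_linear h" and "C_class k f" shows "C_class k (\<lambda>x. h (f x))"
  using assms(2)
proof (induction k arbitrary: f)
  case 0
  then show ?case by (auto intro: bounded_linear.continuous_on[OF h])
next
  case (Suc k)
  show ?case
    by (rule C_class_SucI[OF bounded_linear.has_derivative[OF h C_class_SucD(1)[OF Suc.prems]]])
      (intro Suc.IH C_class_SucD(2) Suc.prems)
qed

lemma C_class_scaleR:
  fixes f :: "'a::real_normed_vector \<Rightarrow> real" and g :: "'a \<Rightarrow> 'b::real_normed_vector"
  assumes "C_class k f" "C_class k g" shows "C_class k (\<lambda>x. f x *\<^sub>R g x)"
  using assms
proof (induction k arbitrary: f g)
  case 0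
  then show ?case by (auto intro: continuous_intros)
next
  case (Suc k)
  show ?case
    by (rule C_class_SucI[OF has_derivative_scaleR[OF C_class_SucD(1)[OF Suc.prems(1)] C_class_SucD(1)[OF Suc.prems(2)]]])
      (intro C_class_add Suc.IH C_class_SucD(2) Suc.prems C_class_mono[OF Suc.prems(1)] C_class_mono[OF Suc.prems(2)])
qed

text \<open>With a real argument the derivative of the outer function is a scalar times its value at
  1. The chain rule thus produces a product of two functions, to which \<open>C_class_scaleR\<close>
  and the induction hypothesis apply.\<close>

lemma C_class_compose:
  fixes f :: "real \<Rightarrow> 'b::real_normed_vector" and u :: "'a::real_normed_vector \<Rightarrow> real"
  assumes "C_class k f" "C_class k u" shows "C_class k (\<lambda>x. f (u x))"
  using assms
proof (induction k arbitrary: f)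
  case 0
  then show ?case by (auto intro: continuous_on_compose2)
next
  case (Suc k)
  let ?f' = "\<lambda>s. frechet_derivative f (at s) 1"
  have f': "frechet_derivative f (at s) v = v *\<^sub>R ?f' s" for s v
    using linear_cmul[OF has_derivative_linear[OF C_class_SucD(1)[OF Suc.prems(1)]], of s v 1] by simp
  show ?case
  proof (rule C_class_SucI)
    show "((\<lambda>x. f (u x)) has_derivative (\<lambda>v. frechet_derivative u (at x) v *\<^sub>R ?f' (u x))) (at x)" for x
      using diff_chain_at[OF C_class_SucD(1)[OF Suc.prems(2)] C_class_SucD(1)[OF Suc.prems(1)], of x]
      by (simp add: o_def f'[of "u x" "frechet_derivative u (at x) _"])
    show "C_class k (\<lambda>x. frechet_derivative u (at x) v *\<^sub>R ?f' (u x))" for v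
      by (intro C_class_scaleR C_class_SucD(2) Suc C_class_mono[OF Suc.prems(2)])
  qed
qed

lemma C_class_local:
  assumes "\<And>x. \<exists>U g. open U \<and> x \<in> U \<and> C_class k g \<and> (\<forall>y\<in>U. f y = g y)"
  shows "C_class k f"
  using assms
proof (induction k arbitrary: f)
  case 0
  have "isCont f x" for x
  proof -
    obtain U g where U: "open U" "x \<in> U" "C_class 0 g" "\<forall>y\<in>U. f y = g y"
      using 0 by blast
    then have "isCont g x" by (simp add: continuous_on_eq_continuous_at)
    then show ?thesis
      using U isCont_cong[of f g x] eventually_nhds by (metis (mono_tags, lifting))
  qed
  then show ?case by (simp add: continuous_at_imp_continuous_on)
next
  case (Suc k)
  have loc: "(f has_derivative frechet_derivative g (at y)) (at y)"
    if "open U" "y \<in> U" "C_class (Suc k) g" "\<forall>y\<in>U. f y = g y" for U g y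
    by (rule has_derivative_transform_within_open[OF C_class_SucD(1)[OF that(3)]])
      (use that in auto)
  show ?case
  proof (rule C_class_SucI)
    show der: "(f has_derivative frechet_derivative f (at x)) (at x)" for x
      using loc Suc.prems[of x] frechet_derivative_at by metis
    show "C_class k (\<lambda>x. frechet_derivative f (at x) v)" for v
    proof (rule Suc.IH)
      fix x
      obtain U g where U: "open U" "x \<in> U" "C_class (Suc k) g" "\<forall>y\<in>U. f y = g y"
        using Suc.prems by blast
      then have "\<forall>y\<in>U. frechet_derivative f (at y) v = frechet_derivative g (at y) v"
        using loc frechet_derivative_at by metis
      then show "\<exists>U g. open U \<and> x \<in> U \<and> C_class k g \<and> (\<forall>y\<in>U. frechet_derivative f (at y) v = g y)"
        using U C_class_SucD(2) by blast
    qed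
  qed
qed

lemma C_class_inverse:
  fixes f :: "'a::real_normed_vector \<Rightarrow> real"
  assumes "\<And>x. f x \<noteq> 0" "C_class k f" shows "C_class k (\<lambda>x. inverse (f x))"
  using assms(2)
proof (induction k)
  case 0
  then show ?case using assms(1) by (auto intro: continuous_intros)
next
  case (Suc k)
  show ?case
  proof (rule C_class_SucI)
    show "((\<lambda>x. inverse (f x)) has_derivative
        (\<lambda>v. (-1) *\<^sub>R (inverse (f x) *\<^sub>R frechet_derivative f (at x) v *\<^sub>R inverse (f x)))) (at x)" for x
      using Deriv.has_derivative_inverse[OF assms(1) C_class_SucD(1)[OF Suc.prems]] by (simp add: mult_ac)
    show "C_class k (\<lambda>x. (-1) *\<^sub>R (inverse (f x) *\<^sub>R frechet_derivative f (at x) v *\<^sub>R inverse (f x)))" for v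
      by (intro C_class_scaleR C_class_SucD(2) Suc C_class_mono[OF Suc.prems] C_class_const)
  qed
qed

named_theorems smooth_intros

lemma smooth_const [smooth_intros]: "smooth (\<lambda>x. c)"
  by (simp add: smooth_def C_class_const)

lemma smooth_bounded_linear: "bounded_linear f \<Longrightarrow> smooth f"
  by (simp add: smooth_def C_class_bounded_linear)

lemma smooth_ident [smooth_intros]: "smooth (\<lambda>x. x)"
  by (intro smooth_bounded_linear bounded_linear_ident)

lemma smooth_fst [smooth_intros]: "smooth fst"
  and smooth_snd [smooth_intros]: "smooth snd"
  by (intro smooth_bounded_linear bounded_linear_fst bounded_linear_snd)+

lemma smooth_inner [smooth_intros]: "smooth (\<lambda>x. a \<bullet> x)"
  by (intro smooth_bounded_linear bounded_linear_inner_right)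

lemma smooth_inner_left: "smooth f \<Longrightarrow> smooth (\<lambda>x. a \<bullet> f x)"
  unfolding smooth_def using C_class_bounded_linear_compose[OF bounded_linear_inner_right] by blast

lemma smooth_add [smooth_intros]: "smooth f \<Longrightarrow> smooth g \<Longrightarrow> smooth (\<lambda>x. f x + g x)"
  by (simp add: smooth_def C_class_add)

lemma smooth_scaleR [smooth_intros]: "smooth f \<Longrightarrow> smooth g \<Longrightarrow> smooth (\<lambda>x. f x *\<^sub>R g x)"
  by (simp add: smooth_def C_class_scaleR)

lemma smooth_mult [smooth_intros]:
  "smooth f \<Longrightarrow> smooth g \<Longrightarrow> smooth (\<lambda>x. f x * g x :: real)"
  using smooth_scaleR[of f g] by simp

lemma smooth_power [smooth_intros]: "smooth f \<Longrightarrow> smooth (\<lambda>x. f x ^ n :: real)"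
  by (induction n) (auto intro!: smooth_intros)

lemma smooth_minus [smooth_intros]: "smooth f \<Longrightarrow> smooth (\<lambda>x. - f x)"
  using smooth_scaleR[of "\<lambda>x. -1" f] by (simp add: smooth_const)

lemma smooth_diff [smooth_intros]: "smooth f \<Longrightarrow> smooth g \<Longrightarrow> smooth (\<lambda>x. f x - g x)"
  using smooth_add[of f "\<lambda>x. - g x"] by (simp add: smooth_minus)

lemma smooth_sum [smooth_intros]:
  "(\<And>i. i \<in> I \<Longrightarrow> smooth (f i)) \<Longrightarrow> smooth (\<lambda>x. \<Sum>i\<in>I. f i x)"
  by (induction I rule: infinite_finite_induct) (auto intro!: smooth_intros)

lemma smooth_prod [smooth_intros]:
  "(\<And>i. i \<in> I \<Longrightarrow> smooth (f i)) \<Longrightarrow> smooth (\<lambda>x. \<Prod>i\<in>I. f i x :: real)"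
  by (induction I rule: infinite_finite_induct) (auto intro!: smooth_intros)

lemma smooth_compose:
  fixes f :: "real \<Rightarrow> 'b::real_normed_vector"
  shows "smooth f \<Longrightarrow> smooth u \<Longrightarrow> smooth (\<lambda>x. f (u x))"
  by (simp add: smooth_def C_class_compose)

lemma smooth_Pair [smooth_intros]:
  fixes f :: "'a::real_normed_vector \<Rightarrow> real" and g :: "'a \<Rightarrow> real"
  assumes "smooth f" "smooth g" shows "smooth (\<lambda>x. (f x, g x))"
proof -
  have eq: "(\<lambda>x. (f x, g x)) = (\<lambda>x. f x *\<^sub>R (1, 0) + g x *\<^sub>R (0, 1))" by auto
  show ?thesis unfolding eq by (intro smooth_intros assms)
qed

lemma smooth_inverse:
  "smooth f \<Longrightarrow> (\<And>x. f x \<noteq> 0) \<Longrightarrow> smooth (\<lambda>x. inverse (f x :: real))"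
  by (simp add: smooth_def C_class_inverse)

lemma smooth_local:
  assumes "\<And>x. \<exists>U g. open U \<and> x \<in> U \<and> smooth g \<and> (\<forall>y\<in>U. f y = g y)"
  shows "smooth f"
  unfolding smooth_def by (intro allI C_class_local) (use assms in \<open>meson smooth_def\<close>)

lemma smooth_has_derivative:
  "smooth f \<Longrightarrow> (f has_derivative frechet_derivative f (at x)) (at x)"
  unfolding smooth_def using C_class_SucD(1) by blast

lemma smooth_frechet_derivative:
  "smooth f \<Longrightarrow> smooth (\<lambda>x. frechet_derivative f (at x) v)"
  unfolding smooth_def using C_class_SucD(2) by blast

lemma smooth_continuous_on: "smooth f \<Longrightarrow> continuous_on S f"
  unfolding smooth_def using C_class_continuous continuous_on_subset by blast

lemma smooth_has_vector_derivative:
  "smooth f \<Longrightarrow> (f has_vector_derivative vector_derivative f (at t)) (at t)"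
  using smooth_has_derivative by (metis differentiableI vector_derivative_works)

lemma vector_derivative_eq_frechet:
  "smooth f \<Longrightarrow> vector_derivative f (at t) = frechet_derivative f (at t) 1"
  using smooth_has_vector_derivative[of f t] frechet_derivative_at[of f]
  by (fastforce simp: has_vector_derivative_def)

lemma smooth_vector_derivative: "smooth f \<Longrightarrow> smooth (\<lambda>t. vector_derivative f (at t))"
  by (simp add: vector_derivative_eq_frechet smooth_frechet_derivative)

lemma smooth_sin: "smooth (sin :: real \<Rightarrow> real)"
proof -
  have "C_class k (sin :: real \<Rightarrow> real) \<and> C_class k (cos :: real \<Rightarrow> real)" for k
  proof (induction k)
    case 0
    then show ?case by (auto intro: continuous_intros)
  next
    case (Suc k)
    have *: "C_class (Suc k) f" if "\<And>x. (f has_real_derivative c * f' x) (at x)" "C_class k f'"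
      for f f' :: "real \<Rightarrow> real" and c
    proof (rule C_class_SucI)
      show "(f has_derivative (\<lambda>v. (c * v) *\<^sub>R f' x)) (at x)" for x
        using that(1)[of x] unfolding has_field_derivative_def
        by (rule has_derivative_eq_rhs) (simp add: fun_eq_iff)
    qed (intro C_class_scaleR C_class_const that(2))
    have "C_class (Suc k) (sin :: real \<Rightarrow> real)"
      by (rule *[where c=1 and f'=cos]) (use Suc in \<open>auto intro: DERIV_sin\<close>)
    moreover have "C_class (Suc k) (cos :: real \<Rightarrow> real)"
      by (rule *[where c="-1" and f'=sin]) (use Suc in \<open>auto intro: DERIV_cos\<close>)
    ultimately show ?case by blast
  qed
  then show ?thesis by (simp add: smooth_def)
qed

section \<open>A smooth step function and a smooth staircase\<close>

definition flat_exp :: "nat \<Rightarrow> real \<Rightarrow> real" where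
  "flat_exp n x = (if x \<le> 0 then 0 else inverse x ^ n * exp (- inverse x))"

lemma flat_exp_tendsto_0: "((\<lambda>x. flat_exp n x) \<longlongrightarrow> 0) (at_right 0)"
proof -
  have "((\<lambda>y::real. y ^ n / exp y) \<longlongrightarrow> 0) at_top"
    by (rule tendsto_power_div_exp_0)
  then have "((\<lambda>x::real. inverse x ^ n / exp (inverse x)) \<longlongrightarrow> 0) (at_right 0)"
    by (rule filterlim_compose) (rule filterlim_inverse_at_top_right)
  then show ?thesis
    by (rule Lim_transform_eventually)
      (auto simp: flat_exp_def eventually_at_filter exp_minus field_simps)
qed

text \<open>The factors \<open>inverse x ^ n\<close> make the family closed under differentiation:
  each derivative is a combination of two later members. Smoothness then follows by an induction
  that treats all \<open>n\<close> at once.\<close>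

lemma flat_exp_DERIV:
  "(flat_exp n has_real_derivative (flat_exp (n + 2) x - of_nat n * flat_exp (n + 1) x)) (at x)"
proof -
  consider "x < 0" | "x = 0" | "x > 0" by linarith
  then show ?thesis
  proof cases
    case 1
    have "((\<lambda>x. 0) has_real_derivative 0) (at x)" by simp
    then have "(flat_exp n has_real_derivative 0) (at x)"
      by (rule has_field_derivative_transform_within_open[where S="{..<0}"])
        (use 1 in \<open>auto simp: flat_exp_def\<close>)
    then show ?thesis using 1 by (simp add: flat_exp_def)
  next
    case 3
    have "((\<lambda>x. inverse x ^ n * exp (- inverse x)) has_real_derivative
        (flat_exp (n + 2) x - of_nat n * flat_exp (n + 1) x)) (at x)"
      using 3 power_eq_if[of "inverse x" n]
      by (auto intro!: derivative_eq_intros simp: flat_exp_def algebra_simps power2_eq_square)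
    then show ?thesis
      by (rule has_field_derivative_transform_within_open[where S="{0<..}"])
        (use 3 in \<open>auto simp: flat_exp_def\<close>)
  next
    case 2
    \<comment> \<open>The difference quotient at 0 is again a member of the family, so the
      derivative there is the limit of that member.\<close>
    have eq: "(flat_exp n y - flat_exp n 0) / (y - 0) = flat_exp (Suc n) y" for y
      by (auto simp: flat_exp_def field_simps)
    have "((\<lambda>y. flat_exp (Suc n) y) \<longlongrightarrow> 0) (at 0)"
    proof (rule filterlim_split_at)
      show "(flat_exp (Suc n) \<longlongrightarrow> 0) (at_left 0)"
        by (rule Lim_transform_eventually[OF tendsto_const])
          (auto simp: flat_exp_def eventually_at_filter)
    qed (rule flat_exp_tendsto_0)
    then have "(flat_exp n has_real_derivative 0) (at 0)"
      unfolding has_field_derivative_iff eq .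
    then show ?thesis using 2 by (simp add: flat_exp_def)
  qed
qed

lemma smooth_flat_exp: "smooth (flat_exp n)"
proof -
  have "C_class k (flat_exp n)" for k
  proof (induction k arbitrary: n)
    case 0
    then show ?case
      using DERIV_isCont[OF flat_exp_DERIV] by (auto intro!: continuous_at_imp_continuous_on)
  next
    case (Suc k)
    show ?case
    proof (rule C_class_SucI)
      show "(flat_exp n has_derivative
        (\<lambda>v. v *\<^sub>R (flat_exp (n + 2) x + (- of_nat n) *\<^sub>R flat_exp (n + 1) x))) (at x)" for x
        using flat_exp_DERIV[of n x] unfolding has_field_derivative_def
        by (rule has_derivative_eq_rhs) (simp add: fun_eq_iff)
      show "C_class k (\<lambda>x. v *\<^sub>R (flat_exp (n + 2) x + (- of_nat n) *\<^sub>R flat_exp (n + 1) x))" for v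
        by (intro C_class_add C_class_scaleR C_class_const Suc)
    qed
  qed
  then show ?thesis by (simp add: smooth_def)
qed

lemma flat_exp_mono: "x \<le> y \<Longrightarrow> flat_exp 0 x \<le> flat_exp 0 y"
  by (auto simp: flat_exp_def)

lemma flat_exp_nonneg: "0 \<le> flat_exp 0 x"
  and flat_exp_pos_iff: "0 < flat_exp 0 x \<longleftrightarrow> 0 < x"
  by (auto simp: flat_exp_def)

definition smooth_step :: "real \<Rightarrow> real" where
  "smooth_step x = flat_exp 0 x * inverse (flat_exp 0 x + flat_exp 0 (1 - x))"

lemma flat_exp_add_pos: "0 < flat_exp 0 x + flat_exp 0 (1 - x)"
  using flat_exp_pos_iff[of x] flat_exp_pos_iff[of "1 - x"] flat_exp_nonneg[of x] flat_exp_nonneg[of "1 - x"]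
  by linarith

lemma smooth_smooth_step: "smooth smooth_step"
proof -
  have "smooth (\<lambda>x. flat_exp 0 (1 - x))"
    by (intro smooth_compose[OF smooth_flat_exp] smooth_intros)
  then show ?thesis
    unfolding smooth_step_def[abs_def] using flat_exp_add_pos
    by (intro smooth_intros smooth_inverse smooth_flat_exp) (auto simp: less_le)
qed

lemma smooth_step_eq_0: "x \<le> 0 \<Longrightarrow> smooth_step x = 0"
  and smooth_step_eq_1: "1 \<le> x \<Longrightarrow> smooth_step x = 1"
  by (auto simp: smooth_step_def flat_exp_def)

lemma smooth_step_mono: assumes "x \<le> y" shows "smooth_step x \<le> smooth_step y"
proof -
  have "flat_exp 0 x * (flat_exp 0 y + flat_exp 0 (1 - y)) \<le> flat_exp 0 y * (flat_exp 0 x + flat_exp 0 (1 - x))"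
    using mult_mono[OF flat_exp_mono[OF assms] flat_exp_mono[of "1 - y" "1 - x"]] assms flat_exp_nonneg
    by (simp add: algebra_simps)
  then show ?thesis
    using flat_exp_add_pos[of x] flat_exp_add_pos[of y] by (simp add: smooth_step_def field_simps)
qed

lemma smooth_step_bounds: "0 \<le> smooth_step x" "smooth_step x \<le> 1"
  using smooth_step_mono[of "min x 0" x] smooth_step_mono[of x "max x 1"]
  by (auto simp: smooth_step_eq_0 smooth_step_eq_1)

text \<open>It climbs by 1 in the first quarter of each period and rests for the other three. Four
  shifted copies can therefore drive the four pieces of a joined loop in turn; the resting intervals
  also yield \<open>sawtooth\<close>.\<close>

definition staircase :: "real \<Rightarrow> real" where
  "staircase t = of_int \<lfloor>t\<rfloor> + smooth_step (4 * frac t)"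

text \<open>The formula of one period extends back over the resting part of the preceding one. Every
  point, integers included, thus has a neighbourhood on which a single smooth formula holds.\<close>

lemma staircase_eq:
  assumes "of_int n - 3/4 \<le> t" "t \<le> of_int n + 1"
  shows "staircase t = of_int n + smooth_step (4 * (t - of_int n))"
proof -
  consider "t < of_int n" | "of_int n \<le> t" "t < of_int n + 1" | "t = of_int n + 1"
    using assms by linarith
  then show ?thesis
  proof cases
    case 1
    then have "\<lfloor>t\<rfloor> = n - 1" using assms by linarith
    then show ?thesis
      using 1 assms by (simp add: staircase_def frac_def smooth_step_eq_0 smooth_step_eq_1)
  next
    case 2
    then have "\<lfloor>t\<rfloor> = n" by linarith
    then show ?thesis by (simp add: staircase_def frac_def)
  next
    case 3
    then have "\<lfloor>t\<rfloor> = n + 1" by linarith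
    then show ?thesis using 3 by (simp add: staircase_def frac_def smooth_step_eq_0 smooth_step_eq_1)
  qed
qed

lemma smooth_staircase: "smooth staircase"
proof (rule smooth_local)
  fix t :: real
  let ?n = "of_int \<lfloor>t\<rfloor> :: real"
  let ?U = "{?n - 3/4<..<?n + 1}"
  have "smooth (\<lambda>t. ?n + smooth_step (4 * (t - ?n)))"
    by (intro smooth_intros smooth_compose[OF smooth_smooth_step])
  moreover have "open ?U" "t \<in> ?U" by (auto, linarith+)
  moreover have "\<forall>y\<in>?U. staircase y = ?n + smooth_step (4 * (y - ?n))"
    using staircase_eq by auto
  ultimately show "\<exists>U g. open U \<and> t \<in> U \<and> smooth g \<and> (\<forall>y\<in>U. staircase y = g y)"
    by blast
qed

lemma staircase_add_1: "staircase (t + 1) = staircase t + 1"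
  by (simp add: staircase_def frac_def algebra_simps)

lemma staircase_eq_0: "- 3/4 \<le> t \<Longrightarrow> t \<le> 0 \<Longrightarrow> staircase t = 0"
  using staircase_eq[of 0 t] by (simp add: smooth_step_eq_0)

lemma staircase_eq_1: "1/4 \<le> t \<Longrightarrow> t \<le> 1 \<Longrightarrow> staircase t = 1"
  using staircase_eq[of 0 t] by (simp add: smooth_step_eq_1)

section \<open>Homogenization of almost subadditive functions on the lattice\<close>

text \<open>Adding \<open>K\<close> makes the sequence subadditive, and the argument of Fekete's
  lemma applies: dividing \<open>n\<close> by a fixed \<open>m\<close> with remainder bounds
  \<open>b n / n\<close> by \<open>b m / m\<close> up to a vanishing error, so the limit is the
  infimum.\<close>

lemma almost_subadditive_converges:
  fixes a :: "nat \<Rightarrow> real"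
  assumes sub: "\<And>m n. a (m + n) \<le> a m + a n + K" and nonneg: "\<And>n. 0 \<le> a n" and K: "0 \<le> K"
  shows "convergent (\<lambda>n. a n / real n)"
proof -
  define b where "b n = a n + K" for n
  have b0: "0 \<le> b n" for n using nonneg[of n] K by (simp add: b_def)
  have bmul: "b (q * m + r) \<le> real q * b m + b r" for q m r
  proof (induction q)
    case (Suc q)
    have "b (Suc q * m + r) = b (m + (q * m + r))" by (simp add: add.assoc)
    also have "\<dots> \<le> b m + b (q * m + r)" using sub[of m "q * m + r"] by (simp add: b_def)
    finally show ?case using Suc by (simp add: algebra_simps)
  qed simp
  define L where "L = (INF n\<in>{1..}. b n / real n)"
  have bdd: "bdd_below ((\<lambda>n. b n / real n) ` {1..})"
    by (rule bdd_belowI[of _ 0]) (auto simp: b0)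
  have L_le: "L \<le> b n / real n" if "n \<ge> 1" for n
    unfolding L_def by (rule cINF_lower[OF bdd]) (use that in auto)
  have "(\<lambda>n. b n / real n) \<longlonglongrightarrow> L"
  proof (rule LIMSEQ_I)
    fix e :: real assume e: "e > 0"
    have "\<exists>m\<in>{1..}. b m / real m < L + e / 2"
      using e cINF_less_iff[OF _ bdd, of "L + e / 2"] by (auto simp: L_def)
    then obtain m where m: "m \<ge> 1" "b m / real m < L + e / 2" by auto
    define B where "B = (\<Sum>r<m. b r)"
    have B: "b r \<le> B" if "r < m" for r
      unfolding B_def by (rule member_le_sum) (use that b0 in auto)
    obtain N where N: "real N > 2 * B / e" using reals_Archimedean2 by blast
    have "norm (b n / real n - L) < e" if n: "n \<ge> max N 1" for n
    proof -
      have n0: "real n > 0" and nN: "real n \<ge> real N" using n by auto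
      have "b n \<le> real (n div m) * b m + b (n mod m)"
        using bmul[of "n div m" m "n mod m"] by simp
      also have "\<dots> \<le> real n * (b m / real m) + B"
      proof -
        have "real (n div m) * real m \<le> real n"
          using of_nat_mono[OF div_times_less_eq_dividend[of n m], where 'a=real] by simp
        then have "real (n div m) \<le> real n / real m" using m by (simp add: field_simps)
        then have "real (n div m) * b m \<le> real n / real m * b m"
          by (rule mult_right_mono) (rule b0)
        then show ?thesis using B[of "n mod m"] m by (simp add: mult.commute)
      qed
      finally have "b n / real n \<le> b m / real m + B / real n"
        using n0 by (simp add: field_simps)
      moreover have "B / real n < e / 2"
        using less_le_trans[OF N nN] n0 e by (simp add: field_simps)
      ultimately have "b n / real n < L + e" using m by linarith
      then show ?thesis using L_le[of n] n by auto
    qed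
    then show "\<exists>no. \<forall>n\<ge>no. norm (b n / real n - L) < e" by blast
  qed
  moreover have "(\<lambda>n. K / real n) \<longlonglongrightarrow> 0" by (rule lim_const_over_n)
  ultimately have "(\<lambda>n. b n / real n - K / real n) \<longlonglongrightarrow> L - 0" by (rule tendsto_diff)
  then have "(\<lambda>n. a n / real n) \<longlonglongrightarrow> L"
    by (simp add: b_def diff_divide_distrib[symmetric])
  then show ?thesis by (rule convergentI)
qed

definition lattice_floor :: "real \<times> real \<Rightarrow> real \<times> real" where
  "lattice_floor x = (of_int \<lfloor>fst x\<rfloor>, of_int \<lfloor>snd x\<rfloor>)"

lemma lattice_floor_in_lattice [simp]: "lattice_floor x \<in> lattice"
  by (simp add: lattice_floor_def)

lemma norm_lattice_floor_diff: "norm (lattice_floor x - x) \<le> 2"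
proof -
  have "norm (lattice_floor x - x) \<le> \<bar>of_int \<lfloor>fst x\<rfloor> - fst x\<bar> + \<bar>of_int \<lfloor>snd x\<rfloor> - snd x\<bar>"
    using norm_Pair_le[of "of_int \<lfloor>fst x\<rfloor> - fst x" "of_int \<lfloor>snd x\<rfloor> - snd x"]
    by (cases x) (simp add: lattice_floor_def)
  then show ?thesis by linarith
qed

lemma lattice_add: "x \<in> lattice \<Longrightarrow> y \<in> lattice \<Longrightarrow> x + y \<in> lattice"
  and lattice_diff: "x \<in> lattice \<Longrightarrow> y \<in> lattice \<Longrightarrow> x - y \<in> lattice"
  and lattice_minus: "x \<in> lattice \<Longrightarrow> - x \<in> lattice"
  by (auto simp: mem_Times_iff)

lemma lattice_of_nat_scaleR: "x \<in> lattice \<Longrightarrow> real n *\<^sub>R x \<in> lattice"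
  by (auto simp: mem_Times_iff)

lemma tendsto_const_over_nat_bound:
  fixes u v :: "nat \<Rightarrow> real"
  assumes "(\<lambda>n. u n / real n) \<longlonglongrightarrow> l" "\<And>n. \<bar>u n - v n\<bar> \<le> D"
  shows "(\<lambda>n. v n / real n) \<longlonglongrightarrow> l"
proof -
  have "(\<lambda>n. v n / real n - u n / real n) \<longlonglongrightarrow> 0"
  proof (rule Lim_null_comparison)
    show "\<forall>\<^sub>F n in sequentially. norm (v n / real n - u n / real n) \<le> D / real n"
      using assms(2) by (intro always_eventually allI)
        (auto simp: diff_divide_distrib[symmetric] abs_minus_commute intro: divide_right_mono)
  qed (rule lim_const_over_n)
  from tendsto_add[OF this assms(1)] show ?thesis by simp
qed

text \<open>The properties of \<open>min_length g\<close> from which the stable norm is built. The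
  defect \<open>K\<close> accounts for the fact that loops in two classes need not meet and have to
  be joined by a path.\<close>

locale coarse_norm =
  fixes f :: "real \<times> real \<Rightarrow> real" and K c C :: real
  assumes subadd: "\<And>a b. a \<in> lattice \<Longrightarrow> b \<in> lattice \<Longrightarrow> f (a + b) \<le> f a + f b + K"
    and sym: "\<And>a. a \<in> lattice \<Longrightarrow> f (- a) = f a"
    and lower: "\<And>a. a \<in> lattice \<Longrightarrow> c * norm a \<le> f a"
    and upper: "\<And>a. a \<in> lattice \<Longrightarrow> f a \<le> C * norm a"
    and pos: "0 < c" "0 \<le> C" "0 \<le> K"
begin

lemma close:
  assumes "a \<in> lattice" "b \<in> lattice" shows "\<bar>f a - f b\<bar> \<le> C * norm (a - b) + K"
  using subadd[of b "a - b"] subadd[of a "b - a"] upper[of "a - b"] upper[of "b - a"] assms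
  by (simp add: lattice_diff norm_minus_commute)

lemma close_bounded:
  assumes "a \<in> lattice" "b \<in> lattice" "norm (a - b) \<le> D" shows "\<bar>f a - f b\<bar> \<le> C * D + K"
  using close[OF assms(1,2)] mult_left_mono[OF assms(3) pos(2)] by linarith

definition homogenization :: "real \<times> real \<Rightarrow> real" where
  "homogenization x = lim (\<lambda>n. f (lattice_floor (real n *\<^sub>R x)) / real n)"

lemma homogenization_lim_floor:
  "(\<lambda>n. f (lattice_floor (real n *\<^sub>R x)) / real n) \<longlonglongrightarrow> homogenization x"
proof -
  have "convergent (\<lambda>n. f (lattice_floor (real n *\<^sub>R x)) / real n)"
  proof (rule almost_subadditive_converges)
    fix m n :: nat
    let ?m = "lattice_floor (real m *\<^sub>R x)" and ?n = "lattice_floor (real n *\<^sub>R x)"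
      and ?mn = "lattice_floor (real (m + n) *\<^sub>R x)"
    have "norm (?mn - (?m + ?n)) \<le> norm (?mn - real (m + n) *\<^sub>R x)
        + norm ((?m - real m *\<^sub>R x) + (?n - real n *\<^sub>R x))"
      using norm_triangle_ineq4[of "?mn - real (m + n) *\<^sub>R x" "(?m - real m *\<^sub>R x) + (?n - real n *\<^sub>R x)"]
      by (simp add: algebra_simps)
    \<comment> \<open>Three roundings, each off by at most 2.\<close>
    also have "\<dots> \<le> 6"
      using norm_lattice_floor_diff[of "real (m + n) *\<^sub>R x"] norm_lattice_floor_diff[of "real m *\<^sub>R x"]
        norm_lattice_floor_diff[of "real n *\<^sub>R x"]
        norm_triangle_ineq[of "?m - real m *\<^sub>R x" "?n - real n *\<^sub>R x"] by linarith
    finally have "\<bar>f ?mn - f (?m + ?n)\<bar> \<le> C * 6 + K"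
      by (intro close_bounded lattice_floor_in_lattice lattice_add)
    then show "f ?mn \<le> f ?m + f ?n + (C * 6 + K + K)"
      using subadd[of ?m ?n] by simp
  next
    show "0 \<le> f (lattice_floor (real n *\<^sub>R x))" for n
      using lower[OF lattice_floor_in_lattice, of "real n *\<^sub>R x"] pos
      by (meson less_imp_le mult_nonneg_nonneg norm_ge_zero order_trans)
  qed (use pos in auto)
  then show ?thesis unfolding homogenization_def by (simp add: convergent_LIMSEQ_iff)
qed

text \<open>Moving the lattice points by a bounded amount changes \<open>f\<close> by a bounded
  amount, which disappears after division by \<open>n\<close>. The norm axioms below follow by
  choosing lattice points adapted to each of them.\<close>

lemma homogenization_lim:
  assumes "\<And>n. u n \<in> lattice" "\<And>n. norm (u n - real n *\<^sub>R x) \<le> D"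
  shows "(\<lambda>n. f (u n) / real n) \<longlonglongrightarrow> homogenization x"
proof (rule tendsto_const_over_nat_bound[OF homogenization_lim_floor])
  fix n
  have "norm (lattice_floor (real n *\<^sub>R x) - u n) \<le> 2 + D"
    using norm_triangle_ineq4[of "lattice_floor (real n *\<^sub>R x) - real n *\<^sub>R x" "u n - real n *\<^sub>R x"]
      norm_lattice_floor_diff[of "real n *\<^sub>R x"] assms(2)[of n] by simp
  then show "\<bar>f (lattice_floor (real n *\<^sub>R x)) - f (u n)\<bar> \<le> C * (2 + D) + K"
    by (intro close_bounded lattice_floor_in_lattice assms(1))
qed

lemma homogenization_eq:
  assumes "x \<in> lattice" "\<And>n. f (real n *\<^sub>R x) = real n * l"
  shows "homogenization x = l"
proof -
  have "(\<lambda>n. f (real n *\<^sub>R x) / real n) \<longlonglongrightarrow> homogenization x"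
    by (rule homogenization_lim[where D=0]) (use assms in \<open>auto intro: lattice_of_nat_scaleR\<close>)
  moreover have "(\<lambda>n. f (real n *\<^sub>R x) / real n) \<longlonglongrightarrow> l"
    by (rule tendsto_eventually) (use assms in \<open>auto simp: eventually_sequentially intro!: exI[of _ 1]\<close>)
  ultimately show ?thesis using LIMSEQ_unique by blast
qed

lemma homogenization_triangle:
  "homogenization (x + y) \<le> homogenization x + homogenization y"
proof -
  let ?u = "\<lambda>n. lattice_floor (real n *\<^sub>R x)" and ?v = "\<lambda>n. lattice_floor (real n *\<^sub>R y)"
  have "(\<lambda>n. f (?u n + ?v n) / real n) \<longlonglongrightarrow> homogenization (x + y)"
  proof (rule homogenization_lim)
    show "norm (?u n + ?v n - real n *\<^sub>R (x + y)) \<le> 4" for n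
      using norm_triangle_ineq[of "?u n - real n *\<^sub>R x" "?v n - real n *\<^sub>R y"]
        norm_lattice_floor_diff[of "real n *\<^sub>R x"] norm_lattice_floor_diff[of "real n *\<^sub>R y"]
      by (simp add: algebra_simps)
  qed (intro lattice_add lattice_floor_in_lattice)
  moreover have "(\<lambda>n. f (?u n) / real n + f (?v n) / real n + K / real n)
      \<longlonglongrightarrow> homogenization x + homogenization y + 0"
    by (intro tendsto_add homogenization_lim_floor lim_const_over_n)
  moreover have "f (?u n + ?v n) / real n \<le> f (?u n) / real n + f (?v n) / real n + K / real n" for n
    using divide_right_mono[OF subadd[of "?u n" "?v n"], of "real n"] by (simp add: add_divide_distrib)
  ultimately show ?thesis using LIMSEQ_le by fastforce
qed

lemma homogenization_minus: "homogenization (- x) = homogenization x"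
proof -
  let ?u = "\<lambda>n. lattice_floor (real n *\<^sub>R x)"
  have "(\<lambda>n. f (- ?u n) / real n) \<longlonglongrightarrow> homogenization (- x)"
  proof (rule homogenization_lim)
    show "norm (- ?u n - real n *\<^sub>R (- x)) \<le> 2" for n
      using norm_lattice_floor_diff[of "real n *\<^sub>R x"] norm_minus_cancel[of "?u n - real n *\<^sub>R x"] by simp
  qed (intro lattice_minus lattice_floor_in_lattice)
  then show ?thesis
    using LIMSEQ_unique[OF homogenization_lim_floor[of x]] by (simp add: sym)
qed

lemma homogenization_bounds:
  "c * norm x \<le> homogenization x" "homogenization x \<le> C * norm x"
proof -
  let ?u = "\<lambda>n. lattice_floor (real n *\<^sub>R x)"
  have nrm: "real n * norm x - 2 \<le> norm (?u n)" "norm (?u n) \<le> real n * norm x + 2" for n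
    using norm_lattice_floor_diff[of "real n *\<^sub>R x"] norm_triangle_ineq3[of "?u n" "real n *\<^sub>R x"]
    by (simp_all add: abs_le_iff)
  have "(\<lambda>n. c * norm x - 2 * c / real n) \<longlonglongrightarrow> c * norm x - 0"
    by (intro tendsto_diff tendsto_const lim_const_over_n)
  moreover have "\<forall>n\<ge>1. c * norm x - 2 * c / real n \<le> f (?u n) / real n"
  proof (intro allI impI)
    fix n :: nat assume "1 \<le> n"
    then have eq: "c * (real n * norm x - 2) / real n = c * norm x - 2 * c / real n"
      by (simp add: field_simps)
    have "c * (real n * norm x - 2) \<le> f (?u n)"
      using mult_left_mono[OF nrm(1) less_imp_le[OF pos(1)], of n] lower[OF lattice_floor_in_lattice, of "real n *\<^sub>R x"]
      by linarith
    then show "c * norm x - 2 * c / real n \<le> f (?u n) / real n"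
      unfolding eq[symmetric] by (rule divide_right_mono) simp
  qed
  ultimately show "c * norm x \<le> homogenization x"
    using LIMSEQ_le[OF _ homogenization_lim_floor] by fastforce
  have "(\<lambda>n. C * norm x + 2 * C / real n) \<longlonglongrightarrow> C * norm x + 0"
    by (intro tendsto_add tendsto_const lim_const_over_n)
  moreover have "\<forall>n\<ge>1. f (?u n) / real n \<le> C * norm x + 2 * C / real n"
  proof (intro allI impI)
    fix n :: nat assume "1 \<le> n"
    moreover have "f (?u n) \<le> C * (real n * norm x + 2)"
      using mult_left_mono[OF nrm(2), of C n] upper[of "?u n"] pos by simp
    ultimately show "f (?u n) / real n \<le> C * norm x + 2 * C / real n"
      by (simp add: field_simps)
  qed
  ultimately show "homogenization x \<le> C * norm x"
    using LIMSEQ_le[OF homogenization_lim_floor] by fastforce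
qed

lemma homogenization_scaleR_pos:
  assumes "a > 0" shows "homogenization (a *\<^sub>R x) = a * homogenization x"
proof -
  \<comment> \<open>The points near \<open>m n *\<^sub>R x\<close> serve two limits: they stay at
    bounded distance from \<open>n * a\<close> times \<open>x\<close>, and they run through the
    sequence defining \<open>homogenization x\<close>, with \<open>m n / n\<close> tending to
    \<open>a\<close>.\<close>
  define m where "m n = nat \<lfloor>real n * a\<rfloor>" for n
  have m: "real n * a - 1 \<le> real (m n)" "real (m n) \<le> real n * a" for n
  proof -
    have "real (m n) = of_int \<lfloor>real n * a\<rfloor>" using assms by (simp add: m_def)
    then show "real n * a - 1 \<le> real (m n)" "real (m n) \<le> real n * a" by linarith+
  qed
  let ?u = "\<lambda>n. lattice_floor (real n *\<^sub>R x)"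
  have "(\<lambda>n. f (?u (m n)) / real n) \<longlonglongrightarrow> homogenization (a *\<^sub>R x)"
  proof (rule homogenization_lim[where D="2 + norm x"])
    fix n
    have "norm (real (m n) *\<^sub>R x - real n *\<^sub>R a *\<^sub>R x) = \<bar>real (m n) - real n * a\<bar> * norm x"
      by (metis norm_scaleR scaleR_diff_left scaleR_scaleR)
    also have "\<dots> \<le> 1 * norm x" using m[of n] by (intro mult_right_mono) auto
    finally show "norm (?u (m n) - real n *\<^sub>R a *\<^sub>R x) \<le> 2 + norm x"
      using norm_lattice_floor_diff[of "real (m n) *\<^sub>R x"]
        norm_triangle_ineq[of "?u (m n) - real (m n) *\<^sub>R x" "real (m n) *\<^sub>R x - real n *\<^sub>R a *\<^sub>R x"] by simp
  qed simp
  moreover have "(\<lambda>n. f (?u (m n)) / real n) \<longlonglongrightarrow> homogenization x * a"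
  proof -
    have top: "filterlim m at_top sequentially"
    proof (rule filterlim_at_top[THEN iffD2], intro allI)
      fix Z :: nat
      obtain n0 :: nat where n0: "real n0 > (real Z + 1) / a" using reals_Archimedean2 by blast
      have "Z \<le> m n" if "n \<ge> n0" for n
      proof -
        have "(real Z + 1) / a < real n" using n0 that by (meson less_le_trans of_nat_le_iff)
        then have "real Z + 1 < real n * a" using assms by (simp add: field_simps)
        then show ?thesis using m[of n] by linarith
      qed
      then show "\<forall>\<^sub>F n in sequentially. Z \<le> m n" by (auto simp: eventually_sequentially)
    qed
    have "(\<lambda>n. real (m n) / real n) \<longlonglongrightarrow> a"
    proof (rule tendsto_const_over_nat_bound[where D=1])
      show "(\<lambda>n. (real n * a) / real n) \<longlonglongrightarrow> a"
        by (rule tendsto_eventually) (auto simp: eventually_sequentially intro!: exI[of _ 1])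
      show "\<bar>real n * a - real (m n)\<bar> \<le> 1" for n using m[of n] by linarith
    qed
    then have "(\<lambda>n. f (?u (m n)) / real (m n) * (real (m n) / real n)) \<longlonglongrightarrow> homogenization x * a"
      by (intro tendsto_mult filterlim_compose[OF homogenization_lim_floor top])
    moreover have "\<forall>\<^sub>F n in sequentially.
        f (?u (m n)) / real (m n) * (real (m n) / real n) = f (?u (m n)) / real n"
      using filterlim_at_top[THEN iffD1, OF top, rule_format, of 1] by eventually_elim auto
    ultimately show ?thesis by (rule Lim_transform_eventually)
  qed
  ultimately show ?thesis using LIMSEQ_unique by (fastforce simp: mult.commute)
qed

lemma homogenization_0: "homogenization 0 = 0"
  using homogenization_bounds[of 0] by simp

lemma is_norm_homogenization: "is_norm homogenization"
  unfolding is_norm_def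
proof (intro conjI allI)
  show "0 \<le> homogenization x" for x
    using homogenization_bounds(1)[of x] pos
    by (meson less_imp_le mult_nonneg_nonneg norm_ge_zero order_trans)
  show "homogenization x = 0 \<longleftrightarrow> x = 0" for x
    using homogenization_bounds(1)[of x] pos mult_pos_pos[of c "norm x"] homogenization_0 by fastforce
  show "homogenization (a *\<^sub>R x) = \<bar>a\<bar> * homogenization x" for a x
    using homogenization_scaleR_pos[of a x] homogenization_scaleR_pos[of "- a" x]
      homogenization_minus[of "a *\<^sub>R x"] homogenization_0
    by (cases a "0 :: real" rule: linorder_cases) auto
  show "homogenization (x + y) \<le> homogenization x + homogenization y" for x y
    by (rule homogenization_triangle)
qed

lemma homogenization_lipschitz: "\<bar>homogenization x - homogenization y\<bar> \<le> C * norm (x - y)"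
  using homogenization_triangle[of y "x - y"] homogenization_triangle[of x "y - x"]
    homogenization_bounds(2)[of "x - y"] homogenization_bounds(2)[of "y - x"]
  by (simp add: norm_minus_commute)

text \<open>Pointwise convergence is uniform on a finite net. Both \<open>f\<close>, up to a
  constant that division by \<open>n\<close> removes, and its homogenization are Lipschitz, so the
  estimate passes from the net to all of \<open>S\<close>.\<close>

lemma homogenization_uniform:
  assumes "compact S" "e > 0"
  shows "\<forall>\<^sub>F n in sequentially. \<forall>h\<in>S. real n *\<^sub>R h \<in> lattice \<longrightarrow>
           \<bar>f (real n *\<^sub>R h) / real n - homogenization h\<bar> < e"
proof -
  \<comment> \<open>Four errors below \<open>e / 4\<close> are added at the end, two of them of size
    \<open>C * d\<close>. The summand 1 covers \<open>C = 0\<close>.\<close>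
  define d where "d = e / (4 * (C + 1))"
  have d: "d > 0" "C * d < e / 4" using assms pos by (auto simp: d_def field_simps)
  obtain T where T: "finite T" "S \<subseteq> (\<Union>y\<in>T. ball y d)"
    using assms(1) d(1) compact_eq_totally_bounded by blast
  have "\<forall>\<^sub>F n in sequentially. \<forall>y\<in>T.
      \<bar>f (lattice_floor (real n *\<^sub>R y)) / real n - homogenization y\<bar> < e / 4"
    using T(1) assms(2) tendstoD[OF homogenization_lim_floor, of "e / 4"]
    by (intro eventually_ball_finite) (auto simp: dist_real_def)
  moreover have "\<forall>\<^sub>F n in sequentially. (2 * C + K) / real n < e / 4"
    using order_tendstoD(2)[OF lim_const_over_n, of "e / 4" "2 * C + K"] assms(2) by auto
  moreover have "\<forall>\<^sub>F n in sequentially. (1::nat) \<le> n" by (rule eventually_ge_at_top)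
  ultimately show ?thesis
  proof eventually_elim
    case (elim n)
    show ?case
    proof (intro ballI impI)
      fix h assume h: "h \<in> S" "real n *\<^sub>R h \<in> lattice"
      obtain y where y: "y \<in> T" "norm (h - y) < d"
        using T(2) h(1) by (auto simp: dist_norm norm_minus_commute)
      let ?y = "lattice_floor (real n *\<^sub>R y)"
      have Cd: "C * norm (h - y) \<le> C * d" using y pos by (intro mult_left_mono) auto
      have "norm (real n *\<^sub>R h - ?y) \<le> norm (real n *\<^sub>R (h - y)) + norm (?y - real n *\<^sub>R y)"
        using norm_triangle_ineq4[of "real n *\<^sub>R (h - y)" "?y - real n *\<^sub>R y"]
        by (simp add: algebra_simps)
      then have "norm (real n *\<^sub>R h - ?y) \<le> real n * norm (h - y) + 2"
        using norm_lattice_floor_diff[of "real n *\<^sub>R y"] by simp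
      then have "\<bar>f (real n *\<^sub>R h) - f ?y\<bar> \<le> C * (real n * norm (h - y) + 2) + K"
        by (intro close_bounded h lattice_floor_in_lattice)
      then have "\<bar>f (real n *\<^sub>R h) - f ?y\<bar> / real n \<le> C * norm (h - y) + (2 * C + K) / real n"
        using elim(3) by (simp add: field_simps)
      then have "\<bar>f (real n *\<^sub>R h) / real n - f ?y / real n\<bar> < e / 4 + e / 4"
        using elim(2) Cd d(2) by (simp only: diff_divide_distrib[symmetric] abs_divide abs_of_nat)
      then show "\<bar>f (real n *\<^sub>R h) / real n - homogenization h\<bar> < e"
        using elim(1)[rule_format, OF y(1)] homogenization_lipschitz[of h y] Cd d(2) by linarith
    qed
  qed
qed

end

section \<open>Existence of the stable norm\<close>

lemma deriv_nonneg_of_mono: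
  fixes f :: "real \<Rightarrow> real"
  assumes "mono f" "(f has_real_derivative l) (at x)" shows "0 \<le> l"
proof (rule ccontr)
  assume "\<not> 0 \<le> l"
  then obtain d where d: "d > 0" "\<forall>h>0. h < d \<longrightarrow> f x > f (x + h)"
    using DERIV_neg_dec_right[OF assms(2)] by auto
  have "f (x + d / 2) < f x" using d by simp
  then show False using monoD[OF assms(1), of x "x + d / 2"] d(1) by simp
qed

text \<open>At an endpoint of the interval the derivative exists by smoothness, and its one-sided
  value already determines it.\<close>

lemma vector_derivative_eq_0_of_constant:
  assumes "smooth S" "a < b" "t \<in> {a..b}" "\<And>s. s \<in> {a..b} \<Longrightarrow> S s = c"
  shows "vector_derivative S (at t) = 0"
proof (rule vector_derivative_unique_within_closed_interval[of a b t S])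
  show "(S has_vector_derivative vector_derivative S (at t)) (at t within cbox a b)"
    by (rule has_vector_derivative_at_within[OF smooth_has_vector_derivative[OF assms(1)]])
  show "(S has_vector_derivative 0) (at t within cbox a b)"
    by (rule has_vector_derivative_transform[OF _ _ has_vector_derivative_const[of c]])
      (use assms in auto)
qed (use assms in auto)

lemma smooth_has_real_derivative:
  fixes f :: "real \<Rightarrow> real"
  shows "smooth f \<Longrightarrow> (f has_real_derivative vector_derivative f (at t)) (at t)"
  using smooth_has_vector_derivative by (simp add: has_real_derivative_iff_has_vector_derivative)

lemma mono_staircase: "mono staircase"
proof (rule monoI)
  fix s t :: real assume "s \<le> t"
  then consider "\<lfloor>s\<rfloor> = \<lfloor>t\<rfloor>" | "\<lfloor>s\<rfloor> + 1 \<le> \<lfloor>t\<rfloor>" using floor_mono[of s t] by linarith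
  then show "staircase s \<le> staircase t"
  proof cases
    case 1
    then show ?thesis
      using \<open>s \<le> t\<close> by (simp add: staircase_def frac_def smooth_step_mono)
  next
    case 2
    then have "of_int \<lfloor>s\<rfloor> + 1 \<le> (of_int \<lfloor>t\<rfloor> :: real)" by linarith
    then show ?thesis
      using smooth_step_bounds[of "4 * frac s"] smooth_step_bounds[of "4 * frac t"]
      unfolding staircase_def by linarith
  qed
qed

lemma bilinear_expand:
  fixes B :: "real \<times> real \<Rightarrow> real \<times> real \<Rightarrow> real"
  assumes "bilinear B"
  shows "B v w = fst v * fst w * B (1, 0) (1, 0) + fst v * snd w * B (1, 0) (0, 1)
    + snd v * fst w * B (0, 1) (1, 0) + snd v * snd w * B (0, 1) (0, 1)"
proof -
  have "v = fst v *\<^sub>R (1, 0) + snd v *\<^sub>R (0, 1)" "w = fst w *\<^sub>R (1, 0) + snd w *\<^sub>R (0, 1)"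
    by (auto simp: prod_eq_iff)
  then have "B v w = B (fst v *\<^sub>R (1, 0) + snd v *\<^sub>R (0, 1)) (fst w *\<^sub>R (1, 0) + snd w *\<^sub>R (0, 1))"
    by simp
  also have "\<dots> = fst v * fst w * B (1, 0) (1, 0) + fst v * snd w * B (1, 0) (0, 1)
    + snd v * fst w * B (0, 1) (1, 0) + snd v * snd w * B (0, 1) (0, 1)"
    by (simp only: bilinear_ladd[OF assms] bilinear_radd[OF assms] bilinear_lmul[OF assms]
        bilinear_rmul[OF assms] real_scaleR_def) (simp add: algebra_simps)
  finally show ?thesis .
qed

definition speed ::
  "(real \<times> real \<Rightarrow> real \<times> real \<Rightarrow> real \<times> real \<Rightarrow> real) \<Rightarrow> (real \<Rightarrow> real \<times> real) \<Rightarrow> real \<Rightarrow> real" where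
  "speed g \<sigma> t = sqrt (g (\<sigma> t) (vector_derivative \<sigma> (at t)) (vector_derivative \<sigma> (at t)))"

lemma riem_length_speed: "riem_length g \<sigma> = integral {0..1} (speed g \<sigma>)"
  by (simp add: riem_length_def speed_def[abs_def])

lemma loop_translate:
  assumes "loop_in_class h \<sigma>"
  shows "loop_in_class h (\<lambda>t. \<sigma> t + z)"
    and "vector_derivative (\<lambda>t. \<sigma> t + z) (at t) = vector_derivative \<sigma> (at t)"
proof -
  have s: "smooth \<sigma>" using assms by (simp add: loop_in_class_def)
  show "loop_in_class h (\<lambda>t. \<sigma> t + z)"
    using assms by (auto simp: loop_in_class_def intro!: smooth_intros)
  have "((\<lambda>t. \<sigma> t + z) has_vector_derivative vector_derivative \<sigma> (at t) + 0) (at t)"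
    by (intro has_vector_derivative_add smooth_has_vector_derivative s has_vector_derivative_const)
  then show "vector_derivative (\<lambda>t. \<sigma> t + z) (at t) = vector_derivative \<sigma> (at t)"
    using vector_derivative_at by fastforce
qed

lemma loop_reverse:
  assumes "loop_in_class h \<sigma>"
  shows "loop_in_class (- h) (\<lambda>t. \<sigma> (1 - t))"
    and "vector_derivative (\<lambda>t. \<sigma> (1 - t)) (at t) = - vector_derivative \<sigma> (at (1 - t))"
proof -
  have s: "smooth \<sigma>" and p: "\<And>t. \<sigma> (t + 1) = \<sigma> t + h" using assms by (auto simp: loop_in_class_def)
  show "loop_in_class (- h) (\<lambda>t. \<sigma> (1 - t))"
    unfolding loop_in_class_def
  proof (intro conjI allI)
    show "smooth (\<lambda>t. \<sigma> (1 - t))" by (intro smooth_compose[OF s] smooth_intros)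
    show "\<sigma> (1 - (t + 1)) = \<sigma> (1 - t) + - h" for t using p[of "- t"] by (simp add: algebra_simps)
  qed
  have "((\<lambda>t. 1 - t) has_vector_derivative (-1::real)) (at t)"
    by (auto intro!: derivative_eq_intros)
  from vector_diff_chain_at[OF this smooth_has_vector_derivative[OF s]]
  show "vector_derivative (\<lambda>t. \<sigma> (1 - t)) (at t) = - vector_derivative \<sigma> (at (1 - t))"
    by (auto simp: o_def dest: vector_derivative_at)
qed

lemma straight_loop:
  shows "loop_in_class h (\<lambda>t. t *\<^sub>R h)" "vector_derivative (\<lambda>t. t *\<^sub>R h) (at t) = h"
proof -
  show "loop_in_class h (\<lambda>t. t *\<^sub>R h)"
    by (auto simp: loop_in_class_def algebra_simps intro!: smooth_intros)
  have "((\<lambda>t. t *\<^sub>R h) has_vector_derivative h) (at t)"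
    by (auto intro!: derivative_eq_intros)
  then show "vector_derivative (\<lambda>t. t *\<^sub>R h) (at t) = h" by (rule vector_derivative_at)
qed

text \<open>Substitution: a piece that is driven by the staircase through its whole parameter
  interval within a quarter of a period keeps its length.\<close>

lemma integral_staircase:
  fixes F :: "real \<Rightarrow> real"
  assumes "continuous_on UNIV F"
  shows "((\<lambda>t. vector_derivative (\<lambda>t. staircase (t - a)) (at t) * F (staircase (t - a)))
    has_integral integral {0..1} F) {a..a + 1/4}"
proof -
  let ?A = "\<lambda>t. staircase (t - a)"
  have s: "smooth ?A" by (intro smooth_compose[OF smooth_staircase] smooth_intros)
  have A: "?A a = 0" "?A (a + 1/4) = 1" by (auto simp: staircase_eq_0 staircase_eq_1)
  have "((\<lambda>t. vector_derivative ?A (at t) *\<^sub>R F (?A t)) has_integral integral {?A a..?A (a + 1/4)} F) {a..a + 1/4}"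
  proof (rule has_integral_substitution)
    show "?A ` {a..a + 1/4} \<subseteq> {0..1}"
    proof safe
      fix t assume "t \<in> {a..a + 1/4}"
      then show "?A t \<in> {0..1}"
        using monoD[OF mono_staircase, of 0 "t - a"] monoD[OF mono_staircase, of "t - a" "1/4"] A by auto
    qed
    show "(?A has_real_derivative vector_derivative ?A (at t)) (at t within {a..a + 1/4})" for t
      by (rule DERIV_subset[OF smooth_has_real_derivative[OF s]]) simp
  qed (use A assms in \<open>auto intro: continuous_on_subset\<close>)
  then show ?thesis by (simp only: A real_scaleR_def)
qed

locale torus =
  fixes g :: "real \<times> real \<Rightarrow> real \<times> real \<Rightarrow> real \<times> real \<Rightarrow> real"
  assumes torus_metric: "torus_metric g"
begin

lemma bilinear: "bilinear (g p)" and posdef: "v \<noteq> 0 \<Longrightarrow> 0 < g p v v"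
  and smooth_metric: "smooth (\<lambda>p. g p v w)" and periodic: "z \<in> lattice \<Longrightarrow> g (p + z) = g p"
  using torus_metric unfolding torus_metric_def by blast+

lemma metric_scaleR: "g p (a *\<^sub>R v) (a *\<^sub>R v) = a\<^sup>2 * g p v v"
  by (simp add: bilinear_lmul[OF bilinear] bilinear_rmul[OF bilinear] power2_eq_square)

lemma metric_minus: "g p (- v) (- v) = g p v v"
  using metric_scaleR[of p "-1" v] by simp

lemma metric_nonneg: "0 \<le> g p v v"
  using posdef[of v p] bilinear_lzero[OF bilinear, of p v] by (cases "v = 0") auto

lemma continuous_metric [continuous_intros]:
  assumes "continuous_on S p" "continuous_on S v" "continuous_on S w"
  shows "continuous_on S (\<lambda>t. g (p t) (v t) (w t))"
proof -
  have "continuous_on S (\<lambda>t. g (p t) a b)" for a b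
    by (rule continuous_on_compose2[OF smooth_continuous_on[OF smooth_metric, of UNIV] assms(1)]) simp
  then show ?thesis
    by (subst bilinear_expand[OF bilinear]) (intro continuous_intros assms)
qed

text \<open>Periodicity moves the base point into the unit cell and homogeneity makes
  \<open>v\<close> a unit vector. On the resulting compact set the speed attains a minimum, positive
  by definiteness, and a maximum.\<close>

lemma metric_bounds:
  obtains c C where "0 < c" "0 \<le> C" "\<And>p v. c * norm v \<le> sqrt (g p v v)"
    "\<And>p v. sqrt (g p v v) \<le> C * norm v"
proof -
  define S where "S = (cbox (0,0) (1,1) :: (real \<times> real) set) \<times> (sphere 0 1 :: (real \<times> real) set)"
  let ?f = "\<lambda>x. sqrt (g (fst x) (snd x) (snd x))"
  have S: "compact S" unfolding S_def by (intro compact_Times compact_cbox compact_sphere)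
  have "((0,0), (1,0)) \<in> S" by (auto simp: S_def norm_prod_def)
  then have ne: "S \<noteq> {}" by blast
  have cont: "continuous_on S ?f" by (intro continuous_intros)
  obtain x where x: "x \<in> S" "\<forall>y\<in>S. ?f x \<le> ?f y" using continuous_attains_inf[OF S ne cont] by blast
  obtain x' where x': "x' \<in> S" "\<forall>y\<in>S. ?f y \<le> ?f x'" using continuous_attains_sup[OF S ne cont] by blast
  have reduce: "\<exists>y\<in>S. sqrt (g p v v) = norm v * ?f y" if "v \<noteq> 0" for p v
  proof
    let ?q = "p - lattice_floor p" and ?w = "inverse (norm v) *\<^sub>R v"
    show "(?q, ?w) \<in> S"
      using that by (auto simp: S_def lattice_floor_def cbox_def Basis_prod_def inner_prod_def) linarith+
    have "g ?q = g p" using periodic[of "lattice_floor p" ?q] by simp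
    moreover have "v = norm v *\<^sub>R ?w" using that by simp
    then have "g p v v = (norm v)\<^sup>2 * g p ?w ?w" by (metis metric_scaleR)
    ultimately show "sqrt (g p v v) = norm v * ?f (?q, ?w)"
      by (simp add: real_sqrt_mult)
  qed
  show thesis
  proof (rule that[of "?f x" "?f x'"])
    have "norm (snd x) = 1" using x(1) by (auto simp: S_def)
    then show "0 < ?f x" using posdef[of "snd x" "fst x"] by fastforce
    show "0 \<le> ?f x'" by (simp add: metric_nonneg)
    fix p v
    show "?f x * norm v \<le> sqrt (g p v v)"
    proof (cases "v = 0")
      case False
      then obtain y where "y \<in> S" "sqrt (g p v v) = norm v * ?f y" using reduce by blast
      then show ?thesis using x(2) mult_left_mono[of "?f x" "?f y" "norm v"] by (simp add: mult.commute)
    qed (simp add: metric_nonneg)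
    show "sqrt (g p v v) \<le> ?f x' * norm v"
    proof (cases "v = 0")
      case False
      then obtain y where "y \<in> S" "sqrt (g p v v) = norm v * ?f y" using reduce by blast
      then show ?thesis using x'(2) mult_left_mono[of "?f y" "?f x'" "norm v"] by (simp add: mult.commute)
    qed (simp add: bilinear_lzero[OF bilinear])
  qed
qed

lemma continuous_speed: "smooth \<sigma> \<Longrightarrow> continuous_on S (speed g \<sigma>)"
  unfolding speed_def[abs_def]
  by (intro continuous_intros smooth_continuous_on smooth_vector_derivative)

lemma speed_integrable: "smooth \<sigma> \<Longrightarrow> speed g \<sigma> integrable_on {a..b}"
  by (intro integrable_continuous_interval continuous_speed)

lemma speed_nonneg: "0 \<le> speed g \<sigma> t"
  by (simp add: speed_def metric_nonneg)

lemma riem_length_nonneg: "loop_in_class h \<sigma> \<Longrightarrow> 0 \<le> riem_length g \<sigma>"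
  unfolding riem_length_speed by (intro integral_nonneg speed_integrable) (auto simp: loop_in_class_def speed_nonneg)

lemma min_length_le: "loop_in_class h \<sigma> \<Longrightarrow> min_length g h \<le> riem_length g \<sigma>"
  unfolding min_length_def by (intro cINF_lower bdd_belowI[of _ 0]) (auto simp: riem_length_nonneg)

lemma min_length_ge:
  "(\<And>\<sigma>. loop_in_class h \<sigma> \<Longrightarrow> l \<le> riem_length g \<sigma>) \<Longrightarrow> l \<le> min_length g h"
  unfolding min_length_def using straight_loop(1)[of h] by (intro cINF_greatest) auto

lemma riem_length_reverse:
  assumes "loop_in_class h \<sigma>" shows "riem_length g (\<lambda>t. \<sigma> (1 - t)) = riem_length g \<sigma>"
proof -
  have "smooth \<sigma>" using assms by (simp add: loop_in_class_def)
  have eq: "speed g (\<lambda>t. \<sigma> (1 - t)) = (\<lambda>t. speed g \<sigma> (1 - t))"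
    by (auto simp: speed_def loop_reverse(2)[OF assms] metric_minus)
  have "((\<lambda>t. (-1) *\<^sub>R speed g \<sigma> (1 - t)) has_integral
      (integral {1 - 0..1 - 1} (speed g \<sigma>) - integral {1 - 1..1 - 0} (speed g \<sigma>))) {0..1}"
    by (rule has_integral_substitution_general[where c=0 and d=1 and s="{}"])
      (auto intro!: continuous_intros continuous_speed derivative_eq_intros \<open>smooth \<sigma>\<close>)
  then have "((\<lambda>t. speed g \<sigma> (1 - t)) has_integral integral {0..1} (speed g \<sigma>)) {0..1}"
    by (drule_tac has_integral_neg) simp
  then show ?thesis unfolding riem_length_speed eq by (rule integral_unique)
qed

lemma min_length_minus: "min_length g (- h) = min_length g h"
proof -
  have *: "min_length g (- h) \<le> min_length g h" for h
    by (rule min_length_ge) (metis min_length_le loop_reverse(1) riem_length_reverse)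
  show ?thesis using *[of h] *[of "- h"] by simp
qed

text \<open>The loops are joined by a segment and its reverse. Each of the four pieces is traversed on a
  quarter of the unit interval, with vanishing velocity at its ends, which makes the join smooth.\<close>

lemma concatenate_loops:
  assumes \<sigma>: "loop_in_class a \<sigma>" and \<rho>: "loop_in_class b \<rho>" and d: "d = \<rho> 0 - \<sigma> 0 - a"
    and C: "\<And>p v. sqrt (g p v v) \<le> C * norm v"
  obtains \<gamma> where "loop_in_class (a + b) \<gamma>"
    "riem_length g \<gamma> \<le> riem_length g \<sigma> + riem_length g \<rho> + 2 * C * norm d"
proof -
  define A where "A k t = staircase (t - of_nat k / 4)" for k :: nat and t
  define A' where "A' k t = vector_derivative (A k) (at t)" for k t
  have s: "smooth \<sigma>" "smooth \<rho>" and p: "\<And>t. \<sigma> (t + 1) = \<sigma> t + a" "\<And>t. \<rho> (t + 1) = \<rho> t + b"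
    using assms by (auto simp: loop_in_class_def)
  have p1: "\<sigma> 1 = \<sigma> 0 + a" "\<rho> 1 = \<rho> 0 + b" using p[of 0] by auto
  have sA: "smooth (A k)" for k
    unfolding A_def[abs_def] by (intro smooth_compose[OF smooth_staircase] smooth_intros)
  have A_der: "(A k has_vector_derivative A' k t) (at t)" for k t
    unfolding A'_def by (rule smooth_has_vector_derivative[OF sA])
  have A_per: "A k (t + 1) = A k t + 1" for k t
    using staircase_add_1[of "t - real k / 4"] by (simp add: A_def algebra_simps)
  have A'_nonneg: "0 \<le> A' k t" for k t
  proof (rule deriv_nonneg_of_mono)
    show "mono (A k)" using mono_staircase by (auto simp: A_def mono_def)
    show "(A k has_real_derivative A' k t) (at t)"
      unfolding A'_def by (rule smooth_has_real_derivative[OF sA])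
  qed
  \<comment> \<open>During quarter \<open>k\<close> the earlier pieces are finished, the later ones
    have not started, and none of these contributes to the velocity.\<close>
  have A_const: "A j t = (if j < k then 1 else 0) \<and> A' j t = 0"
    if "j \<noteq> k" "j < 4" "k < 4" "t \<in> {of_nat k / 4..of_nat k / 4 + 1/4}" for j k :: nat and t
  proof -
    have eq: "A j s = (if j < k then 1 else 0)" if "s \<in> {of_nat k / 4..of_nat k / 4 + 1/4}" for s
    proof (cases "j < k")
      case True
      then have "real j + 1 \<le> real k" by linarith
      then show ?thesis using True that \<open>k < 4\<close> by (auto simp: A_def intro!: staircase_eq_1)
    next
      case False
      then have "real k + 1 \<le> real j" using \<open>j \<noteq> k\<close> by linarith
      then show ?thesis using False that \<open>j < 4\<close> by (auto simp: A_def intro!: staircase_eq_0)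
    qed
    have "vector_derivative (A j) (at t) = 0"
      by (rule vector_derivative_eq_0_of_constant[OF sA _ that(4) eq]) auto
    then show ?thesis using eq that(4) by (simp add: A'_def)
  qed
  \<comment> \<open>The vector \<open>d\<close> leads from the end \<open>\<sigma> 0 + a\<close> of
    the first loop to \<open>\<rho> 0\<close>. The last term retraces it, so that over a period only
    the translation by \<open>a + b\<close> remains.\<close>
  define \<gamma> where "\<gamma> t = \<sigma> (A 0 t) + A 1 t *\<^sub>R d + (\<rho> (A 2 t) - \<rho> 0) - A 3 t *\<^sub>R d" for t
  have sg: "smooth \<gamma>"
    unfolding \<gamma>_def[abs_def] by (intro smooth_intros smooth_compose[OF s(1)] smooth_compose[OF s(2)] sA)
  have loop: "loop_in_class (a + b) \<gamma>"
    unfolding loop_in_class_def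
  proof (intro conjI allI sg)
    show "\<gamma> (t + 1) = \<gamma> t + (a + b)" for t
      unfolding \<gamma>_def A_per p by (simp add: algebra_simps)
  qed
  have der: "vector_derivative \<gamma> (at t) = A' 0 t *\<^sub>R vector_derivative \<sigma> (at (A 0 t)) + A' 1 t *\<^sub>R d
      + A' 2 t *\<^sub>R vector_derivative \<rho> (at (A 2 t)) - A' 3 t *\<^sub>R d" for t
  proof (rule vector_derivative_at)
    have 1: "((\<lambda>t. \<sigma> (A 0 t)) has_vector_derivative A' 0 t *\<^sub>R vector_derivative \<sigma> (at (A 0 t))) (at t)"
      using vector_diff_chain_at[OF A_der smooth_has_vector_derivative[OF s(1)]] by (simp add: o_def)
    have 2: "((\<lambda>t. \<rho> (A 2 t) - \<rho> 0) has_vector_derivative A' 2 t *\<^sub>R vector_derivative \<rho> (at (A 2 t)) - 0) (at t)"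
      using vector_diff_chain_at[OF A_der smooth_has_vector_derivative[OF s(2)]]
      by (intro has_vector_derivative_diff has_vector_derivative_const) (simp add: o_def)
    have 3: "((\<lambda>t. A k t *\<^sub>R d) has_vector_derivative A' k t *\<^sub>R d) (at t)" for k
      using has_vector_derivative_scaleR[OF _ has_vector_derivative_const, of "A k" "A' k t" t UNIV d] A_der[of k t]
      by (simp add: has_real_derivative_iff_has_vector_derivative)
    show "(\<gamma> has_vector_derivative A' 0 t *\<^sub>R vector_derivative \<sigma> (at (A 0 t)) + A' 1 t *\<^sub>R d
      + A' 2 t *\<^sub>R vector_derivative \<rho> (at (A 2 t)) - A' 3 t *\<^sub>R d) (at t)"
      using has_vector_derivative_diff[OF has_vector_derivative_add[OF has_vector_derivative_add[OF 1 3[of 1]] 2] 3[of 3]]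
      by (simp add: \<gamma>_def[abs_def])
  qed
  have scale: "sqrt (g q (A' k t *\<^sub>R v) (A' k t *\<^sub>R v)) = A' k t * sqrt (g q v v)" for q k t v
    using A'_nonneg[of k t] by (simp add: metric_scaleR real_sqrt_mult)
  have piece: "((\<lambda>t. A' k t * F (A k t)) has_integral integral {0..1} F) {of_nat k / 4..of_nat k / 4 + 1/4}"
    if "continuous_on UNIV F" for k F
    using integral_staircase[OF that, of "of_nat k / 4"] by (simp add: A_def A'_def[unfolded A_def])
  have int0: "integral {0..1/4} (speed g \<gamma>) = riem_length g \<sigma>"
  proof -
    have "integral {0..1/4} (speed g \<gamma>) = integral {0..1/4} (\<lambda>t. A' 0 t * speed g \<sigma> (A 0 t))"
    proof (rule integral_cong)
      fix t :: real assume "t \<in> {0..1/4}"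
      then have "\<gamma> t = \<sigma> (A 0 t)" "vector_derivative \<gamma> (at t) = A' 0 t *\<^sub>R vector_derivative \<sigma> (at (A 0 t))"
        using A_const[of 1 0 t] A_const[of 2 0 t] A_const[of 3 0 t] by (auto simp: \<gamma>_def der)
      then show "speed g \<gamma> t = A' 0 t * speed g \<sigma> (A 0 t)" by (simp add: speed_def scale)
    qed
    then show ?thesis
      using integral_unique[OF piece[OF continuous_speed[OF s(1)], of 0]] by (simp add: riem_length_speed)
  qed
  have int2: "integral {1/2..3/4} (speed g \<gamma>) = riem_length g \<rho>"
  proof -
    have "integral {1/2..3/4} (speed g \<gamma>) = integral {1/2..3/4} (\<lambda>t. A' 2 t * speed g \<rho> (A 2 t))"
    proof (rule integral_cong)
      fix t :: real assume "t \<in> {1/2..3/4}"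
      then have "\<gamma> t = \<rho> (A 2 t)" "vector_derivative \<gamma> (at t) = A' 2 t *\<^sub>R vector_derivative \<rho> (at (A 2 t))"
        using A_const[of 0 2 t] A_const[of 1 2 t] A_const[of 3 2 t] by (auto simp: \<gamma>_def der p1 d)
      then show "speed g \<gamma> t = A' 2 t * speed g \<rho> (A 2 t)" by (simp add: speed_def scale)
    qed
    then show ?thesis
      using integral_unique[OF piece[OF continuous_speed[OF s(2)], of 2]] by (simp add: riem_length_speed)
  qed
  have seg: "integral {of_nat k / 4..of_nat k / 4 + 1/4} (speed g \<gamma>) \<le> C * norm d" if "k = 1 \<or> k = 3" for k :: nat
  proof -
    have i: "((\<lambda>t. A' k t * (C * norm d)) has_integral C * norm d) {of_nat k / 4..of_nat k / 4 + 1/4}"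
      using piece[of "\<lambda>_. C * norm d" k] by simp
    have "integral {of_nat k / 4..of_nat k / 4 + 1/4} (speed g \<gamma>)
        \<le> integral {of_nat k / 4..of_nat k / 4 + 1/4} (\<lambda>t. A' k t * (C * norm d))"
    proof (rule integral_le[OF speed_integrable[OF sg] has_integral_integrable[OF i]])
      fix t :: real assume t: "t \<in> {of_nat k / 4..of_nat k / 4 + 1/4}"
      have "vector_derivative \<gamma> (at t) = A' k t *\<^sub>R d \<or> vector_derivative \<gamma> (at t) = A' k t *\<^sub>R (- d)"
        using that A_const[of 0 k t] A_const[of 1 k t] A_const[of 2 k t] A_const[of 3 k t] t
        by (auto simp: der)
      then have "speed g \<gamma> t = A' k t * sqrt (g (\<gamma> t) d d)"
        unfolding speed_def by (auto simp only: scale metric_minus)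
      then show "speed g \<gamma> t \<le> A' k t * (C * norm d)"
        using C[of "\<gamma> t" d] A'_nonneg[of k t] by (simp add: mult_left_mono)
    qed
    then show ?thesis unfolding integral_unique[OF i] .
  qed
  have comb: "integral {0..y} (speed g \<gamma>) = integral {0..x} (speed g \<gamma>) + integral {x..y} (speed g \<gamma>)"
    if "0 \<le> x" "x \<le> y" for x y
    using Henstock_Kurzweil_Integration.integral_combine[OF that speed_integrable[OF sg]] by simp
  have "riem_length g \<gamma> = integral {0..1/4} (speed g \<gamma>) + integral {1/4..1/2} (speed g \<gamma>)
      + integral {1/2..3/4} (speed g \<gamma>) + integral {3/4..1} (speed g \<gamma>)"
    unfolding riem_length_speed using comb[of "1/4" "1/2"] comb[of "1/2" "3/4"] comb[of "3/4" 1] by simp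
  then have "riem_length g \<gamma> \<le> riem_length g \<sigma> + riem_length g \<rho> + 2 * C * norm d"
    using int0 int2 seg[of 1] seg[of 3] by simp
  then show thesis using loop that by blast
qed

text \<open>A deck translation brings the start of the second loop within distance 2 of the end of
  the first. The joining segment is run through twice, at cost at most \<open>2 * C\<close> each
  time, hence the defect \<open>4 * C\<close>. The lower bound holds because the velocity of a lift
  integrates to its class; the upper bound is given by a straight loop.\<close>

lemma coarse_norm_min_length: "\<exists>K c C. coarse_norm (min_length g) K c C"
proof -
  obtain c C where c: "0 < c" "0 \<le> C" and lo: "\<And>p v. c * norm v \<le> sqrt (g p v v)"
    and up: "\<And>p v. sqrt (g p v v) \<le> C * norm v"
    using metric_bounds by blast
  have "coarse_norm (min_length g) (4 * C) c C"
  proof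
    fix a b :: "real \<times> real" assume ab: "a \<in> lattice" "b \<in> lattice"
    have "min_length g (a + b) - 4 * C - min_length g b \<le> min_length g a"
    proof (rule min_length_ge)
      fix \<sigma> assume \<sigma>: "loop_in_class a \<sigma>"
      have "min_length g (a + b) - 4 * C - riem_length g \<sigma> \<le> min_length g b"
      proof (rule min_length_ge)
        fix \<rho> assume \<rho>: "loop_in_class b \<rho>"
        define z where "z = lattice_floor (\<sigma> 0 + a - \<rho> 0)"
        have z: "z \<in> lattice" by (simp only: z_def lattice_floor_in_lattice)
        define d where "d = (\<rho> 0 + z) - \<sigma> 0 - a"
        have "norm d \<le> 2"
          using norm_lattice_floor_diff[of "\<sigma> 0 + a - \<rho> 0"] by (simp add: d_def z_def algebra_simps)
        then have Cd: "2 * C * norm d \<le> 4 * C" using c(2) mult_left_mono[of "norm d" 2 C] by simp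
        obtain \<gamma> where "loop_in_class (a + b) \<gamma>"
          "riem_length g \<gamma> \<le> riem_length g \<sigma> + riem_length g (\<lambda>t. \<rho> t + z) + 2 * C * norm d"
          using concatenate_loops[OF \<sigma> loop_translate(1)[OF \<rho>] d_def up] by blast
        moreover have "riem_length g (\<lambda>t. \<rho> t + z) = riem_length g \<rho>"
          by (simp only: riem_length_def loop_translate(2)[OF \<rho>] periodic[OF z])
        ultimately show "min_length g (a + b) - 4 * C - riem_length g \<sigma> \<le> riem_length g \<rho>"
          using Cd min_length_le[of "a + b" \<gamma>] by linarith
      qed
      then show "min_length g (a + b) - 4 * C - min_length g b \<le> riem_length g \<sigma>" by linarith
    qed
    then show "min_length g (a + b) \<le> min_length g a + min_length g b + 4 * C" by linarith
  next
    fix a :: "real \<times> real"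
    show "c * norm a \<le> min_length g a"
    proof (rule min_length_ge)
      fix \<sigma> assume \<sigma>: "loop_in_class a \<sigma>"
      then have s: "smooth \<sigma>" and a: "\<sigma> 1 - \<sigma> 0 = a"
        by (auto simp: loop_in_class_def dest: spec[of _ 0])
      have i: "((\<lambda>t. vector_derivative \<sigma> (at t)) has_integral a) {0..1}"
        unfolding a[symmetric]
        by (rule fundamental_theorem_of_calculus)
          (auto intro: has_vector_derivative_at_within smooth_has_vector_derivative[OF s])
      have "norm (integral {0..1} (\<lambda>t. vector_derivative \<sigma> (at t))) \<le> integral {0..1} (\<lambda>t. speed g \<sigma> t / c)"
      proof (rule Henstock_Kurzweil_Integration.integral_norm_bound_integral)
        show "(\<lambda>t. speed g \<sigma> t / c) integrable_on {0..1}"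
          by (intro integrable_on_divide speed_integrable s)
        show "norm (vector_derivative \<sigma> (at t)) \<le> speed g \<sigma> t / c" for t
          using lo[of "vector_derivative \<sigma> (at t)" "\<sigma> t"] c(1) by (simp add: speed_def field_simps)
      qed (use i in blast)
      then show "c * norm a \<le> riem_length g \<sigma>"
        using c(1) integral_unique[OF i] by (simp add: riem_length_speed field_simps)
    qed
    show "min_length g a \<le> C * norm a"
    proof -
      have "riem_length g (\<lambda>t. t *\<^sub>R a) \<le> integral {0..1::real} (\<lambda>t. C * norm a)"
        unfolding riem_length_speed
        by (rule integral_le)
          (use straight_loop(1)[of a] in \<open>auto simp: speed_def straight_loop(2) up loop_in_class_def intro: speed_integrable\<close>)
      then show ?thesis using min_length_le[OF straight_loop(1)[of a]] by simp
    qed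
    show "min_length g (- a) = min_length g a" by (rule min_length_minus)
  qed (use c in auto)
  then show ?thesis by blast
qed

text \<open>The second property reads off the limit when calibration gives the minimal lengths of
  all multiples exactly.\<close>

lemma stable_norm_exists:
  obtains N where "is_stable_norm g N"
    "\<And>h l. h \<in> lattice \<Longrightarrow> (\<And>n. min_length g (real n *\<^sub>R h) = real n * l) \<Longrightarrow> N h = l"
proof -
  obtain K c C where "coarse_norm (min_length g) K c C" using coarse_norm_min_length by blast
  then interpret coarse_norm "min_length g" K c C .
  show thesis
    by (rule that[of homogenization])
      (use is_norm_homogenization homogenization_uniform homogenization_eq in \<open>auto simp only: is_stable_norm_def\<close>)
qed

end

section \<open>Calibrated metrics\<close>

text \<open>The determinant. Below, \<open>cross i x \<in> \<int>\<close> describes the lines of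
  direction \<open>i\<close>: for a lattice vector \<open>i\<close> it defines a lattice-invariant
  family of parallel lines that contains the line through 0 and its translates.\<close>

definition cross :: "real \<times> real \<Rightarrow> real \<times> real \<Rightarrow> real" where
  "cross a b = fst a * snd b - snd a * fst b"

lemma cross_add: "cross a (x + y) = cross a x + cross a y"
  and cross_diff: "cross a (x - y) = cross a x - cross a y"
  and cross_scaleR: "cross a (c *\<^sub>R x) = c * cross a x"
  and cross_self: "cross a a = 0"
  by (simp_all add: cross_def algebra_simps)

lemma bounded_linear_cross: "bounded_linear (cross a)"
proof -
  have "cross a = (\<lambda>x. (- snd a, fst a) \<bullet> x)" by (auto simp: cross_def inner_prod_def)
  then show ?thesis by (simp add: bounded_linear_inner_right)
qed

lemma smooth_cross [smooth_intros]: "smooth (cross a)"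
  by (rule smooth_bounded_linear[OF bounded_linear_cross])

lemma cross_Ints: "a \<in> lattice \<Longrightarrow> b \<in> lattice \<Longrightarrow> cross a b \<in> \<int>"
  by (auto simp: cross_def)

lemma cross_eq_0D:
  assumes "cross a x = 0" "a \<noteq> 0" obtains t where "x = t *\<^sub>R a"
proof -
  obtain a1 a2 x1 x2 where [simp]: "a = (a1, a2)" "x = (x1, x2)" by (cases a, cases x)
  have eq: "a1 * x2 = a2 * x1" using assms(1) by (simp add: cross_def)
  show thesis
  proof (cases "a1 = 0")
    case True
    then show ?thesis using eq assms(2) that[of "x2 / a2"] by (auto simp: zero_prod_def)
  next
    case False
    then show ?thesis using eq that[of "x1 / a1"] by (auto simp: field_simps)
  qed
qed

lemma cross_expand: "cross a b *\<^sub>R x = cross a x *\<^sub>R b - cross b x *\<^sub>R a"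
  by (cases a, cases b, cases x) (simp add: cross_def algebra_simps)

lemma Lagrange_identity: "(a \<bullet> b)\<^sup>2 + (cross a b)\<^sup>2 = (norm a)\<^sup>2 * (norm b)\<^sup>2"
  unfolding power2_norm_eq_inner
  by (cases a, cases b) (simp add: cross_def power2_eq_square algebra_simps)

section \<open>Smooth periodic functions of one variable\<close>

lemma sin_sq_add_Int:
  assumes "n \<in> \<int>" shows "(sin (pi * (t + n)))\<^sup>2 = (sin (pi * t))\<^sup>2"
proof -
  obtain m where m: "n = of_int m" using assms by (auto elim: Ints_cases)
  have "sin (pi * of_int m) = 0" "(cos (pi * of_int m))\<^sup>2 = 1"
    using sin_npi_int[of m] sin_cos_squared_add[of "pi * of_int m"] by auto
  then show ?thesis by (simp add: m distrib_left sin_add power_mult_distrib)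
qed

lemma abs_sin_mult_Int_le:
  fixes n x :: real
  assumes "n \<in> \<int>" shows "\<bar>sin (n * x)\<bar> \<le> \<bar>n\<bar> * \<bar>sin x\<bar>"
proof -
  have nat: "\<bar>sin (real k * x)\<bar> \<le> real k * \<bar>sin x\<bar>" for k
  proof (induction k)
    case (Suc k)
    have "real (Suc k) * x = real k * x + x" by (simp add: algebra_simps)
    then have "\<bar>sin (real (Suc k) * x)\<bar> = \<bar>sin (real k * x) * cos x + cos (real k * x) * sin x\<bar>"
      by (simp only: sin_add)
    also have "\<dots> \<le> \<bar>sin (real k * x)\<bar> * \<bar>cos x\<bar> + \<bar>cos (real k * x)\<bar> * \<bar>sin x\<bar>"
      by (simp flip: abs_mult)
    also have "\<dots> \<le> \<bar>sin (real k * x)\<bar> * 1 + 1 * \<bar>sin x\<bar>"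
      by (intro add_mono mult_mono) auto
    finally show ?case using Suc by (simp add: algebra_simps)
  qed simp
  obtain m :: int where m: "n = of_int m" using assms by (auto elim: Ints_cases)
  have abs: "\<bar>n\<bar> = real (nat \<bar>m\<bar>)" by (simp add: m)
  have "\<bar>sin (n * x)\<bar> = \<bar>sin (\<bar>n\<bar> * x)\<bar>" by (cases "n < 0") auto
  then show ?thesis using nat[of "nat \<bar>m\<bar>"] by (simp only: abs)
qed

text \<open>The squared sine serves throughout as a smooth 1-periodic substitute for the distance to
  the integers. It increases with that distance up to 1/2, so its sublevel sets are small
  neighbourhoods of the integers.\<close>

lemma sin_sq_le_imp_near_Int:
  assumes "(sin (pi * t))\<^sup>2 \<le> (sin (pi * d))\<^sup>2" "0 < d" "d \<le> 1/4"
  shows "\<bar>t - of_int (round t)\<bar> \<le> d"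
proof (rule ccontr)
  let ?s = "\<bar>t - of_int (round t)\<bar>"
  assume "\<not> ?s \<le> d"
  then have s: "d < ?s" by simp
  have s2: "?s \<le> 1/2" using of_int_round_abs_le[of t] by (simp add: abs_minus_commute)
  have d: "pi * d < pi * ?s" "pi * ?s \<le> pi / 2" "- (pi / 2) \<le> pi * d"
    using s s2 assms(2) pi_gt_zero mult_pos_pos[of pi d] by (auto simp: field_simps intro: order_trans[of _ 0])
  then have "sin (pi * d) < sin (pi * ?s)" by (intro sin_monotone_2pi)
  moreover have "0 < sin (pi * d)" using assms(2,3) by (intro sin_gt_zero) auto
  ultimately have "(sin (pi * d))\<^sup>2 < (sin (pi * ?s))\<^sup>2" by (intro power_strict_mono) auto
  also have "(sin (pi * ?s))\<^sup>2 = (sin (pi * (t - of_int (round t))))\<^sup>2"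
    by (cases "t - of_int (round t) \<ge> 0") (auto simp: abs_if algebra_simps sin_diff)
  also have "\<dots> = (sin (pi * t))\<^sup>2" using sin_sq_add_Int[of "- of_int (round t)" t] by simp
  finally show False using assms(1) by simp
qed

lemma sin_sq_eq_0_iff: "(sin (pi * t))\<^sup>2 = 0 \<longleftrightarrow> t \<in> \<int>"
proof -
  have "sin (pi * t) = 0 \<longleftrightarrow> (\<exists>n::int. pi * t = of_int n * pi)" by (rule sin_zero_iff_int2)
  then show ?thesis by (auto simp: Ints_def)
qed

lemma smooth_sin_sq [smooth_intros]:
  assumes "smooth f" shows "smooth (\<lambda>x. (sin (pi * f x))\<^sup>2)"
  by (intro smooth_intros smooth_compose[OF smooth_sin] assms)

text \<open>A smooth version of the signed distance to the nearest integer, exact within 3/8 of the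
  integers. The shift by 3/8 places the climb of the staircase on [3/8, 5/8] modulo 1.\<close>

definition sawtooth :: "real \<Rightarrow> real" where
  "sawtooth t = t - staircase (t - 3/8)"

text \<open>The parameters are thresholds for the squared sine, not for \<open>t\<close>: the bump
  is 1 up to \<open>a\<close> and 0 from \<open>b\<close> on.\<close>

definition bump :: "real \<Rightarrow> real \<Rightarrow> real \<Rightarrow> real" where
  "bump a b t = 1 - smooth_step (((sin (pi * t))\<^sup>2 - a) / (b - a))"

lemma smooth_sawtooth: "smooth sawtooth"
  unfolding sawtooth_def[abs_def] by (intro smooth_intros smooth_compose[OF smooth_staircase])

lemma sawtooth_add_Int: assumes "n \<in> \<int>" shows "sawtooth (t + n) = sawtooth t"
proof -
  obtain m :: int where m: "n = of_int m" using assms by (auto elim: Ints_cases)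
  have eq: "t + n - 3/8 = (t - 3/8) + of_int m" by (simp add: m)
  show ?thesis unfolding sawtooth_def eq by (simp add: staircase_def frac_def m)
qed

lemma sawtooth_eq:
  assumes "\<bar>t - n\<bar> \<le> 3/8" "n \<in> \<int>" shows "sawtooth t = t - n"
  using sawtooth_add_Int[OF assms(2), of "t - n"] staircase_eq_0[of "t - n - 3/8"] assms(1)
  by (auto simp: sawtooth_def)

lemma smooth_bump: "smooth (bump a b)"
proof -
  have eq: "bump a b = (\<lambda>t. 1 - smooth_step (((sin (pi * t))\<^sup>2 - a) * inverse (b - a)))"
    by (simp add: bump_def[abs_def] divide_inverse)
  show ?thesis unfolding eq by (intro smooth_intros smooth_compose[OF smooth_smooth_step])
qed

lemma bump_add_Int: "n \<in> \<int> \<Longrightarrow> bump a b (t + n) = bump a b t"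
  by (simp add: bump_def sin_sq_add_Int)

lemma bump_bounds: "0 \<le> bump a b t" "bump a b t \<le> 1"
  using smooth_step_bounds by (auto simp: bump_def)

lemma bump_eq_1: "a < b \<Longrightarrow> (sin (pi * t))\<^sup>2 \<le> a \<Longrightarrow> bump a b t = 1"
  by (auto simp: bump_def intro!: smooth_step_eq_0 divide_nonpos_pos)

lemma bump_eq_0: "a < b \<Longrightarrow> b \<le> (sin (pi * t))\<^sup>2 \<Longrightarrow> bump a b t = 0"
  by (auto simp: bump_def intro!: smooth_step_eq_1)

text \<open>Up to half a period the squared sine grows away from 0, so the bump falls. This sign
  bounds the derivative of the cut-off field along a line from above by 1.\<close>

lemma bump_deriv_sign:
  assumes "a < b" "\<bar>t\<bar> \<le> 1/2" shows "t * vector_derivative (bump a b) (at t) \<le> 0"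
proof -
  let ?w = "((sin (pi * t))\<^sup>2 - a) / (b - a)" and ?S = "\<lambda>x. vector_derivative smooth_step (at x)"
  have S: "(smooth_step has_real_derivative ?S x) (at x)" for x
    by (rule smooth_has_real_derivative[OF smooth_smooth_step])
  have nonneg: "0 \<le> ?S x" for x
    by (rule deriv_nonneg_of_mono[OF _ S]) (simp add: mono_def smooth_step_mono)
  have "((\<lambda>t. ((sin (pi * t))\<^sup>2 - a) / (b - a)) has_real_derivative
      2 * sin (pi * t) * cos (pi * t) * pi / (b - a)) (at t)"
    using assms(1) by (auto intro!: derivative_eq_intros)
  from DERIV_chain2[OF S this]
  have "(bump a b has_real_derivative 0 - ?S ?w * (2 * sin (pi * t) * cos (pi * t) * pi / (b - a))) (at t)"
    unfolding bump_def[abs_def] by (intro DERIV_diff DERIV_const)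
  then have eq: "vector_derivative (bump a b) (at t) = - (?S ?w * (2 * sin (pi * t) * cos (pi * t) * pi / (b - a)))"
    by (simp add: has_real_derivative_iff_has_vector_derivative vector_derivative_at)
  have "pi * \<bar>t\<bar> \<le> pi * (1/2)" using assms(2) by (intro mult_left_mono) auto
  then have pt: "\<bar>pi * t\<bar> \<le> pi / 2" by (simp add: abs_mult)
  have "0 \<le> t * sin (pi * t)"
  proof (cases "t \<ge> 0")
    case True
    then show ?thesis using pt by (intro mult_nonneg_nonneg sin_ge_zero) auto
  next
    case False
    then have "0 \<le> sin (pi * - t)"
      using pt mult_nonneg_nonneg[of pi "- t"] by (intro sin_ge_zero) auto
    then show ?thesis using False by (simp add: mult_nonpos_nonpos)
  qed
  moreover have "0 \<le> cos (pi * t)" using pt by (intro cos_ge_zero) linarith+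
  ultimately have "0 \<le> (t * sin (pi * t)) * cos (pi * t)" by (rule mult_nonneg_nonneg)
  moreover have "0 \<le> s * (2 * q * pi / (b - a))" if "0 \<le> q" "0 \<le> s" for q s :: real
    using that assms(1) by simp
  ultimately have "0 \<le> ?S ?w * (2 * ((t * sin (pi * t)) * cos (pi * t)) * pi / (b - a))"
    using nonneg[of ?w] by blast
  then show ?thesis unfolding eq by (simp add: algebra_simps)
qed

lemma frechet_derivative_periodic:
  assumes "smooth f" "\<And>x. f (x + z) = f x"
  shows "frechet_derivative f (at (x + z)) = frechet_derivative f (at x)"
proof -
  have "((\<lambda>x. x + z) has_derivative (\<lambda>v. v)) (at x)" by (auto intro!: derivative_eq_intros)
  from diff_chain_at[OF this smooth_has_derivative[OF assms(1)]]
  have "(f has_derivative frechet_derivative f (at (x + z))) (at x)" by (simp add: o_def assms(2))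
  then show ?thesis by (rule frechet_derivative_at)
qed

lemma frechet_derivative_cong_open:
  assumes "open U" "x \<in> U" "\<And>y. y \<in> U \<Longrightarrow> f y = g y" "(g has_derivative g') (at x)"
  shows "frechet_derivative f (at x) = g'"
proof -
  have "(f has_derivative g') (at x)"
    by (rule has_derivative_transform_within_open[OF assms(4,1,2)]) (simp add: assms(3))
  then show ?thesis by (rule frechet_derivative_at[symmetric])
qed

text \<open>Counterexamples for \<open>K = n\<close> would accumulate at a zero of \<open>Q\<close>,
  because \<open>F\<close> is bounded on \<open>S\<close>. Since \<open>F\<close> is nonnegative in
  a neighbourhood of such a zero, they cannot be counterexamples.\<close>

lemma compact_penalty:
  fixes F Q :: "'a::metric_space \<Rightarrow> real"
  assumes S: "compact S" and F: "continuous_on S F" and Q: "continuous_on S Q"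
    and Q0: "\<And>z. z \<in> S \<Longrightarrow> 0 \<le> Q z"
    and loc: "\<And>z. z \<in> S \<Longrightarrow> Q z = 0 \<Longrightarrow> \<exists>U. open U \<and> z \<in> U \<and> (\<forall>y\<in>U \<inter> S. 0 \<le> F y)"
  shows "\<exists>K\<ge>0. \<forall>z\<in>S. 0 \<le> F z + K * Q z"
proof (rule ccontr)
  assume "\<not> ?thesis"
  then have "\<exists>z\<in>S. F z + real n * Q z < 0" for n by (meson not_le of_nat_0_le_iff)
  then obtain z where z: "\<And>n. z n \<in> S" "\<And>n. F (z n) + real n * Q (z n) < 0" by metis
  obtain l r where l: "l \<in> S" "strict_mono r" "(z \<circ> r) \<longlonglongrightarrow> l"
    using S z(1) by (metis compact_def)
  have Fneg: "F (z n) < 0" for n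
    using z(2)[of n] mult_nonneg_nonneg[OF of_nat_0_le_iff[of n] Q0[OF z(1)[of n]]] by linarith
  obtain B where B: "\<And>y. y \<in> S \<Longrightarrow> \<bar>F y\<bar> \<le> B"
    using compact_imp_bounded[OF compact_continuous_image[OF F S]] by (auto simp: bounded_iff)
  have "Q l \<le> 0"
  proof (rule LIMSEQ_le)
    show "(\<lambda>n. Q ((z \<circ> r) n)) \<longlonglongrightarrow> Q l"
      using continuous_on_tendsto_compose[OF Q l(3) l(1)] z(1) by simp
    show "(\<lambda>n. B / real n) \<longlonglongrightarrow> 0" by (rule lim_const_over_n)
    have "Q ((z \<circ> r) n) \<le> B / real n" if "n \<ge> 1" for n
    proof -
      have "real n * Q (z (r n)) \<le> real (r n) * Q (z (r n))"
        using seq_suble[OF l(2), of n] Q0[OF z(1)] by (intro mult_right_mono) auto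
      also have "\<dots> \<le> B" using z(2)[of "r n"] B[OF z(1)[of "r n"]] by linarith
      finally show ?thesis using that by (simp add: field_simps)
    qed
    then show "\<exists>N. \<forall>n\<ge>N. Q ((z \<circ> r) n) \<le> B / real n" by blast
  qed
  then have "Q l = 0" using Q0[OF l(1)] by simp
  then obtain U where U: "open U" "l \<in> U" "\<forall>y\<in>U \<inter> S. 0 \<le> F y" using loc l(1) by blast
  have "\<forall>\<^sub>F n in sequentially. (z \<circ> r) n \<in> U" using topological_tendstoD[OF l(3) U(1,2)] .
  then obtain n where "z (r n) \<in> U" by (auto simp: eventually_sequentially)
  then show False using U(3) z(1) Fneg[of "r n"] by (meson IntI not_le)
qed

lemma finite_positive_lower_bound:
  fixes T :: "real set"
  assumes "finite T" "\<And>t. t \<in> T \<Longrightarrow> 0 < t" shows "\<exists>s>0. \<forall>t\<in>T. s \<le> t"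
proof (cases "T = {}")
  case False
  then show ?thesis using assms by (intro exI[of _ "Min T"]) auto
qed (auto intro: exI[of _ 1])

lemma finite_common_multiple:
  fixes T :: "real set"
  assumes "finite T" "T \<subseteq> \<int> - {0}"
  shows "\<exists>M\<in>\<int>. 1 \<le> M \<and> (\<forall>d\<in>T. \<exists>k\<in>\<int>. M = k * d)"
  using assms
proof (induction T rule: finite_induct)
  case (insert d T)
  then obtain M where M: "M \<in> \<int>" "1 \<le> M" "\<forall>d\<in>T. \<exists>k\<in>\<int>. M = k * d" by auto
  have d: "\<bar>d\<bar> \<in> \<int>" "1 \<le> \<bar>d\<bar>" using insert.prems Ints_nonzero_abs_ge1[of d] by auto
  have "\<exists>k\<in>\<int>. M * \<bar>d\<bar> = k * e" if e: "e \<in> insert d T" for e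
  proof (cases "e = d")
    case True
    have "M * \<bar>d\<bar> = (M * sgn d) * d" by (simp add: mult.assoc abs_sgn mult.commute)
    moreover have "M * sgn d \<in> \<int>" using M(1) by (auto simp: sgn_if)
    ultimately show ?thesis using True by blast
  next
    case False
    then obtain k where "k \<in> \<int>" "M = k * e" using M(3) e by auto
    then show ?thesis using d(1) by (intro bexI[of _ "k * \<bar>d\<bar>"]) auto
  qed
  moreover have "1 \<le> M * \<bar>d\<bar>" using mult_mono[of 1 M 1 "\<bar>d\<bar>"] M(2) d(2) by simp
  ultimately show ?case using M(1) d(1) by (intro bexI[of _ "M * \<bar>d\<bar>"]) auto
qed (auto intro: bexI[of _ 1])

text \<open>\<open>R\<close> decides how small the neighbourhoods of the crossings have to be, and
  \<open>M\<close> makes \<open>M *\<^sub>R x\<close> integral at every crossing \<open>x\<close>.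
  \<open>\<tau>\<close> keeps the Euclidean forms below the gaps left by strict convexity; the
  factor 2 is spent in \<open>form_line\<close>.\<close>

locale line_metric =
  fixes I :: "(real \<times> real) set" and L :: "real \<times> real \<Rightarrow> real \<times> real" and R M \<tau> :: real
  assumes finite_I: "finite I"
    and I_lattice: "\<And>i. i \<in> I \<Longrightarrow> i \<in> lattice"
    and I_nonzero: "\<And>i. i \<in> I \<Longrightarrow> i \<noteq> 0"
    and R_ge_1: "1 \<le> R"
    and R_bound: "\<And>i. i \<in> I \<Longrightarrow> \<bar>fst i\<bar> + \<bar>snd i\<bar> \<le> R"
    and M_Ints: "M \<in> \<int>"
    and M_ge_1: "1 \<le> M"
    and M_multiple: "\<And>i l. i \<in> I \<Longrightarrow> l \<in> I \<Longrightarrow> i \<noteq> l \<Longrightarrow> \<exists>k\<in>\<int>. M = k * cross i l"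
    and tau_pos: "0 < \<tau>"
    and tau_diag: "\<And>i. i \<in> I \<Longrightarrow> 2 * \<tau> * norm i \<le> L i \<bullet> i"
    and tau_gap: "\<And>i l. i \<in> I \<Longrightarrow> l \<in> I \<Longrightarrow> i \<noteq> l \<Longrightarrow> 2 * \<tau> * norm i \<le> L i \<bullet> i - \<bar>L l \<bullet> i\<bar>"
begin

text \<open>If both coordinates of \<open>w\<close> are at most this large, then
  \<open>cross i w\<close> has absolute value at most 1/4 for \<open>i\<close> in \<open>I\<close>,
  so it is 0 as soon as it is an integer.\<close>

definition radius :: real where "radius = 1 / (4 * R)"
definition level :: real where "level = (sin (pi * radius))\<^sup>2"

lemma radius: "0 < radius" "radius \<le> 1/4"
  using R_ge_1 by (auto simp: radius_def field_simps)

lemma level_pos: "0 < level"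
proof -
  have "0 < sin (pi * radius)" using radius by (intro sin_gt_zero) auto
  then show ?thesis by (simp add: level_def)
qed

text \<open>Neighbourhoods of (1/M) Z^2, nested for three thresholds. The field below lives on
  \<open>core level\<close> and is exactly radial on \<open>core (level/2)\<close>. The metric
  changes from Euclidean to form-based between \<open>core (level/4)\<close> and
  \<open>core (level/2)\<close>, where the forms are already Euclidean.\<close>

definition core :: "real \<Rightarrow> (real \<times> real) set" where
  "core c = {x. (sin (pi * (M * fst x)))\<^sup>2 < c \<and> (sin (pi * (M * snd x)))\<^sup>2 < c}"

lemma open_core: "open (core c)"
  unfolding core_def by (intro open_Collect_conj open_Collect_less continuous_intros)

definition window :: "real \<Rightarrow> real \<Rightarrow> real \<times> real \<Rightarrow> real" where
  "window a b x = bump a b (M * fst x) * bump a b (M * snd x)"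

text \<open>Near a point \<open>q\<close> of (1/M) Z^2 this is \<open>x - q\<close>, cut off farther
  away. As it is periodic, it can exchange the linear part of a potential near \<open>q\<close>
  without affecting the increments over lattice vectors.\<close>

definition field :: "real \<times> real \<Rightarrow> real \<times> real" where
  "field x = (1 / M) *\<^sub>R window (level/2) level x *\<^sub>R (sawtooth (M * fst x), sawtooth (M * snd x))"

lemma smooth_window [smooth_intros]: "smooth (window a b)"
  unfolding window_def[abs_def] by (intro smooth_intros smooth_compose[OF smooth_bump])

lemma smooth_field: "smooth field"
  unfolding field_def[abs_def] by (intro smooth_intros smooth_compose[OF smooth_sawtooth])

lemma M_lattice:
  assumes "z \<in> lattice" shows "M * fst z \<in> \<int>" "M * snd z \<in> \<int>"
  using assms M_Ints by (auto simp: mem_Times_iff)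

lemma window_periodic: "z \<in> lattice \<Longrightarrow> window a b (x + z) = window a b x"
  using M_lattice by (simp add: window_def distrib_left bump_add_Int)

lemma field_periodic: "z \<in> lattice \<Longrightarrow> field (x + z) = field x"
  using M_lattice by (simp add: field_def window_periodic distrib_left sawtooth_add_Int)

lemma window_bounds: "0 \<le> window a b x" "window a b x \<le> 1"
  using mult_mono[of "bump a b (M * fst x)" 1 "bump a b (M * snd x)" 1]
  by (simp_all add: window_def bump_bounds)

lemma window_eq_1: "a < b \<Longrightarrow> x \<in> core a \<Longrightarrow> window a b x = 1"
  by (auto simp: window_def core_def bump_eq_1)

lemma window_nonzero_imp_core: "a < b \<Longrightarrow> window a b x \<noteq> 0 \<Longrightarrow> x \<in> core b"
  using bump_eq_0[of a b "M * fst x"] bump_eq_0[of a b "M * snd x"]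
  by (force simp: window_def core_def)

lemma field_near_lattice:
  assumes "n1 \<in> \<int>" "n2 \<in> \<int>" "\<bar>M * fst x - n1\<bar> \<le> 3/8" "\<bar>M * snd x - n2\<bar> \<le> 3/8"
  shows "field x = (1 / M) *\<^sub>R window (level/2) level x *\<^sub>R (M * fst x - n1, M * snd x - n2)"
  by (simp only: field_def sawtooth_eq[OF assms(3,1)] sawtooth_eq[OF assms(4,2)])

lemma near_lattice:
  assumes "(sin (pi * (M * fst x)))\<^sup>2 \<le> level" "(sin (pi * (M * snd x)))\<^sup>2 \<le> level"
  obtains n1 n2 where "n1 \<in> \<int>" "n2 \<in> \<int>" "\<bar>M * fst x - n1\<bar> \<le> radius" "\<bar>M * snd x - n2\<bar> \<le> radius"
  using sin_sq_le_imp_near_Int[OF assms(1)[unfolded level_def] radius]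
    sin_sq_le_imp_near_Int[OF assms(2)[unfolded level_def] radius]
  by (rule_tac that[OF Ints_of_int Ints_of_int])

lemma field_deriv_core:
  assumes x: "x \<in> core (level/2)" shows "frechet_derivative field (at x) v = v"
proof -
  obtain n1 n2 where n: "n1 \<in> \<int>" "n2 \<in> \<int>" "\<bar>M * fst x - n1\<bar> \<le> radius" "\<bar>M * snd x - n2\<bar> \<le> radius"
    using near_lattice[of x] x level_pos by (auto simp: core_def)
  let ?U = "core (level/2) \<inter> {y. \<bar>M * fst y - n1\<bar> < 3/8 \<and> \<bar>M * snd y - n2\<bar> < 3/8}"
  have "frechet_derivative field (at x) = (\<lambda>v. v)"
  proof (rule frechet_derivative_cong_open[where U = ?U])
    show "open ?U"
      by (intro open_Int open_core open_Collect_conj open_Collect_less continuous_intros)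
    show "x \<in> ?U" using x n radius by auto
    show "field y = y - (1 / M) *\<^sub>R (n1, n2)" if "y \<in> ?U" for y
    proof -
      have "field y = (1 / M) *\<^sub>R window (level/2) level y *\<^sub>R (M * fst y - n1, M * snd y - n2)"
        using that by (intro field_near_lattice n) auto
      also have "window (level/2) level y = 1" using that level_pos by (intro window_eq_1) auto
      finally show ?thesis using M_ge_1 by (simp add: prod_eq_iff diff_divide_distrib)
    qed
    show "((\<lambda>y. y - (1 / M) *\<^sub>R (n1, n2)) has_derivative (\<lambda>v. v)) (at x)"
      by (auto intro!: derivative_eq_intros)
  qed
  then show ?thesis by simp
qed

text \<open>The field is radial around the points of \<open>(1/M) \<int>\<^sup>2\<close>, and a line of the family that meets the
  support of the field near such a point passes through the point.\<close>

lemma field_deriv_line: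
  assumes i: "i \<in> I" and x: "cross i x \<in> \<int>"
  obtains m where "0 \<le> m" "frechet_derivative field (at x) i = (1 - m) *\<^sub>R i"
proof (cases "(sin (pi * (M * fst x)))\<^sup>2 \<le> level \<and> (sin (pi * (M * snd x)))\<^sup>2 \<le> level")
  case False
  let ?U = "{y. level < (sin (pi * (M * fst y)))\<^sup>2} \<union> {y. level < (sin (pi * (M * snd y)))\<^sup>2}"
  have "frechet_derivative field (at x) = (\<lambda>v. 0)"
  proof (rule frechet_derivative_cong_open[where U = ?U])
    show "open ?U" by (intro open_Un open_Collect_less continuous_intros)
    show "field y = 0" if "y \<in> ?U" for y
      using that bump_eq_0[of "level/2" level] level_pos by (auto simp: field_def window_def zero_prod_def)
  qed (use False in auto)
  then show thesis using that[of 1] by simp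
next
  case True
  then obtain n1 n2 where n: "n1 \<in> \<int>" "n2 \<in> \<int>" "\<bar>M * fst x - n1\<bar> \<le> radius" "\<bar>M * snd x - n2\<bar> \<le> radius"
    using near_lattice[of x] by metis
  define w where "w = (M * fst x - n1, M * snd x - n2)"
  have w: "w = M *\<^sub>R x - (n1, n2)" by (cases x) (simp add: w_def)
  have "cross i (n1, n2) \<in> \<int>" using I_lattice[OF i] n by (intro cross_Ints) auto
  then have "cross i w \<in> \<int>" unfolding w cross_diff cross_scaleR using x M_Ints by auto
  \<comment> \<open>The choice of \<open>radius\<close> forces this integer to vanish, so the
    displacement \<open>w\<close> from the crossing point is parallel to \<open>i\<close>.\<close>
  moreover have "\<bar>cross i w\<bar> < 1"
  proof -
    have "\<bar>cross i w\<bar> \<le> \<bar>fst i\<bar> * \<bar>snd w\<bar> + \<bar>snd i\<bar> * \<bar>fst w\<bar>"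
      unfolding cross_def using abs_triangle_ineq4[of "fst i * snd w" "snd i * fst w"] by (simp add: abs_mult)
    also have "\<dots> \<le> \<bar>fst i\<bar> * radius + \<bar>snd i\<bar> * radius"
      using n by (intro add_mono mult_left_mono) (auto simp: w_def)
    also have "\<dots> \<le> R * radius" using R_bound[OF i] radius by (simp flip: distrib_right add: mult_right_mono)
    also have "\<dots> < 1" using R_ge_1 by (simp add: radius_def)
    finally show ?thesis .
  qed
  ultimately have "cross i w = 0" using Ints_nonzero_abs_less1 by blast
  then obtain t where t: "w = t *\<^sub>R i" using cross_eq_0D I_nonzero[OF i] by blast
  define B where "B = bump (level/2) level"
  \<comment> \<open>Along the line the field at \<open>x + r *\<^sub>R i\<close> is
    \<open>\<psi> (t + M * r) / M\<close> times \<open>i\<close>, so its derivative at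
    \<open>r = 0\<close> is the derivative of \<psi> at \<open>t\<close> times
    \<open>i\<close>.\<close>
  define \<psi> where "\<psi> s = B (s * fst i) * B (s * snd i) * s" for s
  let ?B' = "\<lambda>s. vector_derivative B (at s)"
  have sB: "smooth B" by (simp add: B_def smooth_bump)
  have coord: "M * fst (x + r *\<^sub>R i) = (t + M * r) * fst i + n1" "M * snd (x + r *\<^sub>R i) = (t + M * r) * snd i + n2" for r
    using arg_cong[OF t, of fst] arg_cong[OF t, of snd] by (simp_all add: w_def algebra_simps)
  \<comment> \<open>The product rule, with the factor \<open>t\<close> grouped so that
    \<open>bump_deriv_sign\<close> makes the last two summands nonpositive.\<close>
  let ?\<psi>' = "B (t * fst i) * B (t * snd i) + (t * fst i * ?B' (t * fst i)) * B (t * snd i)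
      + B (t * fst i) * (t * snd i * ?B' (t * snd i))"
  have bound: "\<bar>t * fst i\<bar> \<le> radius" "\<bar>t * snd i\<bar> \<le> radius"
    using n t by (auto simp: w_def prod_eq_iff)
  have "?\<psi>' \<le> 1 * 1 + 0 + 0"
  proof (intro add_mono mult_mono)
    have "t * fst i * ?B' (t * fst i) \<le> 0" "t * snd i * ?B' (t * snd i) \<le> 0"
      using bound radius level_pos by (auto simp: B_def intro!: bump_deriv_sign)
    then show "(t * fst i * ?B' (t * fst i)) * B (t * snd i) \<le> 0"
      "B (t * fst i) * (t * snd i * ?B' (t * snd i)) \<le> 0"
      by (auto simp: B_def bump_bounds intro: mult_nonpos_nonneg mult_nonneg_nonpos)
  qed (auto simp: B_def bump_bounds)
  moreover have "frechet_derivative field (at x) i = ?\<psi>' *\<^sub>R i"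
  proof -
    let ?\<gamma> = "\<lambda>r. x + r *\<^sub>R i"
    have "((\<lambda>r. field (?\<gamma> r)) has_vector_derivative frechet_derivative field (at x) i) (at 0)"
    proof -
      have "(?\<gamma> has_derivative (\<lambda>r. r *\<^sub>R i)) (at 0)" by (auto intro!: derivative_eq_intros)
      from diff_chain_at[OF this smooth_has_derivative[OF smooth_field, of "?\<gamma> 0"]]
      have "((\<lambda>r. field (?\<gamma> r)) has_derivative (\<lambda>r. frechet_derivative field (at x) (r *\<^sub>R i))) (at 0)"
        by (simp add: o_def)
      then show ?thesis
        unfolding has_vector_derivative_def
        by (simp add: linear_cmul[OF has_derivative_linear[OF smooth_has_derivative[OF smooth_field]]])
    qed
    moreover have "((\<lambda>r. field (?\<gamma> r)) has_vector_derivative ?\<psi>' *\<^sub>R i) (at 0)"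
    proof -
      have B': "((\<lambda>r. B ((t + M * r) * a)) has_real_derivative ?B' (t * a) * (M * a)) (at 0)" for a
      proof -
        have "((\<lambda>r. (t + M * r) * a) has_real_derivative M * a) (at 0)"
          by (auto intro!: derivative_eq_intros)
        from DERIV_chain2[OF smooth_has_real_derivative[OF sB, of "(t + M * 0) * a"] this]
        show ?thesis by simp
      qed
      have "((\<lambda>r. 1 / M * \<psi> (t + M * r)) has_real_derivative ?\<psi>') (at 0)"
        unfolding \<psi>_def
      proof (rule DERIV_cong[OF DERIV_cmult[OF DERIV_mult[OF DERIV_mult[OF B' B']]]])
        show "((\<lambda>r. t + M * r) has_real_derivative M) (at 0)" by (auto intro!: derivative_eq_intros)
      qed (use M_ge_1 in \<open>simp add: field_simps\<close>)
      then have "((\<lambda>r. (1 / M * \<psi> (t + M * r)) *\<^sub>R i) has_vector_derivative ?\<psi>' *\<^sub>R i) (at 0)"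
        using has_vector_derivative_scaleR[OF _ has_vector_derivative_const] by fastforce
      moreover
      let ?U = "{r. \<bar>(t + M * r) * fst i\<bar> < 3/8 \<and> \<bar>(t + M * r) * snd i\<bar> < 3/8}"
      have "open ?U" by (intro open_Collect_conj open_Collect_less continuous_intros)
      moreover have "0 \<in> ?U" using bound radius by auto
      moreover have "(1 / M * \<psi> (t + M * r)) *\<^sub>R i = field (?\<gamma> r)" if "r \<in> ?U" for r
      proof -
        have "field (?\<gamma> r) = (1 / M) *\<^sub>R window (level/2) level (?\<gamma> r) *\<^sub>R ((t + M * r) *\<^sub>R i)"
          using that by (subst field_near_lattice[OF n(1,2)]) (auto simp only: coord, auto simp: prod_eq_iff)
        also have "window (level/2) level (?\<gamma> r) = B ((t + M * r) * fst i) * B ((t + M * r) * snd i)"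
          by (simp only: window_def coord bump_add_Int[OF n(1)] bump_add_Int[OF n(2)] B_def)
        finally show ?thesis by (simp add: \<psi>_def)
      qed
      ultimately show ?thesis
        by (rule has_vector_derivative_transform_within_open) auto
    qed
    ultimately show ?thesis by (rule vector_derivative_unique_at)
  qed
  ultimately show thesis using that[of "1 - ?\<psi>'"] by simp
qed

section \<open>The closed forms and their comparison along the lines\<close>

definition unit :: "real \<times> real \<Rightarrow> real \<times> real" where
  "unit l = (1 / norm l) *\<^sub>R l"

text \<open>\<open>form l\<close> is cohomologous to \<open>L l\<close>, and equals \<open>\<tau> (unit l \<bullet> v)\<close> near \<open>(1/M) \<int>\<^sup>2\<close>. There all the forms
  are dominated by \<open>\<tau> \<bar>v\<bar>\<close>, with equality on the respective lines, so that a Euclidean metric is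
  compatible with any number of lines crossing.\<close>

definition potential :: "real \<times> real \<Rightarrow> real \<times> real \<Rightarrow> real" where
  "potential l x = L l \<bullet> x + (\<tau> *\<^sub>R unit l - L l) \<bullet> field x"

definition form :: "real \<times> real \<Rightarrow> real \<times> real \<Rightarrow> real \<times> real \<Rightarrow> real" where
  "form l x v = frechet_derivative (potential l) (at x) v"

lemma unit_inner_le: "i \<in> I \<Longrightarrow> (unit i \<bullet> v)\<^sup>2 \<le> v \<bullet> v"
  using Cauchy_Schwarz_ineq[of "unit i" v] I_nonzero[of i]
  by (simp add: unit_def power2_norm_eq_inner[symmetric])

lemma unit_inner_self: "i \<in> I \<Longrightarrow> unit i \<bullet> i = norm i"
  using I_nonzero[of i] by (simp add: unit_def flip: power2_norm_eq_inner) (simp add: power2_eq_square)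

lemma cross_nonzero: "i \<in> I \<Longrightarrow> l \<in> I \<Longrightarrow> i \<noteq> l \<Longrightarrow> cross i l \<noteq> 0"
  using M_multiple M_ge_1 by fastforce

lemma unit_inner_less:
  assumes "i \<in> I" "l \<in> I" "i \<noteq> l" shows "\<bar>unit l \<bullet> i\<bar> < norm i"
proof -
  have "0 < (cross l i)\<^sup>2" using cross_nonzero[of l i] assms by simp
  then have "(l \<bullet> i)\<^sup>2 < (norm l * norm i)\<^sup>2"
    using Lagrange_identity[of l i] unfolding power_mult_distrib by linarith
  then have "\<bar>l \<bullet> i\<bar> < norm l * norm i"
    using power2_less_imp_less[of "\<bar>l \<bullet> i\<bar>" "norm l * norm i"] by simp
  then show ?thesis using I_nonzero[OF assms(2)] by (simp add: unit_def abs_mult field_simps)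
qed

lemma smooth_potential: "smooth (potential l)"
  unfolding potential_def[abs_def] by (intro smooth_intros smooth_inner_left smooth_field)

lemma potential_translate:
  "z \<in> lattice \<Longrightarrow> potential l (x + z) = potential l x + L l \<bullet> z"
  by (simp add: potential_def field_periodic inner_add_right)

lemma potential_has_derivative: "(potential l has_derivative form l x) (at x)"
  unfolding form_def[abs_def] by (rule smooth_has_derivative[OF smooth_potential])

lemma smooth_form: "smooth (\<lambda>x. form l x v)"
  unfolding form_def by (rule smooth_frechet_derivative[OF smooth_potential])

lemma form_eq: "form l x v = L l \<bullet> v + (\<tau> *\<^sub>R unit l - L l) \<bullet> frechet_derivative field (at x) v"
proof -
  have "(potential l has_derivative
      (\<lambda>v. L l \<bullet> v + (\<tau> *\<^sub>R unit l - L l) \<bullet> frechet_derivative field (at x) v)) (at x)"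
    unfolding potential_def[abs_def]
    by (intro has_derivative_add has_derivative_inner_right has_derivative_ident
        smooth_has_derivative[OF smooth_field])
  from frechet_derivative_at[OF this] show ?thesis unfolding form_def by metis
qed

lemma form_scaleR: "form l x (a *\<^sub>R v) = a * form l x v"
  and form_add: "form l x (v + w) = form l x v + form l x w"
  using linear_cmul[OF has_derivative_linear[OF potential_has_derivative]]
    linear_add[OF has_derivative_linear[OF potential_has_derivative]] by auto

lemma form_expand: "form l x v = fst v * form l x (1, 0) + snd v * form l x (0, 1)"
proof -
  have "v = fst v *\<^sub>R (1, 0) + snd v *\<^sub>R (0, 1)" by (simp add: prod_eq_iff)
  then show ?thesis by (metis form_add form_scaleR)
qed

lemma continuous_form [continuous_intros]:
  assumes "continuous_on S p" "continuous_on S v"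
  shows "continuous_on S (\<lambda>t. form l (p t) (v t))"
proof -
  have "continuous_on S (\<lambda>t. form l (p t) a)" for a
    by (rule continuous_on_compose2[OF smooth_continuous_on[OF smooth_form, of UNIV] assms(1)]) simp
  then show ?thesis
    by (subst form_expand) (intro continuous_intros assms)
qed

lemma form_periodic: "z \<in> lattice \<Longrightarrow> form l (x + z) = form l x"
  using frechet_derivative_periodic[OF smooth_field field_periodic] by (simp add: form_eq fun_eq_iff)

lemma form_core: "x \<in> core (level/2) \<Longrightarrow> form l x v = \<tau> * (unit l \<bullet> v)"
  by (simp add: form_eq field_deriv_core algebra_simps)

text \<open>Along the line of \<open>i\<close> the derivative of the field is multiplication of
  \<open>i\<close> by \<open>1 - m\<close>, so each form takes the value of an affine combination of
  \<open>L l \<bullet> i\<close> and its Euclidean counterpart. For \<open>m \<le> 1\<close> it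
  inherits the inequality from both ends. The slope of the bump is controlled only in sign, so
  \<open>m\<close> may exceed 1; then the factor 2 in \<open>tau_gap\<close> and
  \<open>tau_diag\<close> decides.\<close>

lemma form_line:
  assumes i: "i \<in> I" and x: "cross i x \<in> \<int>"
  shows "0 < form i x i" "\<And>l. l \<in> I \<Longrightarrow> l \<noteq> i \<Longrightarrow> \<bar>form l x i\<bar> < form i x i"
proof -
  obtain m where m: "0 \<le> m" "frechet_derivative field (at x) i = (1 - m) *\<^sub>R i"
    using field_deriv_line[OF i x] by blast
  have form: "form l x i = m * (L l \<bullet> i) + (1 - m) * (\<tau> * (unit l \<bullet> i))" for l
    by (simp add: form_eq m(2) algebra_simps)
  have key: "\<bar>m * q + (1 - m) * (\<tau> * e)\<bar> < m * (L i \<bullet> i) + (1 - m) * (\<tau> * norm i)"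
    if q: "2 * \<tau> * norm i \<le> L i \<bullet> i - \<bar>q\<bar>" and e: "\<bar>e\<bar> < norm i" for q e
  proof -
    have "\<bar>m * q + (1 - m) * (\<tau> * e)\<bar> \<le> \<bar>m * q\<bar> + \<bar>(1 - m) * (\<tau> * e)\<bar>"
      by (rule abs_triangle_ineq)
    then have *: "\<bar>m * q + (1 - m) * (\<tau> * e)\<bar> \<le> m * \<bar>q\<bar> + \<bar>1 - m\<bar> * (\<tau> * \<bar>e\<bar>)"
      using m tau_pos by (simp add: abs_mult)
    have te: "\<tau> * \<bar>e\<bar> < \<tau> * norm i" using e tau_pos by simp
    have pq: "0 < L i \<bullet> i - \<bar>q\<bar>" using q tau_pos e mult_pos_pos[of \<tau> "norm i"] by fastforce
    have mq: "m * (2 * \<tau> * norm i) \<le> m * (L i \<bullet> i) - m * \<bar>q\<bar>"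
      using mult_left_mono[OF q m(1)] by (simp add: algebra_simps)
    show ?thesis
    proof (cases "m < 1")
      case True
      have "(1 - m) * (\<tau> * \<bar>e\<bar>) < (1 - m) * (\<tau> * norm i)" using True te by simp
      moreover have "m * \<bar>q\<bar> \<le> m * (L i \<bullet> i)" using m(1) pq by (intro mult_left_mono) auto
      moreover have "\<bar>1 - m\<bar> = 1 - m" using True by simp
      ultimately show ?thesis using * by simp
    next
      \<comment> \<open>Extrapolation costs \<open>(m - 1) * (\<tau> * norm i)\<close> on either
        side of the inequality, together less than the gain
        \<open>2 * m * \<tau> * norm i\<close>.\<close>
      case False
      have "(m - 1) * (\<tau> * \<bar>e\<bar>) \<le> (m - 1) * (\<tau> * norm i)" using False by (intro mult_left_mono[OF less_imp_le[OF te]]) simp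
      moreover have "0 < \<tau> * norm i" using e tau_pos by (intro mult_pos_pos) linarith+
      moreover have "m * (2 * \<tau> * norm i) = (m - 1) * (\<tau> * norm i) - (1 - m) * (\<tau> * norm i) + 2 * (\<tau> * norm i)"
        by (simp add: algebra_simps)
      moreover have "\<bar>1 - m\<bar> = m - 1" using False by simp
      ultimately show ?thesis using * mq by simp
    qed
  qed
  have "0 < norm i" using I_nonzero[OF i] by simp
  then show "0 < form i x i"
    using key[of 0 0] tau_diag[OF i] by (simp add: form unit_inner_self[OF i])
  show "\<bar>form l x i\<bar> < form i x i" if "l \<in> I" "l \<noteq> i" for l
    using key[OF tau_gap unit_inner_less] i that by (simp add: form unit_inner_self)
qed

section \<open>Construction of the metric\<close>

definition line_dist :: "real \<times> real \<Rightarrow> real \<times> real \<Rightarrow> real" where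
  "line_dist l x = (sin (pi * cross l x))\<^sup>2"

definition gap :: real where
  "gap = level / 4 / (M * R)\<^sup>2"

text \<open>It vanishes on the lines of all other directions and is 1 where these are at least
  \<open>gap / 2\<close> away. By \<open>gap_le_line_dist\<close> the weight is thus 1 on a whole
  neighbourhood of each point of its own lines outside \<open>core (level/4)\<close>.\<close>

definition weight :: "real \<times> real \<Rightarrow> real \<times> real \<Rightarrow> real" where
  "weight i x = (\<Prod>l\<in>I - {i}. smooth_step (2 / gap * line_dist l x))"

lemma gap_pos: "0 < gap"
  using level_pos M_ge_1 R_ge_1 by (simp add: gap_def)

lemma smooth_line_dist [smooth_intros]: "smooth (line_dist l)"
  unfolding line_dist_def[abs_def] by (intro smooth_intros)

lemma smooth_weight [smooth_intros]: "smooth (weight i)"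
  unfolding weight_def[abs_def] by (intro smooth_intros smooth_compose[OF smooth_smooth_step])

lemma line_dist_nonneg: "0 \<le> line_dist l x"
  by (simp add: line_dist_def)

lemma line_dist_eq_0_iff: "line_dist l x = 0 \<longleftrightarrow> cross l x \<in> \<int>"
  unfolding line_dist_def by (rule sin_sq_eq_0_iff)

lemma line_dist_periodic: "l \<in> I \<Longrightarrow> z \<in> lattice \<Longrightarrow> line_dist l (x + z) = line_dist l x"
  by (simp only: line_dist_def cross_add sin_sq_add_Int[OF cross_Ints[OF I_lattice]])

lemma weight_periodic: "z \<in> lattice \<Longrightarrow> weight i (x + z) = weight i x"
  unfolding weight_def by (rule prod.cong) (auto simp only: Diff_iff line_dist_periodic)

lemma weight_nonneg: "0 \<le> weight i x"
  unfolding weight_def by (intro prod_nonneg ballI smooth_step_bounds)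

lemma weight_eq_1:
  assumes "\<And>l. l \<in> I \<Longrightarrow> l \<noteq> i \<Longrightarrow> gap / 2 \<le> line_dist l x" shows "weight i x = 1"
  unfolding weight_def using assms gap_pos
  by (intro prod.neutral ballI smooth_step_eq_1) (auto simp: field_simps)

lemma weight_eq_0:
  assumes "j \<in> I" "j \<noteq> i" "cross j x \<in> \<int>" shows "weight i x = 0"
  unfolding weight_def using assms finite_I line_dist_eq_0_iff[of j x]
  by (intro prod_zero bexI[of _ j]) (auto simp: smooth_step_eq_0)

text \<open>By \<open>cross_expand\<close>, each coordinate of \<open>M *\<^sub>R x\<close> is, up
  to an integer, an integer multiple of \<open>cross l x\<close>, with factor at most
  \<open>M * R\<close> in absolute value. Multiplying the angle by an integer enlarges the sine at
  most by that factor. So if \<open>x\<close> were too close to a line of \<open>l\<close>, it would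
  lie in the core.\<close>

lemma gap_le_line_dist:
  assumes i: "i \<in> I" and l: "l \<in> I" and il: "l \<noteq> i" and x: "cross i x \<in> \<int>"
    and out: "x \<notin> core (level/4)"
  shows "gap \<le> line_dist l x"
proof -
  obtain k where k: "k \<in> \<int>" "M = k * cross i l" using M_multiple[OF i l] il by auto
  have kM: "\<bar>k\<bar> \<le> M"
  proof -
    have "1 \<le> \<bar>cross i l\<bar>"
      using cross_Ints[OF I_lattice I_lattice, OF i l] cross_nonzero[OF i l] il by (intro Ints_nonzero_abs_ge1) auto
    then have "\<bar>k\<bar> * 1 \<le> \<bar>k\<bar> * \<bar>cross i l\<bar>" by (intro mult_left_mono) auto
    also have "\<dots> = M" using k(2) M_ge_1 by (simp flip: abs_mult)
    finally show ?thesis by simp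
  qed
  have bound: "level / 4 \<le> (M * R)\<^sup>2 * line_dist l x"
    if c: "c = k * (cross i x * d - cross l x * e)" "d \<in> \<int>" "e \<in> \<int>" "\<bar>e\<bar> \<le> R"
      "level / 4 \<le> (sin (pi * c))\<^sup>2" for c d e
  proof -
    have "c = - (k * e) * cross l x + k * cross i x * d" using c(1) by (simp add: algebra_simps)
    then have "(sin (pi * c))\<^sup>2 = (sin (pi * (- (k * e) * cross l x)))\<^sup>2"
      using sin_sq_add_Int[of "k * cross i x * d" "- (k * e) * cross l x"] k(1) x c(2)
      by (simp only: Ints_mult)
    also have "\<dots> = \<bar>sin (- (k * e) * (pi * cross l x))\<bar>\<^sup>2" by (simp add: mult_ac)
    also have "\<dots> \<le> (\<bar>- (k * e)\<bar> * \<bar>sin (pi * cross l x)\<bar>)\<^sup>2"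
      using k(1) c(3) by (intro power_mono abs_sin_mult_Int_le) auto
    also have "\<dots> \<le> (M * R * \<bar>sin (pi * cross l x)\<bar>)\<^sup>2"
    proof (intro power_mono mult_right_mono)
      show "\<bar>- (k * e)\<bar> \<le> M * R"
        using mult_mono[OF kM c(4)] M_ge_1 by (simp add: abs_mult)
    qed auto
    also have "\<dots> = (M * R)\<^sup>2 * line_dist l x" by (simp add: line_dist_def power_mult_distrib)
    finally show ?thesis using c(5) by linarith
  qed
  have expand: "M *\<^sub>R x = k *\<^sub>R (cross i x *\<^sub>R l - cross l x *\<^sub>R i)"
    unfolding cross_expand[symmetric] using k(2) by simp
  have lat: "fst l \<in> \<int>" "snd l \<in> \<int>" "fst i \<in> \<int>" "snd i \<in> \<int>" "\<bar>fst i\<bar> \<le> R" "\<bar>snd i\<bar> \<le> R"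
    using I_lattice[OF i] I_lattice[OF l] R_bound[OF i] by auto
  have "level / 4 \<le> (M * R)\<^sup>2 * line_dist l x"
  proof (cases "level / 4 \<le> (sin (pi * (M * fst x)))\<^sup>2")
    case True
    then show ?thesis
      using bound[of "M * fst x" "fst l" "fst i"] arg_cong[OF expand, of fst] lat by simp
  next
    case False
    then have "level / 4 \<le> (sin (pi * (M * snd x)))\<^sup>2" using out by (auto simp: core_def)
    then show ?thesis
      using bound[of "M * snd x" "snd l" "snd i"] arg_cong[OF expand, of snd] lat by simp
  qed
  then show ?thesis using M_ge_1 R_ge_1 by (simp add: gap_def field_simps)
qed

definition cutoff :: "real \<times> real \<Rightarrow> real" where
  "cutoff = window (level/4) (level/2)"

text \<open>Where \<open>cutoff\<close> is positive, \<open>form i\<close> is already the Euclidean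
  form. On a line of \<open>i\<close> both parts then give \<open>(form i x i)\<^sup>2\<close> in
  the transition zone, and so does their convex combination.\<close>

definition base :: "real \<times> real \<Rightarrow> real \<times> real \<Rightarrow> real \<times> real \<Rightarrow> real" where
  "base x v w = cutoff x * (\<tau>\<^sup>2 * (v \<bullet> w)) + (1 - cutoff x) * (\<Sum>i\<in>I. weight i x * (form i x v * form i x w))"

text \<open>The sum punishes directions transversal to a nearby line, the product punishes leaving
  all lines. Both vanish on tangent vectors of the lines, so any multiple may be added without
  changing the lengths of the lines.\<close>

definition penalty :: "real \<times> real \<Rightarrow> real \<times> real \<Rightarrow> real \<times> real \<Rightarrow> real" where
  "penalty x v w = (\<Sum>i\<in>I. weight i x * (cross i v * cross i w)) + (\<Prod>l\<in>I. line_dist l x) * (v \<bullet> w)"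

lemma cutoff_bounds: "0 \<le> cutoff x" "cutoff x \<le> 1"
  by (simp_all add: cutoff_def window_bounds)

lemma cutoff_eq_1: "x \<in> core (level/4) \<Longrightarrow> cutoff x = 1"
  using level_pos by (simp add: cutoff_def window_eq_1)

lemma cutoff_nonzero_imp_core: "cutoff x \<noteq> 0 \<Longrightarrow> x \<in> core (level/2)"
  unfolding cutoff_def using level_pos by (intro window_nonzero_imp_core) auto

lemma cutoff_form_le:
  assumes "l \<in> I" shows "cutoff x * (form l x v)\<^sup>2 \<le> cutoff x * (\<tau>\<^sup>2 * (v \<bullet> v))"
proof (cases "cutoff x = 0")
  case False
  then have "(form l x v)\<^sup>2 = \<tau>\<^sup>2 * (unit l \<bullet> v)\<^sup>2"
    using form_core[OF cutoff_nonzero_imp_core] by (simp add: power_mult_distrib)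
  also have "\<dots> \<le> \<tau>\<^sup>2 * (v \<bullet> v)" by (intro mult_left_mono unit_inner_le assms) auto
  finally show ?thesis by (intro mult_left_mono cutoff_bounds)
qed simp

lemma base_nonneg: "0 \<le> base x v v"
  unfolding base_def using cutoff_bounds[of x]
  by (intro add_nonneg_nonneg mult_nonneg_nonneg[of "cutoff x"] mult_nonneg_nonneg[of "1 - cutoff x"] sum_nonneg
      mult_nonneg_nonneg[OF weight_nonneg zero_le_square]) auto

lemma penalty_nonneg: "0 \<le> penalty x v v"
  unfolding penalty_def
  by (intro add_nonneg_nonneg sum_nonneg mult_nonneg_nonneg[OF weight_nonneg zero_le_square]
      mult_nonneg_nonneg[OF prod_nonneg inner_ge_zero] ballI line_dist_nonneg)

text \<open>The Euclidean part dominates every form by Cauchy-Schwarz, and the other part contains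
  the square of \<open>form i\<close> with full weight.\<close>

lemma form_le_base:
  assumes i: "i \<in> I" and w: "weight i x = 1" and l: "l \<in> I" and le: "(form l x v)\<^sup>2 \<le> (form i x v)\<^sup>2"
  shows "(form l x v)\<^sup>2 \<le> base x v v"
proof -
  have "(form i x v)\<^sup>2 \<le> (\<Sum>i\<in>I. weight i x * (form i x v * form i x v))"
    using member_le_sum[OF i, of "\<lambda>i. weight i x * (form i x v * form i x v)"] finite_I w weight_nonneg
    by (simp add: power2_eq_square)
  then have "(1 - cutoff x) * (form l x v)\<^sup>2 \<le> (1 - cutoff x) * (\<Sum>i\<in>I. weight i x * (form i x v * form i x v))"
    using le cutoff_bounds[of x] by (intro mult_left_mono) auto
  then show ?thesis
    using cutoff_form_le[OF l, of x v] by (simp add: base_def algebra_simps)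
qed

lemma weight_line_eq_1:
  assumes "i \<in> I" "cross i x \<in> \<int>" "x \<notin> core (level/4)" shows "weight i x = 1"
  using gap_le_line_dist[OF assms(1) _ _ assms(2,3)] gap_pos by (intro weight_eq_1) fastforce

lemma base_scaleR: "base x (a *\<^sub>R v) (a *\<^sub>R v) = a\<^sup>2 * base x v v"
  unfolding base_def form_scaleR
  by (simp add: sum_distrib_left power2_eq_square algebra_simps)

lemma penalty_scaleR: "penalty x (a *\<^sub>R v) (a *\<^sub>R v) = a\<^sup>2 * penalty x v v"
  unfolding penalty_def cross_scaleR
  by (simp add: sum_distrib_left power2_eq_square algebra_simps)

lemma base_periodic: "z \<in> lattice \<Longrightarrow> base (x + z) = base x"
  by (simp only: base_def[abs_def] cutoff_def window_periodic weight_periodic form_periodic)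

lemma penalty_periodic: "z \<in> lattice \<Longrightarrow> penalty (x + z) = penalty x"
  by (simp add: penalty_def[abs_def] weight_periodic line_dist_periodic)

lemma smooth_base: "smooth (\<lambda>x. base x v w)"
  unfolding base_def cutoff_def by (intro smooth_intros smooth_form)

lemma smooth_penalty: "smooth (\<lambda>x. penalty x v w)"
  unfolding penalty_def by (intro smooth_intros)

text \<open>The vanishing product puts \<open>x\<close> on some line. Outside the inner core that
  line has weight 1, so the vanishing sum makes \<open>v\<close> tangent to it.\<close>

lemma penalty_eq_0E:
  assumes x: "penalty x v v = 0" and v: "v \<noteq> 0" and out: "x \<notin> core (level/4)"
  obtains i a where "i \<in> I" "cross i x \<in> \<int>" "weight i x = 1" "v = a *\<^sub>R i" "a \<noteq> 0"
proof -
  have sum0: "0 \<le> (\<Sum>i\<in>I. weight i x * (cross i v * cross i v))"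
    by (intro sum_nonneg mult_nonneg_nonneg[OF weight_nonneg zero_le_square])
  have prod0: "0 \<le> (\<Prod>l\<in>I. line_dist l x) * (v \<bullet> v)"
    by (intro mult_nonneg_nonneg prod_nonneg line_dist_nonneg ballI inner_ge_zero)
  have "(\<Prod>l\<in>I. line_dist l x) * (v \<bullet> v) = 0" and sum: "(\<Sum>i\<in>I. weight i x * (cross i v * cross i v)) = 0"
    using x sum0 prod0 unfolding penalty_def by linarith+
  then obtain i where i: "i \<in> I" "cross i x \<in> \<int>"
    using v finite_I by (auto simp: line_dist_eq_0_iff)
  have w1: "weight i x = 1" by (rule weight_line_eq_1[OF i out])
  have "weight i x * (cross i v * cross i v) = 0"
    using sum i(1) finite_I
    by (subst (asm) sum_nonneg_eq_0_iff) (auto intro: mult_nonneg_nonneg[OF weight_nonneg zero_le_square])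
  then have "cross i v = 0" using w1 by simp
  then obtain a where a: "v = a *\<^sub>R i" using cross_eq_0D[OF _ I_nonzero[OF i(1)]] by blast
  then show thesis using that i w1 v by auto
qed

text \<open>In the inner core the metric is Euclidean. Elsewhere \<open>v\<close> is tangent to a
  line of some \<open>i\<close>, whose weight stays 1 nearby; for \<open>l \<noteq> i\<close> the
  strict inequality of \<open>form_line\<close> persists on a neighbourhood of
  \<open>(x, v)\<close>, and for \<open>l = i\<close> the form itself is one of the
  summands.\<close>

lemma form_le_base_locally:
  assumes x: "penalty x v v = 0" and v: "v \<noteq> 0" and l: "l \<in> I"
  shows "\<exists>U. open U \<and> (x, v) \<in> U \<and> (\<forall>(y, w)\<in>U. (form l y w)\<^sup>2 \<le> base y w w)"
proof (cases "x \<in> core (level/4)")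
  case True
  have "(form l y w)\<^sup>2 \<le> base y w w" if "y \<in> core (level/4)" for y w
    using cutoff_form_le[OF l, of y w] that by (simp add: base_def cutoff_eq_1)
  then show ?thesis
    using True open_core by (intro exI[of _ "core (level/4) \<times> UNIV"]) (auto intro: open_Times)
next
  case False
  obtain i a where i: "i \<in> I" "cross i x \<in> \<int>" and a: "v = a *\<^sub>R i" "a \<noteq> 0"
    using penalty_eq_0E[OF x v False] by blast
  define V where "V = (\<Inter>j\<in>I - {i}. {y. gap / 2 < line_dist j y}) \<times> (UNIV :: (real \<times> real) set)"
  have "open V" unfolding V_def using finite_I
    by (intro open_Times open_INT ballI open_Collect_less continuous_intros
        smooth_continuous_on[OF smooth_line_dist]) auto
  have "(x, v) \<in> V"
    using gap_le_line_dist[OF i(1) _ _ i(2) False] gap_pos by (fastforce simp: V_def)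
  have V: "weight i y = 1" if "(y, w) \<in> V" for y w
    using that by (intro weight_eq_1) (auto simp: V_def intro: less_imp_le)
  show ?thesis
  proof (cases "l = i")
    case True
    have "(form l y w)\<^sup>2 \<le> base y w w" if "(y, w) \<in> V" for y w
      by (rule form_le_base[OF i(1) V[OF that] l]) (simp add: True)
    then show ?thesis using \<open>open V\<close> \<open>(x, v) \<in> V\<close> by blast
  next
    case False
    let ?U = "V \<inter> {z. (form l (fst z) (snd z))\<^sup>2 < (form i (fst z) (snd z))\<^sup>2}"
    have "open ?U"
      by (intro open_Int \<open>open V\<close> open_Collect_less continuous_intros)
    moreover have "(x, v) \<in> ?U"
    proof -
      have "\<bar>form l x i\<bar> < form i x i" by (rule form_line(2)[OF i l False])
      then have "(form l x i)\<^sup>2 < (form i x i)\<^sup>2" using power_strict_mono[of "\<bar>form l x i\<bar>" "form i x i" 2] by simp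
      then show ?thesis
        using \<open>(x, v) \<in> V\<close> a(2) by (simp add: a(1) form_scaleR power_mult_distrib)
    qed
    moreover have "(form l y w)\<^sup>2 \<le> base y w w" if "(y, w) \<in> ?U" for y w
      using that by (intro form_le_base[OF i(1) V l]) auto
    ultimately show ?thesis by blast
  qed
qed

text \<open>\<open>compact_penalty\<close> applies on the unit cell times the unit circle;
  periodicity in \<open>x\<close> and homogeneity of degree 2 in \<open>v\<close> extend the
  estimate to all tangent vectors.\<close>

lemma dominating_constant: "\<exists>K\<ge>1. \<forall>l\<in>I. \<forall>x v. (form l x v)\<^sup>2 \<le> base x v v + K * penalty x v v"
proof -
  define S where "S = (cbox (0,0) (1,1) :: (real \<times> real) set) \<times> (sphere 0 1 :: (real \<times> real) set)"
  have S: "compact S" unfolding S_def by (intro compact_Times compact_cbox compact_sphere)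
  have cont: "continuous_on T (\<lambda>z. f (fst z))" if "smooth f" for f :: "real \<times> real \<Rightarrow> real" and T :: "((real \<times> real) \<times> (real \<times> real)) set"
    by (rule continuous_on_compose2[OF smooth_continuous_on[OF that, of UNIV]]) (auto intro: continuous_intros)
  have ex: "\<exists>K\<ge>0. \<forall>z\<in>S. 0 \<le> (base (fst z) (snd z) (snd z) - (form l (fst z) (snd z))\<^sup>2)
      + K * penalty (fst z) (snd z) (snd z)" if l: "l \<in> I" for l
  proof (rule compact_penalty[OF S])
    show "continuous_on S (\<lambda>z. base (fst z) (snd z) (snd z) - (form l (fst z) (snd z))\<^sup>2)"
      unfolding base_def cutoff_def
      by (intro continuous_intros cont smooth_window smooth_weight)
    show "continuous_on S (\<lambda>z. penalty (fst z) (snd z) (snd z))"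
      unfolding penalty_def
      by (intro continuous_intros cont smooth_line_dist smooth_weight
          bounded_linear.continuous_on[OF bounded_linear_cross])
    show "0 \<le> penalty (fst z) (snd z) (snd z)" for z by (rule penalty_nonneg)
    show "\<exists>U. open U \<and> z \<in> U \<and> (\<forall>y\<in>U \<inter> S. 0 \<le> base (fst y) (snd y) (snd y) - (form l (fst y) (snd y))\<^sup>2)"
      if "z \<in> S" "penalty (fst z) (snd z) (snd z) = 0" for z
    proof -
      have "norm (snd z) = 1" using that(1) by (auto simp: S_def)
      then have "snd z \<noteq> 0" by fastforce
      from form_le_base_locally[OF that(2) this l] show ?thesis by fastforce
    qed
  qed
  have "\<forall>l\<in>I. \<exists>K. 0 \<le> K \<and> (\<forall>z\<in>S. (form l (fst z) (snd z))\<^sup>2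
      \<le> base (fst z) (snd z) (snd z) + K * penalty (fst z) (snd z) (snd z))"
  proof
    fix l assume "l \<in> I"
    from ex[OF this] obtain K where K: "0 \<le> K" "\<forall>z\<in>S. 0 \<le> (base (fst z) (snd z) (snd z)
        - (form l (fst z) (snd z))\<^sup>2) + K * penalty (fst z) (snd z) (snd z)" by blast
    have "(form l (fst z) (snd z))\<^sup>2 \<le> base (fst z) (snd z) (snd z) + K * penalty (fst z) (snd z) (snd z)"
      if "z \<in> S" for z
      using bspec[OF K(2) that] by linarith
    then show "\<exists>K. 0 \<le> K \<and> (\<forall>z\<in>S. (form l (fst z) (snd z))\<^sup>2
        \<le> base (fst z) (snd z) (snd z) + K * penalty (fst z) (snd z) (snd z))"
      using K(1) by blast
  qed
  from bchoice[OF this] obtain k where k: "\<And>l. l \<in> I \<Longrightarrow> 0 \<le> k l" "\<And>l z. l \<in> I \<Longrightarrow> z \<in> S \<Longrightarrow>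
      (form l (fst z) (snd z))\<^sup>2 \<le> base (fst z) (snd z) (snd z) + k l * penalty (fst z) (snd z) (snd z)"
    by blast
  \<comment> \<open>The sum exceeds each \<open>k l\<close>, so one constant serves all forms. The
    summand 1 keeps it positive, as definiteness of the metric requires.\<close>
  define K where "K = 1 + (\<Sum>l\<in>I. k l)"
  have kK: "k l \<le> K" if "l \<in> I" for l
    using member_le_sum[OF that, of k] k(1) finite_I by (simp add: K_def)
  have "(form l x v)\<^sup>2 \<le> base x v v + K * penalty x v v" if l: "l \<in> I" for l x v
  proof (cases "v = 0")
    case True
    then show ?thesis
      using base_scaleR[of x 0 v] penalty_scaleR[of x 0 v] form_scaleR[of l x 0 v] by simp
  next
    case False
    define q where "q = x - lattice_floor x"
    define w where "w = inverse (norm v) *\<^sub>R v"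
    have v: "v = norm v *\<^sub>R w" using False by (simp add: w_def)
    have x: "x = q + lattice_floor x" by (simp add: q_def)
    have "(q, w) \<in> S"
      using False by (auto simp: S_def q_def w_def lattice_floor_def cbox_def Basis_prod_def inner_prod_def) linarith+
    then have "(form l q w)\<^sup>2 \<le> base q w w + k l * penalty q w w" using k(2)[OF l] by fastforce
    also have "\<dots> \<le> base q w w + K * penalty q w w"
      by (intro add_left_mono mult_right_mono kK[OF l] penalty_nonneg)
    finally have "(norm v)\<^sup>2 * (form l q w)\<^sup>2 \<le> (norm v)\<^sup>2 * (base q w w + K * penalty q w w)"
      by (intro mult_left_mono) auto
    then have "(form l q v)\<^sup>2 \<le> base q v v + K * penalty q v v"
      by (subst (1 2 3 4 5) v) (simp only: form_scaleR base_scaleR penalty_scaleR power_mult_distrib distrib_left mult_ac)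
    then show ?thesis
      by (subst (1 2 3) x) (simp only: form_periodic base_periodic penalty_periodic lattice_floor_in_lattice)
  qed
  moreover have "1 \<le> K" using k(1) by (auto simp: K_def intro: sum_nonneg)
  ultimately show ?thesis by blast
qed

lemma base_line:
  assumes i: "i \<in> I" and x: "cross i x \<in> \<int>" shows "base x i i = (form i x i)\<^sup>2"
proof (cases "x \<in> core (level/4)")
  case True
  then have "x \<in> core (level/2)" using level_pos by (auto simp: core_def)
  then show ?thesis
    using True by (simp add: base_def cutoff_eq_1 form_core unit_inner_self[OF i] power_mult_distrib power2_norm_eq_inner)
next
  case False
  have "(\<Sum>j\<in>I. weight j x * (form j x i * form j x i)) = (\<Sum>j\<in>I. if j = i then (form i x i)\<^sup>2 else 0)"
    using weight_line_eq_1[OF i x False] weight_eq_0[OF i _ x]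
    by (intro sum.cong) (auto simp: power2_eq_square)
  then have sum: "(\<Sum>j\<in>I. weight j x * (form j x i * form j x i)) = (form i x i)\<^sup>2"
    using i finite_I by simp
  have "cutoff x * (\<tau>\<^sup>2 * (i \<bullet> i)) = cutoff x * (form i x i)\<^sup>2"
  proof (cases "cutoff x = 0")
    case False
    then show ?thesis
      using form_core[OF cutoff_nonzero_imp_core] unit_inner_self[OF i]
      by (simp add: power_mult_distrib power2_norm_eq_inner)
  qed simp
  then show ?thesis by (simp add: base_def sum algebra_simps)
qed

lemma penalty_line:
  assumes i: "i \<in> I" and x: "cross i x \<in> \<int>" shows "penalty x i i = 0"
proof -
  have "weight j x * (cross j i * cross j i) = 0" if "j \<in> I" for j
    using weight_eq_0[OF i _ x, of j] cross_self by (cases "j = i") auto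
  moreover have "(\<Prod>l\<in>I. line_dist l x) = 0"
    using i x finite_I line_dist_eq_0_iff by (intro prod_zero) auto
  ultimately show ?thesis unfolding penalty_def by (subst sum.neutral) auto
qed

text \<open>Only vectors with zero penalty are at issue. There either the Euclidean part is in full
  force, or \<open>v\<close> is tangent to a line of some \<open>i\<close> and \<open>form i\<close>
  is nonzero on it.\<close>

lemma base_add_penalty_pos:
  assumes v: "v \<noteq> 0" and K: "1 \<le> K" shows "0 < base x v v + K * penalty x v v"
proof (cases "penalty x v v = 0")
  case False
  then have "0 < K * penalty x v v" using K penalty_nonneg[of x v] by simp
  then show ?thesis using base_nonneg[of x v] by linarith
next
  case pen: True
  have "0 < base x v v"
  proof (cases "x \<in> core (level/4)")
    case True
    then show ?thesis using v tau_pos by (simp add: base_def cutoff_eq_1)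
  next
    case False
    then obtain i a where i: "i \<in> I" "cross i x \<in> \<int>" "weight i x = 1" and a: "v = a *\<^sub>R i" "a \<noteq> 0"
      using penalty_eq_0E[OF pen v] by blast
    have "0 < (form i x v)\<^sup>2" using form_line(1)[OF i(1,2)] a by (simp add: form_scaleR)
    also have "\<dots> \<le> base x v v" by (rule form_le_base[OF i(1,3,1)]) simp
    finally show ?thesis .
  qed
  then show ?thesis using pen by simp
qed

definition metric :: "real \<Rightarrow> real \<times> real \<Rightarrow> real \<times> real \<Rightarrow> real \<times> real \<Rightarrow> real" where
  "metric K x v w = base x v w + K * penalty x v w"

lemma torus_metric_metric: assumes K: "1 \<le> K" shows "torus_metric (metric K)"
  unfolding torus_metric_def
proof (intro conjI allI impI ballI)
  show "bilinear (metric K p)" for p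
    unfolding bilinear_def metric_def base_def penalty_def
    by (intro conjI allI linearI)
      (simp_all add: form_add form_scaleR cross_add cross_scaleR inner_add_left inner_add_right
        sum.distrib sum_distrib_left algebra_simps)
  show "metric K p v w = metric K p w v" for p v w
    by (simp add: metric_def base_def penalty_def inner_commute mult.commute)
  show "0 < metric K p v v" if "v \<noteq> 0" for p v
    unfolding metric_def by (rule base_add_penalty_pos[OF that K])
  show "smooth (\<lambda>p. metric K p v w)" for v w
    unfolding metric_def by (intro smooth_intros smooth_base smooth_penalty)
  show "metric K (p + z) = metric K p" if "z \<in> lattice" for z p
    by (simp only: metric_def[abs_def] base_periodic[OF that] penalty_periodic[OF that])
qed

lemma metric_line: "i \<in> I \<Longrightarrow> cross i x \<in> \<int> \<Longrightarrow> metric K x i i = (form i x i)\<^sup>2"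
  by (simp add: metric_def base_line penalty_line)

section \<open>Calibration and the stable norm on the lines\<close>

lemma potential_integral:
  assumes "smooth \<sigma>"
  shows "((\<lambda>t. form l (\<sigma> t) (vector_derivative \<sigma> (at t))) has_integral
    potential l (\<sigma> 1) - potential l (\<sigma> 0)) {0..1}"
proof (rule fundamental_theorem_of_calculus)
  fix t :: real
  have "((\<lambda>t. potential l (\<sigma> t)) has_derivative (\<lambda>s. form l (\<sigma> t) (s *\<^sub>R vector_derivative \<sigma> (at t)))) (at t)"
    using diff_chain_at[OF smooth_has_vector_derivative[OF assms, unfolded has_vector_derivative_def]
        potential_has_derivative[of l "\<sigma> t"]]
    by (simp add: o_def)
  then show "((\<lambda>t. potential l (\<sigma> t)) has_vector_derivative form l (\<sigma> t) (vector_derivative \<sigma> (at t)))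
      (at t within {0..1})"
    by (simp add: has_vector_derivative_def form_scaleR has_derivative_at_withinI)
qed simp

text \<open>The potential of \<open>i\<close> calibrates the line through \<open>0\<close> in direction \<open>i\<close>.\<close>

lemma min_length_line:
  assumes K: "1 \<le> K" and dom: "\<And>l x v. l \<in> I \<Longrightarrow> (form l x v)\<^sup>2 \<le> metric K x v v" and i: "i \<in> I"
  shows "min_length (metric K) (real n *\<^sub>R i) = real n * (L i \<bullet> i)"
proof -
  interpret torus "metric K" by (unfold_locales) (rule torus_metric_metric[OF K])
  have diff: "potential i (x + real n *\<^sub>R i) - potential i x = real n * (L i \<bullet> i)" for x
    using potential_translate[OF lattice_of_nat_scaleR[OF I_lattice[OF i]], of i x n] by simp
  show ?thesis
  proof (rule antisym)
    let ?\<sigma> = "\<lambda>t. t *\<^sub>R (real n *\<^sub>R i)"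
    have loop: "loop_in_class (real n *\<^sub>R i) ?\<sigma>" by (rule straight_loop(1))
    then have smooth: "smooth ?\<sigma>" by (simp add: loop_in_class_def)
    \<comment> \<open>Positivity of \<open>form i\<close> on \<open>i\<close> makes the square root
      of its square the form itself, so the length becomes an increment of the potential.\<close>
    have "speed (metric K) ?\<sigma> t = form i (?\<sigma> t) (vector_derivative ?\<sigma> (at t))" for t
    proof -
      have x: "cross i (?\<sigma> t) \<in> \<int>" by (simp add: cross_scaleR cross_self)
      show ?thesis
        using form_line(1)[OF i x]
        by (simp add: speed_def straight_loop(2) metric_scaleR metric_line[OF i x] form_scaleR real_sqrt_mult
            del: scaleR_scaleR)
    qed
    then have "riem_length (metric K) ?\<sigma> = potential i (?\<sigma> 1) - potential i (?\<sigma> 0)"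
      unfolding riem_length_speed by (metis (no_types, lifting) ext integral_unique potential_integral[OF smooth])
    also have "\<dots> = real n * (L i \<bullet> i)" using diff[of 0] by simp
    finally show "min_length (metric K) (real n *\<^sub>R i) \<le> real n * (L i \<bullet> i)"
      using min_length_le[OF loop] by simp
  next
    show "real n * (L i \<bullet> i) \<le> min_length (metric K) (real n *\<^sub>R i)"
    proof (rule min_length_ge)
      fix \<sigma> assume loop: "loop_in_class (real n *\<^sub>R i) \<sigma>"
      then have s: "smooth \<sigma>" and \<sigma>: "\<sigma> 1 = \<sigma> 0 + real n *\<^sub>R i"
        by (auto simp: loop_in_class_def dest: spec[of _ 0])
      have le: "form i (\<sigma> t) (vector_derivative \<sigma> (at t)) \<le> speed (metric K) \<sigma> t" for t
        using real_sqrt_le_mono[OF dom[OF i, of "\<sigma> t" "vector_derivative \<sigma> (at t)"]]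
        by (simp add: speed_def)
      have "real n * (L i \<bullet> i) = integral {0..1} (\<lambda>t. form i (\<sigma> t) (vector_derivative \<sigma> (at t)))"
        using integral_unique[OF potential_integral[OF s, of i]] diff[of "\<sigma> 0"] by (simp add: \<sigma>)
      also have "\<dots> \<le> riem_length (metric K) \<sigma>"
        unfolding riem_length_speed
        by (intro integral_le has_integral_integrable[OF potential_integral[OF s]] speed_integrable s le)
      finally show "real n * (L i \<bullet> i) \<le> riem_length (metric K) \<sigma>" .
    qed
  qed
qed

lemma stable_norm_on_lines:
  obtains N where "toral_stable_norm N" "\<And>i. i \<in> I \<Longrightarrow> N i = L i \<bullet> i"
proof -
  obtain K where K: "1 \<le> K" "\<And>l x v. l \<in> I \<Longrightarrow> (form l x v)\<^sup>2 \<le> metric K x v v"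
    using dominating_constant unfolding metric_def by blast
  interpret torus "metric K" by (unfold_locales) (rule torus_metric_metric[OF K(1)])
  obtain N where N: "is_stable_norm (metric K) N"
    "\<And>h l. h \<in> lattice \<Longrightarrow> (\<And>n. min_length (metric K) (real n *\<^sub>R h) = real n * l) \<Longrightarrow> N h = l"
    using stable_norm_exists by blast
  show thesis
  proof (rule that)
    show "toral_stable_norm N"
      unfolding toral_stable_norm_def using N(1) torus_metric_metric[OF K(1)] by blast
    show "N i = L i \<bullet> i" if "i \<in> I" for i
      by (rule N(2)[OF I_lattice[OF that] min_length_line[OF K that]])
  qed
qed

end

text \<open>As \<open>I\<close> is finite, only finitely many conditions bear on \<open>R\<close>,
  \<open>M\<close> and \<tau>, and constants satisfying all of them exist.\<close>

lemma calibrated_stable_norm: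
  fixes I :: "(real \<times> real) set" and L :: "real \<times> real \<Rightarrow> real \<times> real"
  assumes I: "finite I" "I \<subseteq> lattice"
    and cross: "\<And>i l. i \<in> I \<Longrightarrow> l \<in> I \<Longrightarrow> i \<noteq> l \<Longrightarrow> cross i l \<noteq> 0"
    and diag: "\<And>i. i \<in> I \<Longrightarrow> 0 < L i \<bullet> i"
    and gap: "\<And>i l. i \<in> I \<Longrightarrow> l \<in> I \<Longrightarrow> i \<noteq> l \<Longrightarrow> \<bar>L l \<bullet> i\<bar> < L i \<bullet> i"
  shows "\<exists>N. toral_stable_norm N \<and> (\<forall>i\<in>I. N i = L i \<bullet> i)"
proof -
  have nz: "i \<noteq> 0" if "i \<in> I" for i using diag[OF that] by auto
  define R where "R = 1 + (\<Sum>i\<in>I. \<bar>fst i\<bar> + \<bar>snd i\<bar>)"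
  have "0 \<le> (\<Sum>i\<in>I. \<bar>fst i\<bar> + \<bar>snd i\<bar>)" by (intro sum_nonneg) auto
  then have R1: "1 \<le> R" by (simp add: R_def)
  have R2: "\<bar>fst i\<bar> + \<bar>snd i\<bar> \<le> R" if "i \<in> I" for i
    using member_le_sum[OF that, of "\<lambda>i. \<bar>fst i\<bar> + \<bar>snd i\<bar>"] I(1) by (simp add: R_def)
  define P where "P = {p \<in> I \<times> I. fst p \<noteq> snd p}"
  have P: "finite P" using I(1) by (simp add: P_def)
  define D where "D = (\<lambda>p. cross (fst p) (snd p)) ` P"
  have D: "cross i l \<in> D" if "i \<in> I" "l \<in> I" "i \<noteq> l" for i l
    unfolding D_def using that by (intro image_eqI[of _ _ "(i, l)"]) (simp_all add: P_def)
  have "D \<subseteq> \<int> - {0}"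
  proof
    fix d assume d: "d \<in> D"
    obtain p where p: "p \<in> P" "d = cross (fst p) (snd p)" using d unfolding D_def by blast
    then have "fst p \<in> I" "snd p \<in> I" "fst p \<noteq> snd p" by (auto simp: P_def)
    then have "cross (fst p) (snd p) \<in> \<int>" "cross (fst p) (snd p) \<noteq> 0"
      using cross_Ints[OF subsetD[OF I(2)] subsetD[OF I(2)]] cross by simp_all
    then show "d \<in> \<int> - {0}" by (simp add: p(2))
  qed
  with finite_imageI[OF P] have "\<exists>M\<in>\<int>. 1 \<le> M \<and> (\<forall>d\<in>D. \<exists>k\<in>\<int>. M = k * d)"
    unfolding D_def by (rule finite_common_multiple)
  then obtain M where M: "M \<in> \<int>" "1 \<le> M" and mult: "\<forall>d\<in>D. \<exists>k\<in>\<int>. M = k * d" by blast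
  \<comment> \<open>\<open>r\<close> and \<open>s\<close> are the upper bounds that
    \<open>tau_diag\<close> and \<open>tau_gap\<close> impose on \<tau>.\<close>
  define r where "r i = L i \<bullet> i / (2 * norm i)" for i
  define s where "s p = (L (fst p) \<bullet> fst p - \<bar>L (snd p) \<bullet> fst p\<bar>) / (2 * norm (fst p))" for p
  have r: "0 < r i" if "i \<in> I" for i using diag[OF that] nz[OF that] by (simp add: r_def)
  have s: "0 < s p" if "p \<in> P" for p
    using gap[of "fst p" "snd p"] nz[of "fst p"] that by (auto simp: s_def P_def)
  have "finite (r ` I \<union> s ` P)" using I(1) P by simp
  moreover have "0 < t" if "t \<in> r ` I \<union> s ` P" for t using that r s by blast
  ultimately obtain \<tau> where \<tau>: "0 < \<tau>" "\<And>t. t \<in> r ` I \<union> s ` P \<Longrightarrow> \<tau> \<le> t"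
    using finite_positive_lower_bound[of "r ` I \<union> s ` P"] by blast
  have clear: "2 * \<tau> * norm i \<le> c" if "\<tau> \<le> c / (2 * norm i)" "i \<in> I" for c i
    using that nz[OF that(2)] by (simp add: field_simps)
  have "line_metric I L R M \<tau>"
  proof
    show "i \<in> lattice" if "i \<in> I" for i using I(2) that by blast
    show "\<exists>k\<in>\<int>. M = k * cross i l" if "i \<in> I" "l \<in> I" "i \<noteq> l" for i l
      by (rule bspec[OF mult D[OF that]])
    show "2 * \<tau> * norm i \<le> L i \<bullet> i" if "i \<in> I" for i
      using \<tau>(2)[of "r i"] that by (intro clear) (simp_all add: r_def)
    show "2 * \<tau> * norm i \<le> L i \<bullet> i - \<bar>L l \<bullet> i\<bar>" if "i \<in> I" "l \<in> I" "i \<noteq> l" for i l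
    proof (rule clear)
      have "(i, l) \<in> P" using that by (simp add: P_def)
      then have "\<tau> \<le> s (i, l)" by (intro \<tau>(2)) blast
      then show "\<tau> \<le> (L i \<bullet> i - \<bar>L l \<bullet> i\<bar>) / (2 * norm i)" by (simp add: s_def)
    qed (rule that(1))
  qed (fact I(1) nz R1 R2 M \<tau>(1))+
  then interpret line_metric I L R M \<tau> .
  show ?thesis by (rule stable_norm_on_lines) blast
qed

section \<open>Interpolation of strictly convex norms\<close>

lemma is_normD:
  assumes "is_norm N"
  shows "0 \<le> N x" "N x = 0 \<longleftrightarrow> x = 0" "N (c *\<^sub>R x) = \<bar>c\<bar> * N x" "N (x + y) \<le> N x + N y"
  using assms unfolding is_norm_def by blast+

lemma is_norm_minus: "is_norm N \<Longrightarrow> N (- x) = N x"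
  using is_normD(3)[of N "-1" x] by simp

lemma is_norm_triangle_diff: assumes "is_norm N" shows "\<bar>N x - N y\<bar> \<le> N (x - y)"
  using is_normD(4)[OF assms, of y "x - y"] is_normD(4)[OF assms, of x "y - x"]
    is_norm_minus[OF assms, of "x - y"] by simp

lemma abs_fst_le_norm: "\<bar>fst x\<bar> \<le> norm x" and abs_snd_le_norm: "\<bar>snd x\<bar> \<le> norm x"
  for x :: "real \<times> real"
  using norm_fst_le[of "fst x" "snd x"] norm_snd_le[of "snd x" "fst x"] by auto

lemma is_norm_le_norm:
  assumes "is_norm N" shows "N x \<le> (N (1, 0) + N (0, 1)) * norm x"
proof -
  have "x = fst x *\<^sub>R (1, 0) + snd x *\<^sub>R (0, 1)" by (simp add: prod_eq_iff)
  then have "N x \<le> N (fst x *\<^sub>R (1, 0)) + N (snd x *\<^sub>R (0, 1))" using is_normD(4)[OF assms] by metis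
  also have "\<dots> = \<bar>fst x\<bar> * N (1, 0) + \<bar>snd x\<bar> * N (0, 1)" by (simp only: is_normD(3)[OF assms])
  also have "\<dots> \<le> norm x * N (1, 0) + norm x * N (0, 1)"
    by (intro add_mono mult_right_mono is_normD(1)[OF assms] abs_fst_le_norm abs_snd_le_norm)
  finally show ?thesis by (simp add: algebra_simps)
qed

lemma is_norm_ge_norm:
  assumes "is_norm N" shows "\<exists>c>0. \<forall>x. c * norm x \<le> N x"
proof -
  define C where "C = N (1, 0) + N (0, 1)"
  have "continuous_on (sphere 0 1) N"
  proof (rule continuous_on_subset[OF lipschitz_on_continuous_on subset_UNIV])
    show "C-lipschitz_on UNIV N"
    proof (rule lipschitz_onI)
      show "dist (N x) (N y) \<le> C * dist x y" for x y
        unfolding dist_norm C_def real_norm_def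
        by (rule order_trans[OF is_norm_triangle_diff[OF assms] is_norm_le_norm[OF assms]])
    qed (simp add: C_def is_normD(1)[OF assms])
  qed
  moreover have "(1, 0) \<in> sphere (0 :: real \<times> real) 1" by (simp add: norm_prod_def)
  then have "sphere (0 :: real \<times> real) 1 \<noteq> {}" by blast
  ultimately obtain u where u: "u \<in> sphere 0 1" "\<forall>x\<in>sphere 0 1. N u \<le> N x"
    using continuous_attains_inf[OF compact_sphere] by blast
  have "u \<noteq> 0" using u(1) by auto
  then have "0 < N u" using is_normD(1,2)[OF assms, of u] by simp
  moreover have "N u * norm x \<le> N x" for x
  proof (cases "x = 0")
    case False
    then have "N u \<le> N (inverse (norm x) *\<^sub>R x)" using u(2) by simp
    also have "\<dots> = N x / norm x" by (simp add: is_normD(3)[OF assms] field_simps)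
    finally show ?thesis using False by (simp add: field_simps)
  qed (use is_normD(1)[OF assms] in simp)
  ultimately show ?thesis by blast
qed

text \<open>In the plane a supporting functional is a subgradient of one convex function of a real
  variable, the restriction of \<open>N\<close> to the line through \<open>p\<close> orthogonal to
  \<open>p\<close>.\<close>

lemma supporting_functional:
  assumes N: "is_norm N" and p: "p \<noteq> 0"
  shows "\<exists>a. a \<bullet> p = N p \<and> (\<forall>x. \<bar>a \<bullet> x\<bar> \<le> N x)"
proof -
  define w where "w = (- snd p, fst p)"
  define f where "f t = N (p + t *\<^sub>R w)" for t
  have "convex_on UNIV f"
  proof (rule convex_onI)
    fix t x y :: real assume t: "0 < t" "t < 1"
    have "p + ((1 - t) *\<^sub>R x + t *\<^sub>R y) *\<^sub>R w = (1 - t) *\<^sub>R (p + x *\<^sub>R w) + t *\<^sub>R (p + y *\<^sub>R w)"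
      by (simp add: algebra_simps)
    then have "f ((1 - t) *\<^sub>R x + t *\<^sub>R y) \<le> N ((1 - t) *\<^sub>R (p + x *\<^sub>R w)) + N (t *\<^sub>R (p + y *\<^sub>R w))"
      unfolding f_def using is_normD(4)[OF N] by metis
    then show "f ((1 - t) *\<^sub>R x + t *\<^sub>R y) \<le> (1 - t) * f x + t * f y"
      using t by (simp add: is_normD(3)[OF N] f_def)
  qed simp
  from convex_le_Inf_differential[OF this, of 0] obtain c where c: "\<And>t. N p + c * t \<le> N (p + t *\<^sub>R w)"
    by (fastforce simp: f_def)
  \<comment> \<open>Scaling gives this only for a positive coefficient of \<open>p\<close>. Adding
    \<open>k *\<^sub>R p\<close> reaches that case: the left side grows by exactly
    \<open>k * N p\<close>, the right side by at most as much.\<close>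
  have below: "\<alpha> * N p + c * \<beta> \<le> N (\<alpha> *\<^sub>R p + \<beta> *\<^sub>R w)" for \<alpha> \<beta>
  proof -
    define k where "k = \<bar>\<alpha>\<bar> + 1"
    have k: "0 \<le> k" "0 < \<alpha> + k" by (auto simp: k_def)
    have "(\<alpha> + k) * N p + c * \<beta> = (\<alpha> + k) * (N p + c * (\<beta> / (\<alpha> + k)))"
      using k by (simp add: distrib_left)
    also have "\<dots> \<le> (\<alpha> + k) * N (p + (\<beta> / (\<alpha> + k)) *\<^sub>R w)"
      using k by (intro mult_left_mono c) auto
    also have "\<dots> = N ((\<alpha> + k) *\<^sub>R (p + (\<beta> / (\<alpha> + k)) *\<^sub>R w))"
      using k by (simp add: is_normD(3)[OF N])
    also have "(\<alpha> + k) *\<^sub>R (p + (\<beta> / (\<alpha> + k)) *\<^sub>R w) = (\<alpha> *\<^sub>R p + \<beta> *\<^sub>R w) + k *\<^sub>R p"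
      using k by (simp add: scaleR_add_right scaleR_add_left)
    also have "N \<dots> \<le> N (\<alpha> *\<^sub>R p + \<beta> *\<^sub>R w) + k * N p"
      using is_normD(4)[OF N, of "\<alpha> *\<^sub>R p + \<beta> *\<^sub>R w" "k *\<^sub>R p"] k by (simp add: is_normD(3)[OF N])
    finally show ?thesis by (simp add: algebra_simps)
  qed
  define a where "a = (N p / (p \<bullet> p)) *\<^sub>R p + (c / (p \<bullet> p)) *\<^sub>R w"
  have pp: "p \<bullet> p \<noteq> 0" using p by simp
  have le: "a \<bullet> x \<le> N x" for x
  proof -
    \<comment> \<open>Orthogonal expansion: \<open>w\<close> is \<open>p\<close> turned by a right
      angle and has the same length.\<close>
    have "(p \<bullet> p) *\<^sub>R x = (p \<bullet> x) *\<^sub>R p + (w \<bullet> x) *\<^sub>R w"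
      by (cases p; cases x) (simp add: w_def algebra_simps)
    then have "x = (1 / (p \<bullet> p)) *\<^sub>R ((p \<bullet> x) *\<^sub>R p + (w \<bullet> x) *\<^sub>R w)"
      using pp by (metis divideR_right divide_inverse_commute mult.right_neutral inverse_eq_divide)
    then have x: "x = ((p \<bullet> x) / (p \<bullet> p)) *\<^sub>R p + ((w \<bullet> x) / (p \<bullet> p)) *\<^sub>R w"
      by (simp add: scaleR_add_right)
    have "a \<bullet> x = ((p \<bullet> x) / (p \<bullet> p)) * N p + c * ((w \<bullet> x) / (p \<bullet> p))"
      by (simp add: a_def inner_add_left)
    also have "\<dots> \<le> N (((p \<bullet> x) / (p \<bullet> p)) *\<^sub>R p + ((w \<bullet> x) / (p \<bullet> p)) *\<^sub>R w)" by (rule below)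
    finally show ?thesis using x by simp
  qed
  have "w \<bullet> p = 0" by (cases p) (simp add: w_def)
  then have "a \<bullet> p = N p" using pp by (simp add: a_def inner_add_left)
  moreover have "\<bar>a \<bullet> x\<bar> \<le> N x" for x
    using le[of x] le[of "- x"] is_norm_minus[OF N, of x] by simp
  ultimately show ?thesis by blast
qed

lemma cross_nonzero_independent:
  assumes "cross x y \<noteq> 0" shows "x \<noteq> y" "independent {x, y}"
proof -
  show ne: "x \<noteq> y" using assms cross_self[of x] by auto
  have "x \<notin> span {y}"
  proof
    assume "x \<in> span {y}"
    then obtain k where "x = k *\<^sub>R y" by (auto simp: span_singleton)
    then show False using assms by (simp add: cross_def)
  qed
  moreover have "y \<noteq> 0" using assms by (auto simp: cross_def)
  ultimately show "independent {x, y}" using ne by (simp add: independent_insert)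
qed

text \<open>If \<open>a\<close> also attained \<open>N\<close> at \<open>i\<close> up to sign, it
  would attain it at the sum of \<open>l\<close> and the signed \<open>i\<close>. The triangle
  inequality would then be an equality for two independent vectors.\<close>

lemma strictly_convex_support:
  assumes N: "strictly_convex_norm N" and a: "a \<bullet> l = N l" "\<And>x. \<bar>a \<bullet> x\<bar> \<le> N x"
    and il: "cross i l \<noteq> 0"
  shows "\<bar>a \<bullet> i\<bar> < N i"
proof (rule ccontr)
  assume "\<not> \<bar>a \<bullet> i\<bar> < N i"
  then have eq: "\<bar>a \<bullet> i\<bar> = N i" using a(2)[of i] by linarith
  have norm: "is_norm N" using N by (simp add: strictly_convex_norm_def)
  define s where "s = (if 0 \<le> a \<bullet> i then 1 else -1 :: real)"
  have s: "a \<bullet> (s *\<^sub>R i) = N (s *\<^sub>R i)" "cross (s *\<^sub>R i) l \<noteq> 0"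
    using eq il by (auto simp: s_def cross_def is_norm_minus[OF norm])
  then have "N (s *\<^sub>R i + l) < N (s *\<^sub>R i) + N l"
    using N cross_nonzero_independent[OF s(2)] unfolding strictly_convex_norm_def by blast
  then show False using a(1) a(2)[of "s *\<^sub>R i + l"] s(1) by (simp add: inner_add_right del: inner_scaleR_right)
qed

text \<open>Distinct parallel vectors would make a determinant vanish. One vector per direction
  suffices, since norms are homogeneous.\<close>

lemma direction_representatives:
  fixes S :: "(real \<times> real) set"
  assumes "finite S"
  shows "\<exists>I\<subseteq>S. 0 \<notin> I \<and> (\<forall>i\<in>I. \<forall>l\<in>I. i \<noteq> l \<longrightarrow> cross i l \<noteq> 0) \<and>
    (\<forall>v\<in>S. v = 0 \<or> (\<exists>i\<in>I. \<exists>c. v = c *\<^sub>R i))"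
  using assms
proof (induction S rule: finite_induct)
  case (insert v S)
  then obtain I where I: "I \<subseteq> S" "0 \<notin> I" "\<forall>i\<in>I. \<forall>l\<in>I. i \<noteq> l \<longrightarrow> cross i l \<noteq> 0"
    "\<forall>v\<in>S. v = 0 \<or> (\<exists>i\<in>I. \<exists>c. v = c *\<^sub>R i)" by blast
  show ?case
  proof (cases "v = 0 \<or> (\<exists>i\<in>I. cross i v = 0)")
    case True
    then have "v = 0 \<or> (\<exists>i\<in>I. \<exists>c. v = c *\<^sub>R i)" using I(2) cross_eq_0D by metis
    then show ?thesis using I by (intro exI[of _ I]) auto
  next
    case False
    have "cross v i \<noteq> 0" if "i \<in> I" for i
      using False that by (auto simp: cross_def mult.commute)
    moreover have "\<exists>c. v = c *\<^sub>R v" by (rule exI[of _ 1]) simp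
    ultimately show ?thesis using I False by (intro exI[of _ "insert v I"]) (simp, blast)
  qed
qed simp

lemma interpolating_stable_norm:
  assumes N: "strictly_convex_norm N" and S: "finite S" "S \<subseteq> lattice"
  shows "\<exists>N'. toral_stable_norm N' \<and> (\<forall>v\<in>S. N' v = N v)"
proof -
  have norm: "is_norm N" using N by (simp add: strictly_convex_norm_def)
  obtain I where I: "I \<subseteq> S" "0 \<notin> I" "\<And>i l. i \<in> I \<Longrightarrow> l \<in> I \<Longrightarrow> i \<noteq> l \<Longrightarrow> cross i l \<noteq> 0"
    and dir: "\<And>v. v \<in> S \<Longrightarrow> v = 0 \<or> (\<exists>i\<in>I. \<exists>c. v = c *\<^sub>R i)"
    using direction_representatives[OF S(1)] by metis
  obtain L where L: "\<And>p. p \<noteq> 0 \<Longrightarrow> L p \<bullet> p = N p" "\<And>p x. p \<noteq> 0 \<Longrightarrow> \<bar>L p \<bullet> x\<bar> \<le> N x"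
    using supporting_functional[OF norm] by metis
  have nz: "i \<noteq> 0" if "i \<in> I" for i using that I(2) by auto
  have pos: "0 < N i" if "i \<in> I" for i
    using is_normD(1,2)[OF norm, of i] nz[OF that] by simp
  have L_less: "\<bar>L l \<bullet> i\<bar> < L i \<bullet> i" if "i \<in> I" "l \<in> I" "i \<noteq> l" for i l
    using strictly_convex_support[OF N L(1) L(2) I(3)[OF that]] nz that L(1) by simp
  have L_pos: "0 < L i \<bullet> i" if "i \<in> I" for i using pos nz L(1) that by simp
  obtain N' where N': "toral_stable_norm N'" "\<forall>i\<in>I. N' i = L i \<bullet> i"
    using calibrated_stable_norm[OF finite_subset[OF I(1) S(1)] subset_trans[OF I(1) S(2)] I(3) L_pos L_less]
    by blast
  have norm': "is_norm N'" using N'(1) by (auto simp: toral_stable_norm_def is_stable_norm_def)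
  have "N' v = N v" if v: "v \<in> S" for v
  proof (cases "v = 0")
    case True
    then show ?thesis using is_normD(2)[OF norm, of v] is_normD(2)[OF norm', of v] by simp
  next
    case False
    then obtain i c where "i \<in> I" "v = c *\<^sub>R i" using dir[OF v] by blast
    then show ?thesis using N'(2) L(1) nz by (simp add: is_normD(3)[OF norm] is_normD(3)[OF norm'])
  qed
  then show ?thesis using N'(1) by blast
qed

text \<open>Scale \<open>y\<close> by \<open>n\<close> and round to a lattice point, where the norms
  agree. The ball contains the two basis vectors, so both norms have the same Lipschitz constant;
  each loses at most twice that constant by rounding, and division by \<open>n\<close> gives the
  bound.\<close>

lemma norm_eq_on_lattice_ball:
  assumes N: "is_norm N" "is_norm N'" and n: "1 \<le> n" and y: "norm y \<le> B" and R: "1 \<le> R" "real n * B + 2 \<le> R"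
    and eq: "\<And>v. v \<in> lattice \<Longrightarrow> norm v \<le> R \<Longrightarrow> N' v = N v"
  shows "\<bar>N' y - N y\<bar> \<le> 4 * (N (1, 0) + N (0, 1)) / real n"
proof -
  let ?C = "N (1, 0) + N (0, 1)"
  define v where "v = lattice_floor (real n *\<^sub>R y)"
  have C': "N' (1, 0) + N' (0, 1) = ?C"
    using eq[of "(1, 0)"] eq[of "(0, 1)"] R(1) by (simp add: norm_prod_def)
  have C0: "0 \<le> ?C" using is_normD(1)[OF N(1)] by simp
  have d: "norm (real n *\<^sub>R y - v) \<le> 2"
    using norm_lattice_floor_diff[of "real n *\<^sub>R y"] by (simp add: v_def norm_minus_commute)
  have "norm v \<le> norm (real n *\<^sub>R y) + norm (real n *\<^sub>R y - v)"
    using norm_triangle_ineq4[of "real n *\<^sub>R y" "real n *\<^sub>R y - v"] by simp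
  also have "\<dots> \<le> real n * B + 2" using d y by (auto intro!: add_mono mult_left_mono)
  finally have v: "N' v = N v" using R(2) by (intro eq) (simp only: v_def lattice_floor_in_lattice, linarith)
  have "\<bar>M (real n *\<^sub>R y) - M v\<bar> \<le> ?C * 2"
    if "is_norm M" "M (1, 0) + M (0, 1) = ?C" for M
  proof -
    have "\<bar>M (real n *\<^sub>R y) - M v\<bar> \<le> ?C * norm (real n *\<^sub>R y - v)"
      using is_norm_triangle_diff[OF that(1)] is_norm_le_norm[OF that(1)] order_trans unfolding that(2) by blast
    also have "\<dots> \<le> ?C * 2" by (rule mult_left_mono[OF d C0])
    finally show ?thesis .
  qed
  from this[OF N(1) refl] this[OF N(2) C'] v
  have "\<bar>N' (real n *\<^sub>R y) - N (real n *\<^sub>R y)\<bar> \<le> 4 * ?C" by linarith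
  then have "real n * \<bar>N' y - N y\<bar> \<le> 4 * ?C"
    by (simp add: is_normD(3)[OF N(1)] is_normD(3)[OF N(2)] abs_mult flip: right_diff_distrib)
  then show ?thesis using n by (simp add: field_simps)
qed

lemma finite_lattice_ball: "finite {v \<in> lattice. norm v \<le> R}"
proof (rule finite_subset)
  define Z where "Z = (of_int ` {- \<lceil>R\<rceil>..\<lceil>R\<rceil>} :: real set)"
  have Z: "x \<in> Z" if x: "x \<in> \<int>" "\<bar>x\<bar> \<le> R" for x
  proof -
    obtain m :: int where m: "x = of_int m" using x(1) by (auto elim: Ints_cases)
    then have "- \<lceil>R\<rceil> \<le> m" "m \<le> \<lceil>R\<rceil>" using x(2) by linarith+
    then show ?thesis using m by (simp add: Z_def)
  qed
  show "finite (Z \<times> Z)" by (simp add: Z_def)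
  show "{v \<in> lattice. norm v \<le> R} \<subseteq> Z \<times> Z"
  proof
    fix v :: "real \<times> real" assume "v \<in> {v \<in> lattice. norm v \<le> R}"
    then have "fst v \<in> \<int>" "snd v \<in> \<int>" "norm v \<le> R" by auto
    then have "fst v \<in> Z" "snd v \<in> Z"
      using order_trans[OF abs_fst_le_norm[of v]] order_trans[OF abs_snd_le_norm[of v]] by (auto intro: Z)
    then show "v \<in> Z \<times> Z" by (simp add: mem_Times_iff)
  qed
qed

theorem theorem1p3:
  fixes Ninf :: "real \<times> real \<Rightarrow> real"
    and h :: "nat \<Rightarrow> real \<times> real"
  assumes "strictly_convex_norm Ninf"
    and "h ` {1..} = lattice"
    and "\<And>j. j \<ge> 1 \<Longrightarrow> Ninf (h j) \<le> Ninf (h (j + 1))"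
  shows "\<exists>N :: nat \<Rightarrow> real \<times> real \<Rightarrow> real.
     (\<forall>k\<ge>1. toral_stable_norm (N k)) \<and>
     (\<forall>k\<ge>1. (\<forall>j\<in>{1..k}. N k (h j) = Ninf (h j)) \<and>
             (\<forall>j\<ge>k + 1. N k (h j) \<ge> Ninf (h k))) \<and>
     (\<forall>K. compact K \<longrightarrow> uniform_limit K N Ninf sequentially)"
proof -
  have norm: "is_norm Ninf" using assms(1) by (simp add: strictly_convex_norm_def)
  have "\<exists>N. toral_stable_norm N \<and> (\<forall>v\<in>{v \<in> lattice. norm v \<le> R}. N v = Ninf v)" for R
    by (rule interpolating_stable_norm[OF assms(1) finite_lattice_ball]) blast
  then obtain F where F: "\<And>R. toral_stable_norm (F R)"
    "\<And>R v. v \<in> lattice \<Longrightarrow> norm v \<le> R \<Longrightarrow> F R v = Ninf v"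
    by (simp only: mem_Collect_eq Ball_def) metis
  have F_norm: "is_norm (F R)" for R
    using F(1)[of R] by (auto simp: toral_stable_norm_def is_stable_norm_def)
  define C where "C = 4 * (Ninf (1, 0) + Ninf (0, 1))"
  have near: "\<bar>F R y - Ninf y\<bar> \<le> C / real n"
    if "1 \<le> n" "norm y \<le> B" "1 \<le> R" "real n * B + 2 \<le> R" for R B n y
    unfolding C_def by (rule norm_eq_on_lattice_ball[OF norm F_norm that]) (rule F(2))
  obtain c where c: "0 < c" "\<And>x. c * norm x \<le> Ninf x" using is_norm_ge_norm[OF norm] by blast
  \<comment> \<open>With \<open>n0 = m + 1\<close> the error on unit vectors drops below
    \<open>c / 2\<close>, half of a lower bound for \<open>Ninf\<close> there. This is what
    \<open>half\<close> uses, with \<open>B = 1\<close>.\<close>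
  obtain m :: nat where m: "real m > 2 * C / c" using reals_Archimedean2 by blast
  define n0 where "n0 = m + 1"
  have n0: "C / real n0 < c / 2"
  proof -
    have "2 * C / c < real n0" using m by (simp add: n0_def)
    then show ?thesis using c(1) by (simp add: field_simps n0_def)
  qed
  have half: "Ninf y / 2 \<le> F R y" if R: "real n0 + 2 \<le> R" for R y
  proof (cases "y = 0")
    case False
    define w where "w = inverse (norm y) *\<^sub>R y"
    have y: "y = norm y *\<^sub>R w" and w: "norm w = 1" using False by (auto simp: w_def)
    have "\<bar>F R w - Ninf w\<bar> \<le> C / real n0"
      by (rule near[where B=1]) (use R w in \<open>auto simp: n0_def\<close>)
    moreover have "c \<le> Ninf w" using c(2)[of w] w by simp
    ultimately have "Ninf w / 2 \<le> F R w" using n0 unfolding abs_le_iff by linarith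
    then have "norm y * (Ninf w / 2) \<le> norm y * F R w" by (intro mult_left_mono) auto
    then show ?thesis
      using is_normD(3)[OF norm, of "norm y" w] is_normD(3)[OF F_norm, of R "norm y" w] y by simp
  qed (use is_normD(2)[OF norm, of 0] is_normD(2)[OF F_norm, of R 0] in simp)
  \<comment> \<open>The summand \<open>k\<close> makes the balls exhaust the plane,
    \<open>n0 + 2\<close> is the radius needed for \<open>half\<close>, and the last summand puts
    the first \<open>k\<close> classes inside the ball and ensures that \<open>Ninf\<close> is at
    least \<open>2 * Ninf (h k)\<close> outside it.\<close>
  define \<rho> where "\<rho> k = real k + real n0 + 2 + 2 * Ninf (h k) / c" for k
  have Nh: "0 \<le> 2 * Ninf (h k) / c" for k using is_normD(1)[OF norm, of "h k"] c(1) by simp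
  have \<rho>: "real k \<le> \<rho> k" "1 \<le> \<rho> k" "real n0 + 2 \<le> \<rho> k" "2 * Ninf (h k) / c \<le> \<rho> k" for k
    using Nh[of k] unfolding \<rho>_def by linarith+
  have h_lattice: "h j \<in> lattice" if "1 \<le> j" for j using assms(2) that by blast
  have h_mono: "Ninf (h i) \<le> Ninf (h j)" if "1 \<le> i" "i \<le> j" for i j
    using that(2)
  proof (induction rule: dec_induct)
    case (step n)
    then show ?case using assms(3)[of n] that(1) by simp
  qed simp
  show ?thesis
  proof (intro exI[of _ "\<lambda>k. F (\<rho> k)"] conjI allI impI ballI)
    show "toral_stable_norm (F (\<rho> k))" for k by (rule F(1))
  next
    fix k j :: nat assume k: "1 \<le> k" and j: "j \<in> {1..k}"
    have j1: "1 \<le> j" "j \<le> k" using j by auto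
    have "c * norm (h j) \<le> Ninf (h k)" by (rule order_trans[OF c(2) h_mono[OF j1]])
    then have "norm (h j) \<le> Ninf (h k) / c" using c(1) by (simp add: field_simps)
    then have "norm (h j) \<le> \<rho> k" using Nh[of k] \<rho>(4)[of k] by linarith
    then show "F (\<rho> k) (h j) = Ninf (h j)" by (rule F(2)[OF h_lattice[OF j1(1)]])
  next
    fix k j :: nat assume k: "1 \<le> k" and j: "k + 1 \<le> j"
    show "Ninf (h k) \<le> F (\<rho> k) (h j)"
    proof (cases "norm (h j) \<le> \<rho> k")
      case True
      have "Ninf (h k) \<le> Ninf (h j)" using h_mono[of k j] k j by simp
      moreover have "1 \<le> j" using j by simp
      ultimately show ?thesis using F(2)[OF h_lattice True] by simp
    \<comment> \<open>A class outside the ball of agreement: its norm may have dropped, but by at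
      most the factor 2 that the radius provides for.\<close>
    next
      case False
      then have "2 * Ninf (h k) / c \<le> norm (h j)" using \<rho>(4)[of k] by linarith
      then have "2 * Ninf (h k) \<le> c * norm (h j)" using c(1) by (simp add: field_simps)
      then show ?thesis using c(2)[of "h j"] half[OF \<rho>(3), of "h j" k] by linarith
    qed
  next
    fix K :: "(real \<times> real) set" assume "compact K"
    then have "bounded K" by (rule compact_imp_bounded)
    then obtain B where B: "\<forall>y\<in>K. norm y \<le> B" unfolding bounded_iff by blast
    show "uniform_limit K (\<lambda>k. F (\<rho> k)) Ninf sequentially"
    proof (rule uniform_limitI)
      fix e :: real assume e: "0 < e"
      obtain p :: nat where p: "real p > C / e" using reals_Archimedean2 by blast
      define n where "n = p + 1"
      have "C / e < real n" using p by (simp add: n_def)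
      then have n: "C / real n < e" using e by (simp add: field_simps n_def)
      obtain k0 :: nat where k0: "real n * B + 2 \<le> real k0" using real_arch_simple by blast
      have "dist (F (\<rho> k) y) (Ninf y) < e" if "k0 \<le> k" "y \<in> K" for k y
      proof -
        have "real k0 \<le> real k" using that(1) by simp
        then have "real n * B + 2 \<le> \<rho> k" using k0 \<rho>(1)[of k] by linarith
        then have "\<bar>F (\<rho> k) y - Ninf y\<bar> \<le> C / real n"
          by (rule near[OF _ bspec[OF B that(2)] \<rho>(2), rotated]) (simp add: n_def)
        then show ?thesis using n by (simp add: dist_real_def)
      qed
      then show "\<forall>\<^sub>F k in sequentially. \<forall>y\<in>K. dist (F (\<rho> k) y) (Ninf y) < e"
        unfolding eventually_sequentially by blast
    qed
  qed
qed

end
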